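(* Let $c_1>c_2>1$, $0<\alpha<1$, $\Delta>0$ be reals. There exist a constant $\gamma=\gamma(c_1,c_2,\alpha,\Delta)>0$ and an algorithm that, given an $n$-vertex graph $G=(V,E)$ with maximum degree at most $\Delta$ and $|E|/|V|\ge c_1$, finds in time polynomial in $n$ either a nonempty subset $W\subset V$ of size $|W|\le\alpha n$ spanning at least $c_2|W|$ edges in $G$, or an induced subgraph $G^*=(V^*,E^* )$ of $G$ on at least $\alpha n$ vertices which is a $\gamma$-expander.
   Context: Graphs are finite and simple. The parameters $c_1,c_2,\alpha,\Delta$ are fixed; the algorithm may depend on them. A set $W\subset V$ spans an edge if both endpoints of the edge lie in $W$. For a graph $G=(V,E)$ and $W\subset V$, the external neighborhood is $N_G(W)=\{v\in V\setminus W: v \text{ has a neighbor in } W\}$. For $\gamma>0$, a graph $G=(V,E)$ on $m$ vertices is a $\gamma$-expander if $|N_G(W)|\ge \gamma|W|$ for every $W\subset V$ with $|W|\le m/2$. *)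

theory Defs
  imports Complex_Main "HOL-Computational_Algebra.Polynomial"
begin

section \<open>Finite simple graphs\<close>

definition simple_graph :: "'a set \<Rightarrow> 'a set set \<Rightarrow> bool" where
  "simple_graph V E \<longleftrightarrow> finite V \<and> (\<forall>e\<in>E. e \<subseteq> V \<and> card e = 2)"

definition vertex_degree :: "'a set set \<Rightarrow> 'a \<Rightarrow> nat" where
  "vertex_degree E v = card {e \<in> E. v \<in> e}"

text \<open>Only meaningful for a finite nonempty vertex set.\<close>

definition max_degree :: "'a set \<Rightarrow> 'a set set \<Rightarrow> nat" where
  "max_degree V E = Max (vertex_degree E ` V)"

definition induced_edges :: "'a set set \<Rightarrow> 'a set \<Rightarrow> 'a set set" where
  "induced_edges E W = {e \<in> E. e \<subseteq> W}"

definition ext_nbhd :: "'a set \<Rightarrow> 'a set set \<Rightarrow> 'a set \<Rightarrow> 'a set" where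
  "ext_nbhd V E W = {v \<in> V - W. \<exists>w\<in>W. {v, w} \<in> E}"

definition expander :: "real \<Rightarrow> 'a set \<Rightarrow> 'a set set \<Rightarrow> bool" where
  "expander \<gamma> V E \<longleftrightarrow>
     (\<forall>W. W \<subseteq> V \<and> real (card W) \<le> real (card V) / 2 \<longrightarrow>
        real (card (ext_nbhd V E W)) \<ge> \<gamma> * real (card W))"


section \<open>Algorithms: random access machine programs\<close>

text \<open>
  The model of computation is the deterministic random access machine with addition and
  truncated subtraction, but no multiplication, in structured form.
  The memory consists of arrays of natural numbers; a program mentions finitely many
  arrays, and the indices may be computed, which gives indirect addressing.

  Every memory access and every arithmetic operation costs one unit. Since no operation
  increases the bit length of the largest number around by more than one, all numbers
  occurring in a run of length \<open>t\<close> have bit length at most \<open>t\<close> plus a term logarithmic in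
  the input and the program constants. Hence polynomial time on this machine is the same
  as polynomial time on a Turing machine (Cook and Reckhow).
\<close>

type_synonym state = "nat \<Rightarrow> nat \<Rightarrow> nat"

datatype aexp =
    Const nat
  | Cell nat aexp
  | Add aexp aexp
  | Sub aexp aexp

text \<open>The array name in \<open>Cell\<close> and \<open>Assign\<close> is a literal; only the index is an expression.\<close>

datatype com =
    Skip
  | Assign nat aexp aexp
  | Seq com com
  | If aexp com com
  | While aexp com

fun aval :: "aexp \<Rightarrow> state \<Rightarrow> nat" where
  "aval (Const k) s = k"
| "aval (Cell a i) s = s a (aval i s)"
| "aval (Add e f) s = aval e s + aval f s"
| "aval (Sub e f) s = aval e s - aval f s"

fun acost :: "aexp \<Rightarrow> nat" where
  "acost (Const k) = 1"
| "acost (Cell a i) = 1 + acost i"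
| "acost (Add e f) = 1 + acost e + acost f"
| "acost (Sub e f) = 1 + acost e + acost f"

definition update :: "state \<Rightarrow> nat \<Rightarrow> nat \<Rightarrow> nat \<Rightarrow> state" where
  "update s a i x = s(a := (s a)(i := x))"

text \<open>
  \<open>exec P s t s'\<close>: started in state \<open>s\<close>, program \<open>P\<close> halts in state \<open>s'\<close> after exactly
  \<open>t\<close> steps. Conditions hold iff the expression is nonzero.
\<close>

inductive exec :: "com \<Rightarrow> state \<Rightarrow> nat \<Rightarrow> state \<Rightarrow> bool" where
  Skip: "exec Skip s 1 s"
| Assign: "exec (Assign a i e) s (1 + acost i + acost e) (update s a (aval i s) (aval e s))"
| Seq: "exec P s t s' \<Longrightarrow> exec Q s' u s'' \<Longrightarrow> exec (Seq P Q) s (t + u) s''"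
| IfTrue: "aval e s \<noteq> 0 \<Longrightarrow> exec P s t s' \<Longrightarrow> exec (If e P Q) s (1 + acost e + t) s'"
| IfFalse: "aval e s = 0 \<Longrightarrow> exec Q s t s' \<Longrightarrow> exec (If e P Q) s (1 + acost e + t) s'"
| WhileFalse: "aval e s = 0 \<Longrightarrow> exec (While e P) s (1 + acost e) s"
| WhileTrue: "aval e s \<noteq> 0 \<Longrightarrow> exec P s t s' \<Longrightarrow> exec (While e P) s' u s'' \<Longrightarrow>
    exec (While e P) s (1 + acost e + t + u) s''"

inductive_cases SkipE: "exec Skip s t s'"
inductive_cases AssignE: "exec (Assign a i e) s t s'"
inductive_cases SeqE: "exec (Seq P Q) s t s'"
inductive_cases IfE: "exec (If e P Q) s t s'"
inductive_cases WhileE: "exec (While e P) s t s'"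

lemma exec_deterministic:
  "exec P s t s' \<Longrightarrow> exec P s u s'' \<Longrightarrow> u = t \<and> s'' = s'"
proof (induction arbitrary: u s'' rule: exec.induct)
  case (Skip s)
  then show ?case by (rule SkipE) simp
next
  case (Assign a i e s)
  then show ?case by (rule AssignE) simp
next
  case (Seq P s t s' Q v r)
  from Seq.prems obtain t1 t2 s1 where
    "exec P s t1 s1" "exec Q s1 t2 s''" "u = t1 + t2" by (rule SeqE)
  then show ?case using Seq.IH by metis
next
  case (IfTrue e s P t s' Q)
  from IfTrue.prems show ?case
    by (rule IfE) (simp_all add: IfTrue.hyps IfTrue.IH)
next
  case (IfFalse e s Q t s' P)
  from IfFalse.prems show ?case
    by (rule IfE) (simp_all add: IfFalse.hyps IfFalse.IH)
next
  case (WhileFalse e s P)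
  from WhileFalse.prems show ?case
    by (rule WhileE) (simp_all add: WhileFalse.hyps)
next
  case (WhileTrue e s P t s' v r)
  from WhileTrue.prems WhileTrue.hyps(1) obtain t1 s1 t2 where
    "u = 1 + acost e + t1 + t2" "exec P s t1 s1" "exec (While e P) s1 t2 s''"
    by (auto elim: WhileE)
  then show ?case using WhileTrue.IH by metis
qed


section \<open>Input and output conventions\<close>

text \<open>
  The input is a graph on the vertex set \<open>{..<n}\<close>: cell 0 of array 0 holds \<open>n\<close>, and array 1
  holds the adjacency matrix row by row, the entry for \<open>(u, v)\<close> being in cell \<open>u * n + v\<close>.
  All other cells are 0.
\<close>

definition graph_input :: "nat \<Rightarrow> nat set set \<Rightarrow> state" where
  "graph_input n E = (\<lambda>a k.
     if a = 0 \<and> k = 0 then n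
     else if a = 1 \<and> k < n * n \<and> {k div n, k mod n} \<in> E then 1
     else 0)"

text \<open>
  The output is a tag, in cell 0 of array 2, and a set of vertices, given by its
  characteristic vector in array 3.
\<close>

definition out_tag :: "state \<Rightarrow> nat" where
  "out_tag s = s 2 0"

definition out_set :: "nat \<Rightarrow> state \<Rightarrow> nat set" where
  "out_set n s = {v \<in> {..<n}. s 3 v \<noteq> 0}"

end

theory Submission
  imports Defs "HOL-Analysis.Analysis"
begin

text \<open>
  The algorithm keeps a vertex set \<open>U\<close> with \<open>e(U) \<ge> F(|U|)\<close> for \<open>F(x) = (p/q) x + x\<^sup>2/(q n)\<close>,
  where \<open>p/q \<ge> c2\<close> and \<open>(p+1)/q \<le> c1\<close>. If \<open>U\<close> splits into two parts and the number of edges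
  between them is a small multiple of the size of the smaller part, then the convexity of \<open>F\<close>
  pays for the lost edges, so one of the parts satisfies the same inequality and replaces \<open>U\<close>.
  Once \<open>|U| \<le> \<alpha> n\<close>, \<open>U\<close> is a dense small set.

  Sparse cuts are searched among the level sets \<open>{u. x u \<ge> x z}\<close> of the vectors \<open>x = M\<^sup>t \<delta>\<^sub>v\<close>, where
  \<open>M = 2 D I - L\<close> with \<open>L\<close> the Laplacian of \<open>G[U]\<close>. These vectors are integral and are
  computed without multiplications. If no level set is sparse for \<open>t < T\<close> with \<open>T\<close> linear in \<open>n\<close>, then by
  Cheeger's inequality each step contracts the centred unit vectors by a constant factor, hence
  also the centred indicator of any set \<open>W\<close>. If \<open>W\<close> had a tiny boundary, its centred indicator
  would have a Rayleigh quotient too close to \<open>2 D\<close> for that.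
\<close>

section \<open>Functions computable in polynomial time\<close>

text \<open>Splitting sizes \<open>a + b\<close> changes \<open>F\<close> by
  \<open>2ab/(qn)\<close>, at least \<open>\<alpha> min(a,b)/q\<close> while
  \<open>a + b > \<alpha> n\<close>; so cuts of at most \<open>min(a,b)/K\<close> edges are
  affordable for a constant \<open>K\<close>. The slack \<open>(p+1)/q \<le> c1\<close> says
  \<open>F(n) \<le> |E|\<close>. Testing expansion exactly is too expensive; a spectral test loses a
  square by Cheeger, and a constant stays a constant. Eigenvectors are not exact integer data, and a
  single start vector may be nearly orthogonal to the bad direction. Every unit vector is therefore
  tried: the indicator of any set is a sum of them, so the loss is polynomial in \<open>n\<close>.
  Logarithmically many rounds would overcome it; linearly many let Bernoulli's inequality do so.
  Only quadratic forms occur, no diagonalisation. For irrational \<open>\<alpha>\<close> the size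
  test uses a rational bound slightly above \<open>\<alpha>\<close>. A set that passes may be too
  large by a few vertices, and the term \<open>x\<^sup>2/(qn)\<close> pays for deleting them as
  well.\<close>

definition agree :: "nat \<Rightarrow> state \<Rightarrow> state \<Rightarrow> bool" where
  "agree m s s' \<longleftrightarrow> (\<forall>a<m. s a = s' a)"

lemma agree_refl: "agree m s s"
  by (simp add: agree_def)

lemma agree_trans: "agree m s s' \<Longrightarrow> agree m s' s'' \<Longrightarrow> agree m s s''"
  by (simp add: agree_def)

lemma agree_mono: "agree m s s' \<Longrightarrow> k \<le> m \<Longrightarrow> agree k s s'"
  by (simp add: agree_def)

lemma agreeD: "agree m s s' \<Longrightarrow> a < m \<Longrightarrow> s a = s' a"
  by (simp add: agree_def)

text \<open>Earlier code leaves garbage in scratch arrays. A value reading only arrays below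
  \<open>m\<close> is unaffected, so operands can be evaluated one after another.\<close>

definition cdep :: "nat \<Rightarrow> (state \<Rightarrow> 'b) \<Rightarrow> bool" where
  "cdep m f \<longleftrightarrow> (\<forall>s s'. agree m s s' \<longrightarrow> f s = f s')"

lemma cdepD: "cdep m f \<Longrightarrow> agree m s s' \<Longrightarrow> f s = f s'"
  by (auto simp: cdep_def)

text \<open>
  The code for \<open>f\<close> can be placed so that it only writes to arrays from any given \<open>d \<ge> m\<close> on;
  this makes it composable without keeping track of scratch arrays.
\<close>

definition cexp :: "nat \<Rightarrow> (state \<Rightarrow> nat) \<Rightarrow> bool" where
  "cexp m f \<longleftrightarrow> 0 < m \<and> cdep m f \<and>
     (\<forall>d\<ge>m. \<exists>P p. \<forall>s. \<exists>t s'. exec P s t s' \<and> t \<le> poly p (s 0 0) \<and> s' d 0 = f s \<and> agree d s' s)"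

lemma cexpI:
  assumes "0 < m" "cdep m f"
    and "\<And>d. d \<ge> m \<Longrightarrow>
      \<exists>P p. \<forall>s. \<exists>t s'. exec P s t s' \<and> t \<le> poly p (s 0 0) \<and> s' d 0 = f s \<and> agree d s' s"
  shows "cexp m f"
  using assms by (simp add: cexp_def)

lemma cexpE:
  assumes "cexp m f" "d \<ge> m"
  obtains P p where "\<And>s. \<exists>t s'. exec P s t s' \<and> t \<le> poly p (s 0 0) \<and> s' d 0 = f s \<and> agree d s' s"
  using assms unfolding cexp_def by meson

lemma cexp_pos: "cexp m f \<Longrightarrow> 0 < m"
  by (simp add: cexp_def)

lemma cexp_dep: "cexp m f \<Longrightarrow> cdep m f"
  by (simp add: cexp_def)

section \<open>Arithmetic, tests and bounded sums\<close>

lemma cexp_const: "0 < m \<Longrightarrow> cexp m (\<lambda>s. k)"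
proof (rule cexpI)
  fix d assume "m \<le> d"
  have "exec (Assign d (Const 0) (Const k)) s 3 (update s d 0 k)" for s
    using exec.Assign[of d "Const 0" "Const k" s] by (simp add: eval_nat_numeral)
  moreover have "3 \<le> poly [:3:] (s 0 0)" for s :: state by simp
  moreover have "agree d (update s d 0 k) s" "update s d 0 k d 0 = k" for s
    by (simp_all add: agree_def update_def)
  ultimately show "\<exists>P p. \<forall>s. \<exists>t s'. exec P s t s' \<and> t \<le> poly p (s 0 0) \<and> s' d 0 = k \<and> agree d s' s"
    by blast
qed (simp_all add: cdep_def)

lemma cexp_cell:
  assumes f: "cexp m f" and a: "a < m"
  shows "cexp m (\<lambda>s. s a (f s))"
proof (rule cexpI)
  show "0 < m" using f by (rule cexp_pos)
  show "cdep m (\<lambda>s. s a (f s))"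
    using cexp_dep[OF f] a unfolding cdep_def agree_def by metis
  fix d assume d: "m \<le> d"
  obtain P p where P: "\<And>s. \<exists>t s'. exec P s t s' \<and> t \<le> poly p (s 0 0) \<and> s' d 0 = f s \<and> agree d s' s"
    using cexpE[OF f d] by blast
  define e where "e = Cell a (Cell d (Const 0))"
  have "\<exists>t s'. exec (Seq P (Assign d (Const 0) e)) s t s' \<and> t \<le> poly (p + [:5:]) (s 0 0)
     \<and> s' d 0 = s a (f s) \<and> agree d s' s" for s
  proof -
    obtain t s1 where 1: "exec P s t s1" "t \<le> poly p (s 0 0)" "s1 d 0 = f s" "agree d s1 s"
      using P by blast
    have "exec (Seq P (Assign d (Const 0) e)) s (t + 5) (update s1 d 0 (s1 a (f s)))"
      using exec.Seq[OF 1(1) exec.Assign[of d "Const 0" e s1]] by (simp add: eval_nat_numeral e_def 1)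
    moreover have "s1 a = s a" using 1(4) a d by (simp add: agree_def)
    ultimately show ?thesis using 1
      by (intro exI[of _ "t + 5"] exI[of _ "update s1 d 0 (s1 a (f s))"])
        (auto simp: agree_def update_def)
  qed
  then show "\<exists>P p. \<forall>s. \<exists>t s'. exec P s t s' \<and> t \<le> poly p (s 0 0) \<and> s' d 0 = s a (f s) \<and> agree d s' s"
    by blast
qed

text \<open>The second operand is computed with base \<open>Suc d\<close>, so the first result, in
  array \<open>d\<close>, survives until \<open>e\<close> combines the two cells.\<close>

lemma cexp_binop:
  assumes f: "cexp m f" and g: "cexp m g"
    and op: "\<And>d. \<exists>e. acost e = 5 \<and> (\<forall>s. aval e s = h (s d 0) (s (Suc d) 0))"
  shows "cexp m (\<lambda>s. h (f s) (g s))"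
proof (rule cexpI)
  show "0 < m" using f by (rule cexp_pos)
  show "cdep m (\<lambda>s. h (f s) (g s))"
    using cexp_dep[OF f] cexp_dep[OF g] by (auto simp: cdep_def)
  fix d assume d: "m \<le> d"
  obtain P p where P: "\<And>s. \<exists>t s'. exec P s t s' \<and> t \<le> poly p (s 0 0) \<and> s' d 0 = f s \<and> agree d s' s"
    using cexpE[OF f d] by blast
  obtain Q q where Q: "\<And>s. \<exists>t s'. exec Q s t s' \<and> t \<le> poly q (s 0 0) \<and> s' (Suc d) 0 = g s
     \<and> agree (Suc d) s' s"
    using cexpE[OF g le_SucI[OF d]] by blast
  obtain e where e: "acost e = 5" "\<And>s. aval e s = h (s d 0) (s (Suc d) 0)" using op by blast
  have "\<exists>t s'. exec (Seq P (Seq Q (Assign d (Const 0) e))) s t s' \<and> t \<le> poly (p + q + [:7:]) (s 0 0)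
     \<and> s' d 0 = h (f s) (g s) \<and> agree d s' s" for s
  proof -
    obtain t s1 where 1: "exec P s t s1" "t \<le> poly p (s 0 0)" "s1 d 0 = f s" "agree d s1 s"
      using P by blast
    obtain u s2 where 2: "exec Q s1 u s2" "u \<le> poly q (s1 0 0)" "s2 (Suc d) 0 = g s1"
      "agree (Suc d) s2 s1"
      using Q by blast
    have eq: "g s1 = g s" "s1 0 = s 0" "s2 d = s1 d"
      using cdepD[OF cexp_dep[OF g] agree_mono[OF 1(4) d]] 1(4) 2(4) d cexp_pos[OF f]
      by (auto simp: agree_def)
    let ?s = "update s2 d 0 (h (f s) (g s))"
    have "exec (Assign d (Const 0) e) s2 7 ?s"
      using exec.Assign[of d "Const 0" e s2] by (simp add: eval_nat_numeral e 1 2 eq)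
    then have "exec (Seq P (Seq Q (Assign d (Const 0) e))) s (t + (u + 7)) ?s"
      using 1(1) 2(1) by (blast intro: exec.Seq)
    moreover have "t + (u + 7) \<le> poly (p + q + [:7:]) (s 0 0)" using 1(2) 2(2) eq by simp
    moreover have "agree d ?s s" "?s d 0 = h (f s) (g s)"
      using 1(4) 2(4) by (auto simp: agree_def update_def)
    ultimately show ?thesis by blast
  qed
  then show "\<exists>P p. \<forall>s. \<exists>t s'. exec P s t s' \<and> t \<le> poly p (s 0 0) \<and> s' d 0 = h (f s) (g s)
      \<and> agree d s' s"
    by blast
qed

lemma cexp_add: "cexp m f \<Longrightarrow> cexp m g \<Longrightarrow> cexp m (\<lambda>s. f s + g s)"
proof (rule cexp_binop[where h = "(+)"])
  show "\<exists>e. acost e = 5 \<and> (\<forall>s. aval e s = s d 0 + s (Suc d) 0)" for d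
    by (rule exI[of _ "Add (Cell d (Const 0)) (Cell (Suc d) (Const 0))"]) simp
qed

lemma cexp_diff: "cexp m f \<Longrightarrow> cexp m g \<Longrightarrow> cexp m (\<lambda>s. f s - g s)"
proof (rule cexp_binop[where h = "(-)"])
  show "\<exists>e. acost e = 5 \<and> (\<forall>s. aval e s = s d 0 - s (Suc d) 0)" for d
    by (rule exI[of _ "Sub (Cell d (Const 0)) (Cell (Suc d) (Const 0))"]) simp
qed

lemma cexp_mult_const:
  assumes "cexp m f"
  shows "cexp m (\<lambda>s. k * f s)"
proof (induction k)
  case 0
  show ?case using cexp_const[OF cexp_pos[OF assms], of 0] by simp
next
  case (Suc k)
  show ?case using cexp_add[OF assms Suc] by simp
qed

definition cbool :: "nat \<Rightarrow> (state \<Rightarrow> bool) \<Rightarrow> bool" where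
  "cbool m b \<longleftrightarrow> cexp m (\<lambda>s. if b s then 1 else 0)"

lemma cexp_cong: "cexp m f \<Longrightarrow> (\<And>s. f s = g s) \<Longrightarrow> cexp m g"
  by (metis ext)

lemma cbool_pos: "cbool m b \<Longrightarrow> 0 < m"
  by (simp add: cbool_def cexp_pos)

text \<open>With truncated subtraction, \<open>1 - (f - g)\<close> is the indicator of
  \<open>f \<le> g\<close>. Conjunction is \<open>b + c - 1\<close> in the same spirit, and the
  remaining tests reduce to these.\<close>

lemma cbool_le:
  assumes "cexp m f" "cexp m g"
  shows "cbool m (\<lambda>s. f s \<le> g s)"
  unfolding cbool_def
  by (rule cexp_cong[OF cexp_diff[OF cexp_const[of m 1] cexp_diff[OF assms]]])
    (use cexp_pos[OF assms(1)] in auto)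

lemma cbool_not:
  assumes "cbool m b"
  shows "cbool m (\<lambda>s. \<not> b s)"
  unfolding cbool_def
  by (rule cexp_cong[OF cexp_diff[OF cexp_const[of m 1] assms[unfolded cbool_def]]])
    (use cbool_pos[OF assms(1)] in auto)

lemma cbool_conj:
  assumes "cbool m b" "cbool m c"
  shows "cbool m (\<lambda>s. b s \<and> c s)"
  unfolding cbool_def
  by (rule cexp_cong[OF cexp_diff[OF cexp_add[OF assms[unfolded cbool_def]] cexp_const[of m 1]]])
    (use cbool_pos[OF assms(1)] in auto)

lemma cbool_disj: "cbool m b \<Longrightarrow> cbool m c \<Longrightarrow> cbool m (\<lambda>s. b s \<or> c s)"
  using cbool_not[OF cbool_conj[OF cbool_not cbool_not]] by simp

lemma cbool_less: "cexp m f \<Longrightarrow> cexp m g \<Longrightarrow> cbool m (\<lambda>s. f s < g s)"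
  using cbool_not[OF cbool_le] by (simp add: not_le)

lemma cbool_eq: "cexp m f \<Longrightarrow> cexp m g \<Longrightarrow> cbool m (\<lambda>s. f s = g s)"
  using cbool_conj[OF cbool_le cbool_le] by (simp add: eq_iff)

text \<open>The value of the condition is the number of rounds left, not merely nonzero, so one
  induction on it gives both termination and the cost bound.\<close>

lemma exec_loop:
  assumes cond: "\<And>k s. k \<le> N \<Longrightarrow> I k s \<Longrightarrow> aval e s = N - k"
    and body: "\<And>k s. k < N \<Longrightarrow> I k s \<Longrightarrow> \<exists>t s'. exec B s t s' \<and> t \<le> T \<and> I (Suc k) s'"
    and init: "I 0 s"
  shows "\<exists>t s'. exec (While e B) s t s' \<and> t \<le> (1 + acost e) + N * (1 + acost e + T) \<and> I N s'"
proof -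
  have "\<exists>t s'. exec (While e B) s t s' \<and> t \<le> (1 + acost e) + j * (1 + acost e + T) \<and> I N s'"
    if "j \<le> N" "I (N - j) s" for j s
    using that
  proof (induction j arbitrary: s)
    case 0
    then show ?case using cond[of N s] by (auto intro!: exec.WhileFalse exI)
  next
    case (Suc j)
    obtain t s1 where 1: "exec B s t s1" "t \<le> T" "I (Suc (N - Suc j)) s1"
      using body[of "N - Suc j" s] Suc.prems by auto
    have "I (N - j) s1" using 1(3) Suc.prems by (simp add: Suc_diff_Suc)
    then obtain u s2 where 2: "exec (While e B) s1 u s2"
      "u \<le> (1 + acost e) + j * (1 + acost e + T)" "I N s2"
      using Suc.IH[of s1] Suc.prems by auto
    have "aval e s \<noteq> 0" using cond[of "N - Suc j" s] Suc.prems by simp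
    then have "exec (While e B) s (1 + acost e + t + u) s2"
      using 1(1) 2(1) by (rule exec.WhileTrue)
    moreover have "1 + acost e + t + u \<le> (1 + acost e) + Suc j * (1 + acost e + T)"
      using 1(2) 2(2) by simp
    ultimately show ?case using 2(3) by blast
  qed
  from this[of N s] init show ?thesis by simp
qed

text \<open>Array \<open>d\<close> accumulates, array \<open>Suc d\<close> counts, and the code of
  the summand works above both. The place of the counter varies with \<open>d\<close>, hence
  \<open>f\<close> is required for an index read from any array \<open>i \<ge> m\<close>;
  \<open>dep\<close> shields the summand from the changing total and counter.\<close>

lemma cexp_sum:
  assumes pos: "0 < m" and dep: "\<And>k. cdep m (f k)"
    and f: "\<And>i. m \<le> i \<Longrightarrow> cexp (Suc i) (\<lambda>s. f (s i 0) s)"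
  shows "cexp m (\<lambda>s. \<Sum>k<s 0 0. f k s)"
proof (rule cexpI[OF pos])
  show "cdep m (\<lambda>s. \<Sum>k<s 0 0. f k s)"
    unfolding cdep_def
  proof safe
    fix s s' :: state assume a: "agree m s s'"
    show "(\<Sum>k<s 0 0. f k s) = (\<Sum>k<s' 0 0. f k s')"
      using cdepD[OF dep a] agreeD[OF a pos] by simp
  qed
  fix d assume d: "m \<le> d"
  define i where "i = Suc d"
  have mi: "m \<le> i" using d by (simp add: i_def)
  obtain P p where P: "\<And>s. \<exists>t s'. exec P s t s' \<and> t \<le> poly p (s 0 0) \<and> s' (Suc i) 0 = f (s i 0) s
     \<and> agree (Suc i) s' s"
    using cexpE[OF f[OF mi] order_refl] by blast
  define B where "B = Seq P (Seq (Assign d (Const 0) (Add (Cell d (Const 0)) (Cell (Suc i) (Const 0))))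
     (Assign i (Const 0) (Add (Cell i (Const 0)) (Const 1))))"
  define e where "e = Sub (Cell 0 (Const 0)) (Cell i (Const 0))"
  define R where "R = Seq (Assign d (Const 0) (Const 0)) (Seq (Assign i (Const 0) (Const 0)) (While e B))"
  define r where "r = [:12:] + [:0,1:] * (p + [:19:])"
  have "\<exists>t s'. exec R s0 t s' \<and> t \<le> poly r (s0 0 0)
     \<and> s' d 0 = (\<Sum>k<s0 0 0. f k s0) \<and> agree d s' s0" for s0
  proof -
    define I where "I k s \<longleftrightarrow> agree d s s0 \<and> s i 0 = k \<and> s d 0 = (\<Sum>j<k. f j s0)" for k s
    define s1 where "s1 = update (update s0 d 0 0) i 0 0"
    have n: "s 0 = s0 0" if "agree d s s0" for s using that d pos by (simp add: agree_def)
    have "\<exists>t s'. exec (While e B) s1 t s' \<and>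
        t \<le> (1 + acost e) + s0 0 0 * (1 + acost e + (poly p (s0 0 0) + 13)) \<and> I (s0 0 0) s'"
    proof (rule exec_loop[where I = I])
      show "I 0 s1" by (auto simp: I_def s1_def update_def agree_def i_def)
      show "aval e s = s0 0 0 - k" if "I k s" for k s
        using that n[of s] by (simp add: I_def e_def)
      fix k s assume I: "I k s"
      obtain t s2 where 2: "exec P s t s2" "t \<le> poly p (s 0 0)" "s2 (Suc i) 0 = f (s i 0) s"
        "agree (Suc i) s2 s" using P by blast
      define s3 where "s3 = update s2 d 0 (s2 d 0 + s2 (Suc i) 0)"
      define s4 where "s4 = update s3 i 0 (Suc (s3 i 0))"
      have "exec (Assign d (Const 0) (Add (Cell d (Const 0)) (Cell (Suc i) (Const 0)))) s2 7 s3"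
        using exec.Assign[of d "Const 0" "Add (Cell d (Const 0)) (Cell (Suc i) (Const 0))" s2]
        by (simp add: eval_nat_numeral s3_def)
      moreover have "exec (Assign i (Const 0) (Add (Cell i (Const 0)) (Const 1))) s3 6 s4"
        using exec.Assign[of i "Const 0" "Add (Cell i (Const 0)) (Const 1)" s3]
        by (simp add: eval_nat_numeral s4_def)
      ultimately have "exec B s (t + (7 + 6)) s4"
        unfolding B_def using 2(1) by (blast intro: exec.Seq)
      moreover have "t + (7 + 6) \<le> poly p (s0 0 0) + 13" using 2(2) n[of s] I by (simp add: I_def)
      moreover have "I (Suc k) s4"
      proof -
        have "f k s = f k s0" using I d by (intro cdepD[OF dep]) (auto simp: I_def elim: agree_mono)
        then show ?thesis using I 2(3,4)
          by (auto simp: I_def s4_def s3_def update_def agree_def i_def)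
      qed
      ultimately show "\<exists>t s'. exec B s t s' \<and> t \<le> poly p (s0 0 0) + 13 \<and> I (Suc k) s'" by blast
    qed
    then obtain t s' where w: "exec (While e B) s1 t s'"
      "t \<le> (1 + acost e) + s0 0 0 * (1 + acost e + (poly p (s0 0 0) + 13))" "I (s0 0 0) s'" by blast
    have "exec (Assign d (Const 0) (Const 0)) s0 3 (update s0 d 0 0)"
      using exec.Assign[of d "Const 0" "Const 0" s0] by (simp add: eval_nat_numeral)
    moreover have "exec (Assign i (Const 0) (Const 0)) (update s0 d 0 0) 3 s1"
      using exec.Assign[of i "Const 0" "Const 0" "update s0 d 0 0"] by (simp add: eval_nat_numeral s1_def)
    ultimately have "exec R s0 (3 + (3 + t)) s'"
      unfolding R_def using w(1) by (blast intro: exec.Seq)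
    moreover have "3 + (3 + t) \<le> poly r (s0 0 0)"
      using w(2) by (simp add: r_def e_def algebra_simps)
    ultimately show ?thesis using w(3) by (auto simp: I_def)
  qed
  then show "\<exists>P p. \<forall>s. \<exists>t s'. exec P s t s' \<and> t \<le> poly p (s 0 0) \<and> s' d 0 = (\<Sum>k<s 0 0. f k s)
     \<and> agree d s' s"
    by blast
qed

lemma cexp_if:
  assumes b: "cbool m b" and f: "cexp m f" and g: "cexp m g"
  shows "cexp m (\<lambda>s. if b s then f s else g s)"
proof (rule cexpI)
  show pos: "0 < m" using f by (rule cexp_pos)
  have bd: "b s = b s'" if "agree m s s'" for s s'
    using cdepD[OF cexp_dep[OF b[unfolded cbool_def]] that] by (auto split: if_splits)
  show "cdep m (\<lambda>s. if b s then f s else g s)"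
    using cexp_dep[OF f] cexp_dep[OF g] bd by (auto simp: cdep_def)
  fix d assume d: "m \<le> d"
  obtain P p where P: "\<And>s. \<exists>t s'. exec P s t s' \<and> t \<le> poly p (s 0 0) \<and> s' d 0 = f s \<and> agree d s' s"
    using cexpE[OF f d] by blast
  obtain Q q where Q: "\<And>s. \<exists>t s'. exec Q s t s' \<and> t \<le> poly q (s 0 0) \<and> s' d 0 = g s \<and> agree d s' s"
    using cexpE[OF g d] by blast
  obtain B r where B: "\<And>s. \<exists>t s'. exec B s t s' \<and> t \<le> poly r (s 0 0) \<and> s' d 0 = (if b s then 1 else 0)
     \<and> agree d s' s"
    using cexpE[OF b[unfolded cbool_def] d] by blast
  have "\<exists>t s'. exec (Seq B (If (Cell d (Const 0)) P Q)) s t s' \<and> t \<le> poly (p + q + r + [:3:]) (s 0 0)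
     \<and> s' d 0 = (if b s then f s else g s) \<and> agree d s' s" for s
  proof -
    obtain t s1 where 1: "exec B s t s1" "t \<le> poly r (s 0 0)" "s1 d 0 = (if b s then 1 else 0)"
      "agree d s1 s" using B by blast
    have n: "s1 0 = s 0" using 1(4) d pos by (simp add: agree_def)
    have fg: "f s1 = f s" "g s1 = g s"
      using agree_mono[OF 1(4) d] cdepD[OF cexp_dep] f g by blast+
    show ?thesis
    proof (cases "b s")
      case True
      obtain u s2 where 2: "exec P s1 u s2" "u \<le> poly p (s1 0 0)" "s2 d 0 = f s1"
        "agree d s2 s1" using P by blast
      have "exec (If (Cell d (Const 0)) P Q) s1 (3 + u) s2"
        using exec.IfTrue[of "Cell d (Const 0)" s1 P u s2 Q] 1(3) True 2(1) by (simp add: numeral_3_eq_3)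
      then have "exec (Seq B (If (Cell d (Const 0)) P Q)) s (t + (3 + u)) s2"
        using exec.Seq[OF 1(1)] by blast
      moreover have "t + (3 + u) \<le> poly (p + q + r + [:3:]) (s 0 0)" using 1(2) 2(2) n by simp
      ultimately show ?thesis using 2(3) agree_trans[OF 2(4) 1(4)] True fg
          by (intro exI[of _ "t + (3 + u)"] exI[of _ s2]) simp
    next
      case False
      obtain u s2 where 2: "exec Q s1 u s2" "u \<le> poly q (s1 0 0)" "s2 d 0 = g s1"
        "agree d s2 s1" using Q by blast
      have "exec (If (Cell d (Const 0)) P Q) s1 (3 + u) s2"
        using exec.IfFalse[of "Cell d (Const 0)" s1 Q u s2 P] 1(3) False 2(1) by (simp add: numeral_3_eq_3)
      then have "exec (Seq B (If (Cell d (Const 0)) P Q)) s (t + (3 + u)) s2"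
        using exec.Seq[OF 1(1)] by blast
      moreover have "t + (3 + u) \<le> poly (p + q + r + [:3:]) (s 0 0)" using 1(2) 2(2) n by simp
      ultimately show ?thesis using 2(3) agree_trans[OF 2(4) 1(4)] False fg
          by (intro exI[of _ "t + (3 + u)"] exI[of _ s2]) simp
    qed
  qed
  then show "\<exists>P p. \<forall>s. \<exists>t s'. exec P s t s' \<and> t \<le> poly p (s 0 0)
     \<and> s' d 0 = (if b s then f s else g s) \<and> agree d s' s"
    by blast
qed

lemma cdep_const: "cdep m (\<lambda>s. k)"
  by (simp add: cdep_def)

lemma cdep_cell: "cdep m f \<Longrightarrow> a < m \<Longrightarrow> cdep m (\<lambda>s. s a (f s))"
  unfolding cdep_def agree_def by metis

lemma cdep_binop: "cdep m f \<Longrightarrow> cdep m g \<Longrightarrow> cdep m (\<lambda>s. h (f s) (g s))"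
  unfolding cdep_def by metis

lemma cdep_comp: "cdep m f \<Longrightarrow> cdep m (\<lambda>s. h (f s))"
  unfolding cdep_def by metis

lemma cdep_if: "cdep m b \<Longrightarrow> cdep m f \<Longrightarrow> cdep m g \<Longrightarrow> cdep m (\<lambda>s. if b s then f s else g s)"
  unfolding cdep_def by metis

lemma cdep_sum: "0 < m \<Longrightarrow> (\<And>k. cdep m (f k)) \<Longrightarrow> cdep m (\<lambda>s. \<Sum>k<s 0 0. f k s :: nat)"
  unfolding cdep_def agree_def by (metis (no_types, lifting) sum.cong)

lemma cdep_ex: "0 < m \<Longrightarrow> (\<And>k. cdep m (b k)) \<Longrightarrow> cdep m (\<lambda>s. \<exists>k<s 0 0. b k s)"
  unfolding cdep_def agree_def by metis

lemma cbool_ex: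
  assumes "0 < m" "\<And>k. cdep m (b k)" "\<And>i. m \<le> i \<Longrightarrow> cbool (Suc i) (\<lambda>s. b (s i 0) s)"
  shows "cbool m (\<lambda>s. \<exists>k<s 0 0. b k s)"
proof -
  have "cexp m (\<lambda>s. \<Sum>k<s 0 0. if b k s then 1 else 0)"
    using assms by (intro cexp_sum cdep_if cdep_const) (auto simp: cbool_def)
  then have "cbool m (\<lambda>s. \<not> (\<Sum>k<s 0 0. if b k s then 1 else 0) = (0::nat))"
    using assms(1) by (intro cbool_not cbool_eq cexp_const)
  moreover have "(0 < (if c then 1 else 0 :: nat)) = c" for c by simp
  ultimately show ?thesis by (simp add: Bex_def)
qed

text \<open>Multiplication is not a machine operation; a product with \<open>n\<close> is a sum of
  \<open>n\<close> equal terms.\<close>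

lemma cexp_mult_n:
  assumes "cexp m f"
  shows "cexp m (\<lambda>s. s 0 0 * f s)"
proof -
  have mono: "cexp (Suc i) f" if "m \<le> i" for i
    using assms that unfolding cexp_def cdep_def by (meson Suc_leD agree_mono le_Suc_eq le_trans zero_less_Suc)
  have "cexp m (\<lambda>s. \<Sum>k<s 0 0. f s)"
    using assms mono by (intro cexp_sum) (auto intro: cexp_dep cexp_pos)
  then show ?thesis by simp
qed

text \<open>The operator \<open>h\<close> is instantiated beforehand, as a schematic
  \<open>h\<close> would unify with almost any goal.\<close>

lemmas cdep_intros = cdep_const cdep_cell cdep_if cdep_sum cdep_ex
  cdep_binop[where h = "(+)"] cdep_binop[where h = "(-)"] cdep_binop[where h = "(*)"]
  cdep_binop[where h = "(=)"] cdep_binop[where h = "(\<le>)"] cdep_binop[where h = "(<)"]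
  cdep_binop[where h = "(\<and>)"] cdep_binop[where h = "(\<or>)"] cdep_comp[where h = Not]

lemmas cexp_intros = cexp_const cexp_cell cexp_add cexp_diff cexp_mult_n cexp_mult_const cexp_if cexp_sum
  cbool_le cbool_less cbool_eq cbool_conj cbool_disj cbool_not cbool_ex

section \<open>State transformers computable in polynomial time\<close>

text \<open>Array 0 stays fixed so that bounds polynomial in \<open>n\<close> add up under
  composition. \<open>F\<close> itself also fixes all arrays from \<open>m\<close> on, although the
  code may overwrite those from \<open>d\<close> on.\<close>

definition ccom :: "nat \<Rightarrow> (state \<Rightarrow> state) \<Rightarrow> bool" where
  "ccom m F \<longleftrightarrow> 0 < m \<and> (\<forall>s s'. agree m s s' \<longrightarrow> agree m (F s) (F s')) \<and>
     (\<forall>s a. a = 0 \<or> m \<le> a \<longrightarrow> F s a = s a) \<and>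
     (\<forall>d\<ge>m. \<exists>P p. \<forall>s. \<exists>t s'. exec P s t s' \<and> t \<le> poly p (s 0 0) \<and> agree d s' (F s))"

lemma ccomE:
  assumes "ccom m F" "d \<ge> m"
  obtains P p where "\<And>s. \<exists>t s'. exec P s t s' \<and> t \<le> poly p (s 0 0) \<and> agree d s' (F s)"
  using assms unfolding ccom_def by meson

lemma ccom_agree:
  assumes "ccom m F" "d \<ge> m" "agree d s s'"
  shows "agree d (F s) (F s')"
  unfolding agree_def
proof safe
  fix a assume "a < d"
  show "F s a = F s' a"
  proof (cases "a < m")
    case True
    then show ?thesis using assms agree_mono[OF assms(3,2)] unfolding ccom_def by (simp add: agree_def)
  next
    case False
    then show ?thesis using assms \<open>a < d\<close> unfolding ccom_def by (simp add: agree_def)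
  qed
qed

lemma ccom_fix: "ccom m F \<Longrightarrow> a = 0 \<or> m \<le> a \<Longrightarrow> F s a = s a"
  unfolding ccom_def by blast

lemma ccom_id: "0 < m \<Longrightarrow> ccom m (\<lambda>s. s)"
proof -
  have "exec Skip s 1 s \<and> 1 \<le> poly [:1:] (s 0 0) \<and> agree d s s" for d s
    using exec.Skip[of s] by (simp add: agree_refl)
  then show "0 < m \<Longrightarrow> ccom m (\<lambda>s. s)" unfolding ccom_def by blast
qed

lemma ccom_comp:
  assumes F: "ccom m F" and G: "ccom m G"
  shows "ccom m (\<lambda>s. G (F s))"
  unfolding ccom_def
proof (intro conjI allI impI)
  show "0 < m" using F by (simp add: ccom_def)
  show "agree m (G (F s)) (G (F s'))" if "agree m s s'" for s s'
    using ccom_agree[OF G _ ccom_agree[OF F _ that]] by simp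
  show "G (F s) a = s a" if "a = 0 \<or> m \<le> a" for s a
    using ccom_fix[OF F that] ccom_fix[OF G that] by simp
  fix d assume d: "m \<le> d"
  obtain P p where P: "\<And>s. \<exists>t s'. exec P s t s' \<and> t \<le> poly p (s 0 0) \<and> agree d s' (F s)"
    using ccomE[OF F d] by blast
  obtain Q q where Q: "\<And>s. \<exists>t s'. exec Q s t s' \<and> t \<le> poly q (s 0 0) \<and> agree d s' (G s)"
    using ccomE[OF G d] by blast
  have "\<exists>t s'. exec (Seq P Q) s t s' \<and> t \<le> poly (p + q) (s 0 0) \<and> agree d s' (G (F s))" for s
  proof -
    obtain t s1 where 1: "exec P s t s1" "t \<le> poly p (s 0 0)" "agree d s1 (F s)" using P by blast
    obtain u s2 where 2: "exec Q s1 u s2" "u \<le> poly q (s1 0 0)" "agree d s2 (G s1)" using Q by blast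
    have "s1 0 = s 0" using agreeD[OF 1(3), of 0] d \<open>0 < m\<close> ccom_fix[OF F] by simp
    moreover have "agree d s2 (G (F s))" using agree_trans[OF 2(3) ccom_agree[OF G d 1(3)]] .
    ultimately show ?thesis using exec.Seq[OF 1(1) 2(1)] 1(2) 2(2)
      by (intro exI[of _ "t + u"] exI[of _ s2]) simp
  qed
  then show "\<exists>P p. \<forall>s. \<exists>t s'. exec P s t s' \<and> t \<le> poly p (s 0 0) \<and> agree d s' (G (F s))" by blast
qed

lemma ccom_if:
  assumes b: "cbool m b" and F: "ccom m F" and G: "ccom m G"
  shows "ccom m (\<lambda>s. if b s then F s else G s)"
  unfolding ccom_def
proof (intro conjI allI impI)
  show pos: "0 < m" using F by (simp add: ccom_def)
  have bd: "b s = b s'" if "agree m s s'" for s s'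
    using cdepD[OF cexp_dep[OF b[unfolded cbool_def]] that] by (auto split: if_splits)
  show "agree m (if b s then F s else G s) (if b s' then F s' else G s')" if "agree m s s'" for s s'
    using ccom_agree[OF G _ that] ccom_agree[OF F _ that] bd[OF that] by simp
  show "(if b s then F s else G s) a = s a" if "a = 0 \<or> m \<le> a" for s a
    using ccom_fix[OF F that] ccom_fix[OF G that] by simp
  fix d assume d: "m \<le> d"
  obtain P p where P: "\<And>s. \<exists>t s'. exec P s t s' \<and> t \<le> poly p (s 0 0) \<and> agree d s' (F s)"
    using ccomE[OF F d] by blast
  obtain Q q where Q: "\<And>s. \<exists>t s'. exec Q s t s' \<and> t \<le> poly q (s 0 0) \<and> agree d s' (G s)"
    using ccomE[OF G d] by blast
  obtain B r where B: "\<And>s. \<exists>t s'. exec B s t s' \<and> t \<le> poly r (s 0 0) \<and> s' d 0 = (if b s then 1 else 0)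
     \<and> agree d s' s"
    using cexpE[OF b[unfolded cbool_def] d] by blast
  have "\<exists>t s'. exec (Seq B (If (Cell d (Const 0)) P Q)) s t s' \<and> t \<le> poly (p + q + r + [:3:]) (s 0 0)
     \<and> agree d s' (if b s then F s else G s)" for s
  proof -
    obtain t s1 where 1: "exec B s t s1" "t \<le> poly r (s 0 0)" "s1 d 0 = (if b s then 1 else 0)"
      "agree d s1 s" using B by blast
    have n: "s1 0 = s 0" using 1(4) d pos by (simp add: agree_def)
    have fg: "agree d (F s1) (F s)" "agree d (G s1) (G s)"
      using ccom_agree[OF F d 1(4)] ccom_agree[OF G d 1(4)] .
    show ?thesis
    proof (cases "b s")
      case True
      obtain u s2 where 2: "exec P s1 u s2" "u \<le> poly p (s1 0 0)" "agree d s2 (F s1)"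
        using P by blast
      have "exec (If (Cell d (Const 0)) P Q) s1 (3 + u) s2"
        using exec.IfTrue[of "Cell d (Const 0)" s1 P u s2 Q] 1(3) True 2(1) by (simp add: numeral_3_eq_3)
      then have "exec (Seq B (If (Cell d (Const 0)) P Q)) s (t + (3 + u)) s2"
        using exec.Seq[OF 1(1)] by blast
      moreover have "t + (3 + u) \<le> poly (p + q + r + [:3:]) (s 0 0)" using 1(2) 2(2) n by simp
      ultimately show ?thesis using agree_trans[OF 2(3) fg(1)] True
          by (intro exI[of _ "t + (3 + u)"] exI[of _ s2]) simp
    next
      case False
      obtain u s2 where 2: "exec Q s1 u s2" "u \<le> poly q (s1 0 0)" "agree d s2 (G s1)"
        using Q by blast
      have "exec (If (Cell d (Const 0)) P Q) s1 (3 + u) s2"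
        using exec.IfFalse[of "Cell d (Const 0)" s1 Q u s2 P] 1(3) False 2(1) by (simp add: numeral_3_eq_3)
      then have "exec (Seq B (If (Cell d (Const 0)) P Q)) s (t + (3 + u)) s2"
        using exec.Seq[OF 1(1)] by blast
      moreover have "t + (3 + u) \<le> poly (p + q + r + [:3:]) (s 0 0)" using 1(2) 2(2) n by simp
      ultimately show ?thesis using agree_trans[OF 2(3) fg(2)] False
          by (intro exI[of _ "t + (3 + u)"] exI[of _ s2]) simp
    qed
  qed
  then show "\<exists>P p. \<forall>s. \<exists>t s'. exec P s t s' \<and> t \<le> poly p (s 0 0)
     \<and> agree d s' (if b s then F s else G s)"
    by blast
qed

text \<open>The countdown lives in array \<open>d\<close>, and the body is placed from
  \<open>Suc d\<close> on, so it cannot disturb the countdown. Linear counts are enough, since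
  nesting yields higher powers of \<open>n\<close>.\<close>

lemma ccom_iterate:
  assumes F: "ccom m F"
  shows "ccom m (\<lambda>s. (F ^^ (C * s 0 0)) s)"
  unfolding ccom_def
proof (intro conjI allI impI)
  show pos: "0 < m" using F by (simp add: ccom_def)
  have iter_agree: "agree d ((F ^^ k) s) ((F ^^ k) s')" if "m \<le> d" "agree d s s'" for d k s s'
    using that by (induction k) (auto intro: ccom_agree[OF F])
  have iter_fix: "(F ^^ k) s a = s a" if "a = 0 \<or> m \<le> a" for k s a
    using that by (induction k) (auto simp: ccom_fix[OF F])
  show "agree m ((F ^^ (C * s 0 0)) s) ((F ^^ (C * s' 0 0)) s')" if "agree m s s'" for s s'
    using iter_agree[OF _ that] agreeD[OF that pos] by simp
  show "(F ^^ (C * s 0 0)) s a = s a" if "a = 0 \<or> m \<le> a" for s a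
    using iter_fix[OF that] .
  fix d assume d: "m \<le> d"
  obtain P p where P: "\<And>s. \<exists>t s'. exec P s t s' \<and> t \<le> poly p (s 0 0) \<and> agree (Suc d) s' (F s)"
    using ccomE[OF F le_SucI[OF d]] by blast
  obtain A q where A: "\<And>s. \<exists>t s'. exec A s t s' \<and> t \<le> poly q (s 0 0) \<and> s' d 0 = C * s 0 0
     \<and> agree d s' s"
    using cexpE[OF cexp_mult_const[OF cexp_cell[OF cexp_const]], OF pos pos d] by blast
  define e where "e = Cell d (Const 0)"
  define B where "B = Seq P (Assign d (Const 0) (Sub (Cell d (Const 0)) (Const 1)))"
  define r where "r = q + [:3:] + [:C:] * ([:0,1:] * (p + [:9:]))"
  have "\<exists>t s'. exec (Seq A (While e B)) s0 t s' \<and> t \<le> poly r (s0 0 0)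
     \<and> agree d s' ((F ^^ (C * s0 0 0)) s0)" for s0
  proof -
    define N where "N = C * s0 0 0"
    define I where "I k s \<longleftrightarrow> agree d s ((F ^^ k) s0) \<and> s d 0 = N - k" for k s
    obtain t1 s1 where 1: "exec A s0 t1 s1" "t1 \<le> poly q (s0 0 0)" "s1 d 0 = N" "agree d s1 s0"
      using A unfolding N_def by blast
    have "\<exists>t s'. exec (While e B) s1 t s' \<and>
        t \<le> (1 + acost e) + N * (1 + acost e + (poly p (s0 0 0) + 6)) \<and> I N s'"
    proof (rule exec_loop[where I = I])
      show "I 0 s1" using 1 by (auto simp: I_def)
      show "aval e s = N - k" if "I k s" for k s
        using that by (simp add: I_def e_def)
      fix k s assume I: "I k s"
      obtain t s2 where 2: "exec P s t s2" "t \<le> poly p (s 0 0)" "agree (Suc d) s2 (F s)"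
        using P by blast
      define s3 where "s3 = update s2 d 0 (s2 d 0 - 1)"
      have "exec (Assign d (Const 0) (Sub (Cell d (Const 0)) (Const 1))) s2 6 s3"
        using exec.Assign[of d "Const 0" "Sub (Cell d (Const 0)) (Const 1)" s2]
        by (simp add: eval_nat_numeral s3_def)
      then have "exec B s (t + 6) s3"
        unfolding B_def using 2(1) by (blast intro: exec.Seq)
      moreover have "s 0 = s0 0"
        using I d pos iter_fix[of 0 k s0] by (simp add: I_def agree_def)
      then have "t + 6 \<le> poly p (s0 0 0) + 6" using 2(2) by simp
      moreover have "I (Suc k) s3"
      proof -
        have "s2 d = s d" using 2(3) d ccom_fix[OF F, of d s] by (simp add: agree_def)
        then have "s3 d 0 = N - Suc k" using I by (simp add: s3_def update_def I_def)
        moreover have "agree d s3 s2" by (simp add: s3_def update_def agree_def)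
        moreover have "agree d s2 (F s)" using 2(3) by (rule agree_mono) simp
        moreover have "agree d (F s) ((F ^^ Suc k) s0)"
          using ccom_agree[OF F d] I by (simp add: I_def)
        ultimately show ?thesis unfolding I_def by (blast intro: agree_trans)
      qed
      ultimately show "\<exists>t s'. exec B s t s' \<and> t \<le> poly p (s0 0 0) + 6 \<and> I (Suc k) s'" by blast
    qed
    then obtain t s' where w: "exec (While e B) s1 t s'"
      "t \<le> (1 + acost e) + N * (1 + acost e + (poly p (s0 0 0) + 6))" "I N s'" by blast
    have "t1 + t \<le> poly r (s0 0 0)"
      using w(2) 1(2) by (simp add: r_def e_def N_def algebra_simps)
    then show ?thesis using w(3) exec.Seq[OF 1(1) w(1)] by (auto simp: I_def N_def)
  qed
  then show "\<exists>P p. \<forall>s. \<exists>t s'. exec P s t s' \<and> t \<le> poly p (s 0 0)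
     \<and> agree d s' ((F ^^ (C * s 0 0)) s)" by blast
qed

text \<open>Simultaneous assignment: all values refer to the old state. It is the only write of the
  algorithm, so a scalar is kept in cell 0 of an array whose first \<open>n\<close> cells are set
  together.\<close>

definition amap :: "nat \<Rightarrow> (nat \<Rightarrow> state \<Rightarrow> nat) \<Rightarrow> state \<Rightarrow> state" where
  "amap a f s = s(a := (\<lambda>k. if k < s 0 0 then f k s else s a k))"

text \<open>The values are collected in a scratch array first, so \<open>f\<close> may read the array \<open>a\<close>.\<close>

lemma ccom_amap:
  assumes a: "0 < a" "a < m" and dep: "\<And>k. cdep m (f k)"
    and f: "\<And>i. m \<le> i \<Longrightarrow> cexp (Suc i) (\<lambda>s. f (s i 0) s)"
  shows "ccom m (amap a f)"
  unfolding ccom_def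
proof (intro conjI allI impI)
  show pos: "0 < m" using a by simp
  show "agree m (amap a f s) (amap a f s')" if "agree m s s'" for s s'
    using that cdepD[OF dep that] pos by (auto simp: amap_def agree_def)
  show "amap a f s b = s b" if "b = 0 \<or> m \<le> b" for s b
    using that a by (auto simp: amap_def)
  fix d assume d: "m \<le> d"
  define i where "i = Suc d"
  have mi: "m \<le> i" using d by (simp add: i_def)
  obtain P p where P: "\<And>s. \<exists>t s'. exec P s t s' \<and> t \<le> poly p (s 0 0) \<and> s' (Suc i) 0 = f (s i 0) s
     \<and> agree (Suc i) s' s"
    using cexpE[OF f[OF mi] order_refl] by blast
  define inc where "inc = Assign i (Const 0) (Add (Cell i (Const 0)) (Const 1))"
  define B where "B = Seq P (Seq (Assign d (Cell i (Const 0)) (Cell (Suc i) (Const 0))) inc)"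
  define B' where "B' = Seq (Assign a (Cell i (Const 0)) (Cell d (Cell i (Const 0)))) inc"
  define e where "e = Sub (Cell 0 (Const 0)) (Cell i (Const 0))"
  define Z where "Z = Assign i (Const 0) (Const 0)"
  define R where "R = Seq Z (Seq (While e B) (Seq Z (While e B')))"
  define r where "r = [:18:] + [:0,1:] * (p + [:35:])"
  have ez: "exec Z s 3 (update s i 0 0)" for s
    using exec.Assign[of i "Const 0" "Const 0" s] by (simp add: eval_nat_numeral Z_def)
  have ei: "exec inc s 6 (update s i 0 (Suc (s i 0)))" for s
    using exec.Assign[of i "Const 0" "Add (Cell i (Const 0)) (Const 1)" s] by (simp add: eval_nat_numeral inc_def)
  have "\<exists>t s'. exec R s0 t s' \<and> t \<le> poly r (s0 0 0) \<and> agree d s' (amap a f s0)" for s0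
  proof -
    define n where "n = s0 0 0"
    define I where "I k s \<longleftrightarrow> agree d s s0 \<and> s i 0 = k \<and> (\<forall>j<k. s d j = f j s0)" for k s
    define J where "J k s \<longleftrightarrow> (\<forall>b<d. b \<noteq> a \<longrightarrow> s b = s0 b) \<and> s i 0 = k \<and>
      (\<forall>j<n. s d j = f j s0) \<and> s a = (\<lambda>j. if j < k then f j s0 else s0 a j)" for k s
    define s1 where "s1 = update s0 i 0 0"
    have n1: "s 0 = s0 0" if "agree d s s0" for s using that d pos by (simp add: agree_def)
    have "\<exists>t s'. exec (While e B) s1 t s' \<and>
        t \<le> (1 + acost e) + n * (1 + acost e + (poly p (s0 0 0) + 11)) \<and> I n s'"
    proof (rule exec_loop[where I = I])
      show "I 0 s1" by (auto simp: I_def s1_def update_def agree_def i_def)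
      show "aval e s = n - k" if "I k s" for k s
        using that n1[of s] by (simp add: I_def e_def n_def)
      fix k s assume I: "I k s"
      obtain t s2 where 2: "exec P s t s2" "t \<le> poly p (s 0 0)" "s2 (Suc i) 0 = f (s i 0) s"
        "agree (Suc i) s2 s" using P by blast
      define s3 where "s3 = update s2 d (s2 i 0) (s2 (Suc i) 0)"
      have "exec (Assign d (Cell i (Const 0)) (Cell (Suc i) (Const 0))) s2 5 s3"
        using exec.Assign[of d "Cell i (Const 0)" "Cell (Suc i) (Const 0)" s2]
        by (simp add: eval_nat_numeral s3_def)
      then have "exec B s (t + (5 + 6)) (update s3 i 0 (Suc (s3 i 0)))"
        unfolding B_def using 2(1) ei by (blast intro: exec.Seq)
      moreover have "t + (5 + 6) \<le> poly p (s0 0 0) + 11" using 2(2) n1[of s] I by (simp add: I_def)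
      moreover have "I (Suc k) (update s3 i 0 (Suc (s3 i 0)))"
      proof -
        have "f k s = f k s0" using I d by (intro cdepD[OF dep]) (auto simp: I_def elim: agree_mono)
        then show ?thesis using I 2(3,4)
          by (auto simp: I_def s3_def update_def agree_def i_def less_Suc_eq)
      qed
      ultimately show "\<exists>t s'. exec B s t s' \<and> t \<le> poly p (s0 0 0) + 11 \<and> I (Suc k) s'" by blast
    qed
    then obtain t s2 where w: "exec (While e B) s1 t s2"
      "t \<le> (1 + acost e) + n * (1 + acost e + (poly p (s0 0 0) + 11))" "I n s2" by blast
    define s3 where "s3 = update s2 i 0 0"
    have "\<exists>t s'. exec (While e B') s3 t s' \<and>
        t \<le> (1 + acost e) + n * (1 + acost e + 12) \<and> J n s'"
    proof (rule exec_loop[where I = J])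
      show "J 0 s3" using w(3) d a
        by (auto simp: I_def J_def s3_def update_def agree_def i_def)
      show "aval e s = n - k" if "J k s" for k s
        using that a d by (simp add: J_def e_def n_def)
      fix k s assume J: "J k s" and k: "k < n"
      define s4 where "s4 = update s a (s i 0) (s d (s i 0))"
      have "exec (Assign a (Cell i (Const 0)) (Cell d (Cell i (Const 0)))) s 6 s4"
        using exec.Assign[of a "Cell i (Const 0)" "Cell d (Cell i (Const 0))" s] by (simp add: eval_nat_numeral s4_def)
      then have "exec B' s (6 + 6) (update s4 i 0 (Suc (s4 i 0)))"
        unfolding B'_def using ei by (blast intro: exec.Seq)
      moreover have "J (Suc k) (update s4 i 0 (Suc (s4 i 0)))"
        using J k d a by (auto simp: J_def s4_def update_def i_def less_Suc_eq fun_eq_iff)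
      ultimately show "\<exists>t s'. exec B' s t s' \<and> t \<le> 12 \<and> J (Suc k) s'" by force
    qed
    then obtain u s4 where v: "exec (While e B') s3 u s4"
      "u \<le> (1 + acost e) + n * (1 + acost e + 12)" "J n s4" by blast
    have "exec R s0 (3 + (t + (3 + u))) s4"
      unfolding R_def using w(1) v(1) ez unfolding s1_def s3_def by (blast intro: exec.Seq)
    moreover have "3 + (t + (3 + u)) \<le> poly r (s0 0 0)"
      using w(2) v(2) by (simp add: r_def e_def n_def algebra_simps)
    moreover have "agree d s4 (amap a f s0)"
      using v(3) by (auto simp: J_def amap_def agree_def n_def)
    ultimately show ?thesis by blast
  qed
  then show "\<exists>P p. \<forall>s. \<exists>t s'. exec P s t s' \<and> t \<le> poly p (s 0 0) \<and> agree d s' (amap a f s)"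
    by blast
qed

lemma ccom_amap_comp:
  assumes "ccom m F" "0 < a" "a < m" "\<And>k. cdep m (f k)"
    and "\<And>i. m \<le> i \<Longrightarrow> cexp (Suc i) (\<lambda>s. f (s i 0) s)"
  shows "ccom m (\<lambda>s. amap a f (F s))"
  using ccom_comp[OF assms(1) ccom_amap[OF assms(2-)]] .

section \<open>Expansion from sweep cuts of power iterates\<close>

locale weighted_graph =
  fixes U :: "'a set" and w :: "'a \<Rightarrow> 'a \<Rightarrow> real" and D :: real
  assumes fin: "finite U" and w_nonneg: "0 \<le> w u v" and w_sym: "w u v = w v u"
    and w_row: "u \<in> U \<Longrightarrow> (\<Sum>v\<in>U. w u v) \<le> D" and D_pos: "0 < D"
begin

section \<open>Laplacian quadratic form and the shifted operator\<close>

definition ip :: "('a \<Rightarrow> real) \<Rightarrow> ('a \<Rightarrow> real) \<Rightarrow> real" where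
  "ip x y = (\<Sum>u\<in>U. x u * y u)"

definition lap :: "('a \<Rightarrow> real) \<Rightarrow> 'a \<Rightarrow> real" where
  "lap x u = (\<Sum>v\<in>U. w u v * (x u - x v))"

text \<open>The sum runs over ordered pairs, so every edge counts twice; this is the source of the
  halves below.\<close>

definition energy :: "('a \<Rightarrow> real) \<Rightarrow> real" where
  "energy x = (\<Sum>u\<in>U. \<Sum>v\<in>U. w u v * (x u - x v)\<^sup>2)"

text \<open>Subtracting from \<open>2 * D\<close> keeps the operator positive semidefinite, since
  the Laplacian has norm at most \<open>2 * D\<close>. All matrix entries are nonnegative, so for
  0-1 weights and integral \<open>D\<close> the iterates of unit vectors consist of natural
  numbers.\<close>

definition walk :: "('a \<Rightarrow> real) \<Rightarrow> 'a \<Rightarrow> real" where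
  "walk x u = 2 * D * x u - lap x u"

definition cut :: "'a set \<Rightarrow> real" where
  "cut S = (\<Sum>u\<in>U. \<Sum>v\<in>U. w u v * of_bool (u \<in> S \<and> v \<notin> S))"

lemma ip_self_nonneg: "0 \<le> ip x x"
  by (simp add: ip_def sum_nonneg)

lemma ip_cauchy_schwarz: "(ip x y)\<^sup>2 \<le> ip x x * ip y y"
  using Cauchy_Schwarz_ineq_sum[of x y U] by (simp add: ip_def power2_eq_square)

lemma energy_nonneg: "0 \<le> energy x"
  by (simp add: energy_def sum_nonneg w_nonneg)

text \<open>Exchanging the summation variables and averaging symmetrises the form; self-adjointness
  of the Laplacian and its link to \<open>energy\<close> are then immediate.\<close>

lemma ip_lap: "ip y (lap x) = (\<Sum>u\<in>U. \<Sum>v\<in>U. w u v * ((x u - x v) * (y u - y v))) / 2"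
proof -
  have 1: "ip y (lap x) = (\<Sum>u\<in>U. \<Sum>v\<in>U. w u v * (x u - x v) * y u)"
    by (simp add: ip_def lap_def sum_distrib_left mult.commute mult.left_commute)
  also have "\<dots> = (\<Sum>u\<in>U. \<Sum>v\<in>U. w v u * (x v - x u) * y v)"
    by (rule sum.swap)
  also have "\<dots> = (\<Sum>u\<in>U. \<Sum>v\<in>U. - (w u v * (x u - x v) * y v))"
    by (intro sum.cong refl) (simp add: w_sym algebra_simps)
  finally have 2: "ip y (lap x) = (\<Sum>u\<in>U. \<Sum>v\<in>U. - (w u v * (x u - x v) * y v))" .
  have "ip y (lap x) + ip y (lap x) = (\<Sum>u\<in>U. \<Sum>v\<in>U. w u v * ((x u - x v) * (y u - y v)))"
    by (subst (1) 1, subst 2) (simp add: sum.distrib[symmetric] algebra_simps)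
  then show ?thesis by simp
qed

lemma ip_lap_self: "ip x (lap x) = energy x / 2"
  by (simp add: ip_lap energy_def power2_eq_square)

text \<open>Cauchy-Schwarz in each row, with weights split as \<open>sqrt (w u v)\<close> twice, and
  the bound \<open>D\<close> on row sums. In operator form this is
  \<open>L^2 \<le> 2 D L\<close>.\<close>

lemma ip_lap_lap: "ip (lap x) (lap x) \<le> D * energy x"
proof -
  have "(lap x u)\<^sup>2 \<le> D * (\<Sum>v\<in>U. w u v * (x u - x v)\<^sup>2)" if "u \<in> U" for u
  proof -
    have "(lap x u)\<^sup>2 = (\<Sum>v\<in>U. sqrt (w u v) * (sqrt (w u v) * (x u - x v)))\<^sup>2"
      by (simp add: lap_def mult.assoc[symmetric] w_nonneg)
    also have "\<dots> \<le> (\<Sum>v\<in>U. (sqrt (w u v))\<^sup>2) * (\<Sum>v\<in>U. (sqrt (w u v) * (x u - x v))\<^sup>2)"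
      by (rule Cauchy_Schwarz_ineq_sum)
    also have "\<dots> = (\<Sum>v\<in>U. w u v) * (\<Sum>v\<in>U. w u v * (x u - x v)\<^sup>2)"
      by (simp add: power_mult_distrib w_nonneg)
    also have "\<dots> \<le> D * (\<Sum>v\<in>U. w u v * (x u - x v)\<^sup>2)"
      using w_row[OF that] by (intro mult_right_mono sum_nonneg) (simp_all add: w_nonneg)
    finally show ?thesis .
  qed
  then have "(\<Sum>u\<in>U. (lap x u)\<^sup>2) \<le> (\<Sum>u\<in>U. D * (\<Sum>v\<in>U. w u v * (x u - x v)\<^sup>2))"
    by (rule sum_mono)
  then show ?thesis by (simp add: ip_def energy_def sum_distrib_left power2_eq_square)
qed

lemma ip_walk_self: "ip x (walk x) = 2 * D * ip x x - energy x / 2"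
proof -
  have "ip x (walk x) = 2 * D * ip x x - ip x (lap x)"
    by (simp add: ip_def walk_def algebra_simps sum_subtractf sum_distrib_left)
  then show ?thesis by (simp add: ip_lap_self)
qed

text \<open>On expanding the square the cross term contributes \<open>- 2 * D * energy x\<close>, of
  which \<open>ip_lap_lap\<close> gives back at most half.\<close>

lemma walk_norm_le: "ip (walk x) (walk x) \<le> 4 * D\<^sup>2 * ip x x - D * energy x"
proof -
  have "ip (walk x) (walk x) = 4 * D\<^sup>2 * ip x x - 4 * D * ip x (lap x) + ip (lap x) (lap x)"
    by (simp add: ip_def walk_def algebra_simps sum_subtractf sum.distrib sum_distrib_left
      power2_eq_square)
  then show ?thesis using ip_lap_lap[of x] by (simp add: ip_lap_self)
qed

lemma ip_walk: "ip (walk x) y = ip x (walk y)"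
proof -
  have "ip y (lap x) = ip x (lap y)" unfolding ip_lap by (simp add: mult.commute)
  moreover have "ip (walk x) y = 2 * D * ip x y - ip y (lap x)"
    by (simp add: ip_def walk_def algebra_simps sum_subtractf sum_distrib_left)
  moreover have "ip x (walk y) = 2 * D * ip x y - ip x (lap y)"
    by (simp add: ip_def walk_def algebra_simps sum_subtractf sum_distrib_left)
  ultimately show ?thesis by simp
qed

lemma walk_cong: "(\<And>u. u \<in> U \<Longrightarrow> x u = y u) \<Longrightarrow> u \<in> U \<Longrightarrow> walk x u = walk y u"
  by (simp add: walk_def lap_def)

text \<open>Constant vectors are eigenvectors for \<open>2 * D\<close>, so centring commutes with
  the iteration up to that factor.\<close>

lemma walk_shift: "walk (\<lambda>u. x u - c) u = walk x u - 2 * D * c"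
  by (simp add: walk_def lap_def algebra_simps)

lemma walk_pow_shift: "(walk ^^ t) (\<lambda>u. x u - c) = (\<lambda>u. (walk ^^ t) x u - (2 * D) ^ t * c)"
proof (induction t)
  case (Suc t)
  show ?case by (rule ext) (simp add: Suc walk_shift mult.assoc)
qed simp

lemma walk_sum: "walk (\<lambda>u. \<Sum>i\<in>I. x i u) u = (\<Sum>i\<in>I. walk (x i) u)"
  unfolding walk_def lap_def
  by (simp add: sum_subtractf sum_distrib_left right_diff_distrib)
    (simp add: sum_subtractf[symmetric] sum_distrib_left sum.swap[of _ U I])

lemma walk_pow_sum: "(walk ^^ t) (\<lambda>u. \<Sum>i\<in>I. x i u) = (\<lambda>u. \<Sum>i\<in>I. (walk ^^ t) (x i) u)"
proof (induction t)
  case (Suc t)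
  show ?case by (rule ext) (simp add: Suc walk_sum)
qed simp

lemma sum_walk: "(\<Sum>u\<in>U. walk x u) = 2 * D * (\<Sum>u\<in>U. x u)"
proof -
  have "ip (\<lambda>u. 1) (lap x) = 0" by (simp add: ip_lap)
  then show ?thesis by (simp add: ip_def walk_def sum_subtractf sum_distrib_left)
qed

lemma sum_walk_pow: "(\<Sum>u\<in>U. (walk ^^ t) x u) = (2 * D) ^ t * (\<Sum>u\<in>U. x u)"
  by (induction t) (simp_all add: sum_walk)

text \<open>Along the iteration the ratios of consecutive squared norms are nondecreasing, because
  \<open>\<parallel>M\<^sup>k\<^sup>+\<^sup>1 f\<parallel>\<^sup>2 = \<langle>M\<^sup>k f, M\<^sup>k\<^sup>+\<^sup>2 f\<rangle>\<close>.\<close>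

lemma walk_pow_norm_ge:
  assumes r: "0 \<le> r" and f: "r * ip f f \<le> ip f (walk f)"
  shows "r ^ (2 * k) * ip f f \<le> ip ((walk ^^ k) f) ((walk ^^ k) f)"
proof -
  define N where "N k = ip ((walk ^^ k) f) ((walk ^^ k) f)" for k
  have N0: "0 \<le> N k" for k by (simp add: N_def ip_self_nonneg)
  have conv: "(N (Suc k))\<^sup>2 \<le> N k * N (Suc (Suc k))" for k
    using ip_cauchy_schwarz[of "(walk ^^ k) f" "walk (walk ((walk ^^ k) f))"]
      ip_walk[of "(walk ^^ k) f" "walk ((walk ^^ k) f)"]
    by (simp add: N_def)
  have step: "r\<^sup>2 * N k \<le> N (Suc k)" for k
  proof (induction k)
    case 0
    have "(r * N 0)\<^sup>2 \<le> (ip f (walk f))\<^sup>2"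
      using r f N0[of 0] by (intro power_mono) (simp_all add: N_def)
    also have "\<dots> \<le> N 0 * N (Suc 0)" using ip_cauchy_schwarz[of f "walk f"] by (simp add: N_def)
    finally have "N 0 * (r\<^sup>2 * N 0) \<le> N 0 * N (Suc 0)"
      by (simp add: power2_eq_square algebra_simps)
    then show ?case using N0[of 0] N0[of "Suc 0"] by (cases "N 0 = 0") simp_all
  next
    case (Suc k)
    show ?case
    proof (cases "N k = 0")
      case True
      then have "N (Suc k) = 0" using conv[of k] by simp
      then show ?thesis using N0 by simp
    next
      case False
      then have "0 < N k" using N0[of k] by simp
      have "N k * (r\<^sup>2 * N (Suc k)) \<le> N (Suc k) * N (Suc k)"
        using mult_right_mono[OF Suc N0[of "Suc k"]] by (simp add: algebra_simps)
      also have "\<dots> \<le> N k * N (Suc (Suc k))" using conv[of k] by (simp add: power2_eq_square)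
      finally show ?thesis using \<open>0 < N k\<close> by simp
    qed
  qed
  have "r ^ (2 * k) * N 0 \<le> N k" for k
  proof (induction k)
    case (Suc k)
    have "r ^ (2 * Suc k) * N 0 = r\<^sup>2 * (r ^ (2 * k) * N 0)"
      by (simp add: power2_eq_square)
    also have "\<dots> \<le> r\<^sup>2 * N k" using Suc by (intro mult_left_mono) simp_all
    also have "\<dots> \<le> N (Suc k)" by (rule step)
    finally show ?case .
  qed simp
  then show ?thesis by (simp add: N_def)
qed

section \<open>Cheeger's inequality for integer vectors\<close>

lemma layer_cake:
  fixes a b N :: nat
  assumes "a \<le> N"
  shows "(\<Sum>j=1..N. (2 * real j - 1) * of_bool (j \<le> a \<and> \<not> j \<le> b)) =
    (if b < a then (real a)\<^sup>2 - (real b)\<^sup>2 else 0)"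
proof -
  \<comment> \<open>A square is the sum of the first odd numbers, the discrete form of integrating
    \<open>2 t\<close> over the levels.\<close>
  have sq: "(\<Sum>j=1..k. 2 * real j - 1) = (real k)\<^sup>2" for k
    by (induction k) (simp_all add: power2_eq_square algebra_simps)
  show ?thesis
  proof (cases "b < a")
    case True
    have "(\<Sum>j=1..N. (2 * real j - 1) * of_bool (j \<le> a \<and> \<not> j \<le> b)) = (\<Sum>j\<in>{b<..a}. 2 * real j - 1)"
      using assms by (intro sum.mono_neutral_cong_right) auto
    moreover have "(\<Sum>j=1..a. 2 * real j - 1) = (\<Sum>j=1..b. 2 * real j - 1) + (\<Sum>j\<in>{b<..a}. 2 * real j - 1)"
      using True by (subst sum.union_disjoint[symmetric]) (auto intro!: sum.cong)
    ultimately show ?thesis using True sq by simp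
  qed (auto intro!: sum.neutral)
qed

text \<open>Coarea argument: \<open>y^2\<close> and its variation across edges are sums over level
  sets with weights \<open>2 j - 1\<close>, so expansion of the level sets gives
  \<open>X \<le> K * A\<close>. Cauchy-Schwarz on \<open>|a^2 - b^2| = |a - b| (a + b)\<close> then
  bounds \<open>A\<close> by the energy.\<close>

lemma cheeger_one_sided:
  fixes y :: "'a \<Rightarrow> nat"
  assumes K: "0 \<le> K"
    and exp: "\<And>j. 0 < j \<Longrightarrow> real (card {u\<in>U. j \<le> y u}) \<le> K * cut {u\<in>U. j \<le> y u}"
  shows "ip (\<lambda>u. real (y u)) (\<lambda>u. real (y u)) \<le> 4 * K\<^sup>2 * D * energy (\<lambda>u. real (y u))"
proof -
  define N where "N = (\<Sum>u\<in>U. y u)"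
  have N: "y u \<le> N" if "u \<in> U" for u unfolding N_def using that fin by (simp add: member_le_sum)
  define X where "X = ip (\<lambda>u. real (y u)) (\<lambda>u. real (y u))"
  define c where "c j = 2 * real j - 1" for j
  define A where "A = (\<Sum>u\<in>U. \<Sum>v\<in>U. w u v * \<bar>(real (y u))\<^sup>2 - (real (y v))\<^sup>2\<bar>)"
  have "X = (\<Sum>u\<in>U. \<Sum>j=1..N. c j * of_bool (j \<le> y u))"
    unfolding X_def ip_def
  proof (intro sum.cong refl)
    fix u assume "u \<in> U"
    have "(\<Sum>j=1..N. c j * of_bool (j \<le> y u)) = (\<Sum>j=1..N. c j * of_bool (j \<le> y u \<and> \<not> j \<le> 0))"
      by (intro sum.cong refl) auto
    then show "real (y u) * real (y u) = (\<Sum>j=1..N. c j * of_bool (j \<le> y u))"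
      using layer_cake[OF N[OF \<open>u \<in> U\<close>], of 0] by (auto simp: c_def power2_eq_square)
  qed
  also have "\<dots> = (\<Sum>j=1..N. c j * real (card {u\<in>U. j \<le> y u}))"
    by (subst sum.swap) (simp add: sum_distrib_left[symmetric] sum.If_cases fin Int_def of_bool_def)
  also have "\<dots> \<le> (\<Sum>j=1..N. c j * (K * cut {u\<in>U. j \<le> y u}))"
    using exp by (intro sum_mono mult_left_mono) (auto simp: c_def)
  also have "\<dots> = (\<Sum>j=1..N. \<Sum>u\<in>U. \<Sum>v\<in>U. K * (w u v * (c j * of_bool (j \<le> y u \<and> \<not> j \<le> y v))))"
    unfolding cut_def sum_distrib_left by (intro sum.cong refl) auto
  also have "\<dots> = (\<Sum>u\<in>U. \<Sum>j=1..N. \<Sum>v\<in>U. K * (w u v * (c j * of_bool (j \<le> y u \<and> \<not> j \<le> y v))))"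
    by (rule sum.swap)
  also have "\<dots> = (\<Sum>u\<in>U. \<Sum>v\<in>U. \<Sum>j=1..N. K * (w u v * (c j * of_bool (j \<le> y u \<and> \<not> j \<le> y v))))"
    by (intro sum.cong refl sum.swap)
  also have "\<dots> = (\<Sum>u\<in>U. \<Sum>v\<in>U. K * (w u v * (\<Sum>j=1..N. c j * of_bool (j \<le> y u \<and> \<not> j \<le> y v))))"
    by (simp only: sum_distrib_left)
  \<comment> \<open>Only pairs with \<open>y v < y u\<close> contribute on the left; the absolute
    value counts both orders, which costs a harmless factor two.\<close>
  also have "\<dots> \<le> (\<Sum>u\<in>U. \<Sum>v\<in>U. K * (w u v * \<bar>(real (y u))\<^sup>2 - (real (y v))\<^sup>2\<bar>))"
  proof (intro sum_mono mult_left_mono K w_nonneg)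
    fix u v assume "u \<in> U"
    show "(\<Sum>j=1..N. c j * of_bool (j \<le> y u \<and> \<not> j \<le> y v)) \<le> \<bar>(real (y u))\<^sup>2 - (real (y v))\<^sup>2\<bar>"
      unfolding c_def layer_cake[OF N[OF \<open>u \<in> U\<close>]] by simp
  qed
  also have "\<dots> = K * A" by (simp add: A_def sum_distrib_left)
  finally have XA: "X \<le> K * A" .
  define P where "P = U \<times> U"
  have "A = (\<Sum>(u,v)\<in>P. (sqrt (w u v) * \<bar>real (y u) - real (y v)\<bar>) * (sqrt (w u v) * (real (y u) + real (y v))))"
    unfolding A_def P_def sum.cartesian_product
  proof (intro sum.cong refl, clarify)
    fix u v
    have "\<bar>(real (y u))\<^sup>2 - (real (y v))\<^sup>2\<bar> = \<bar>real (y u) - real (y v)\<bar> * (real (y u) + real (y v))"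
      by (simp add: power2_eq_square square_diff_square_factored abs_mult)
    moreover have "w u v = sqrt (w u v) * sqrt (w u v)" by (simp add: w_nonneg)
    ultimately show "w u v * \<bar>(real (y u))\<^sup>2 - (real (y v))\<^sup>2\<bar> = sqrt (w u v) * \<bar>real (y u) - real (y v)\<bar>
      * (sqrt (w u v) * (real (y u) + real (y v)))"
      by (metis mult.assoc mult.left_commute)
  qed
  then have "A\<^sup>2 \<le> (\<Sum>(u,v)\<in>P. (sqrt (w u v) * \<bar>real (y u) - real (y v)\<bar>)\<^sup>2)
      * (\<Sum>(u,v)\<in>P. (sqrt (w u v) * (real (y u) + real (y v)))\<^sup>2)"
    using Cauchy_Schwarz_ineq_sum[of "\<lambda>(u,v). sqrt (w u v) * \<bar>real (y u) - real (y v)\<bar>"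
        "\<lambda>(u,v). sqrt (w u v) * (real (y u) + real (y v))" P]
    by (simp add: case_prod_beta)
  also have "(\<Sum>(u,v)\<in>P. (sqrt (w u v) * \<bar>real (y u) - real (y v)\<bar>)\<^sup>2) = energy (\<lambda>u. real (y u))"
    by (simp add: P_def energy_def sum.cartesian_product power_mult_distrib w_nonneg)
  also have "(\<Sum>(u,v)\<in>P. (sqrt (w u v) * (real (y u) + real (y v)))\<^sup>2) \<le> 4 * D * X"
  proof -
    have "(\<Sum>(u,v)\<in>P. (sqrt (w u v) * (real (y u) + real (y v)))\<^sup>2)
       \<le> (\<Sum>u\<in>U. \<Sum>v\<in>U. 2 * (real (y u))\<^sup>2 * w u v + 2 * (real (y v))\<^sup>2 * w v u)"
      unfolding P_def sum.cartesian_product[symmetric]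
    proof (intro sum_mono)
      fix u v
      have "(real (y u) + real (y v))\<^sup>2 \<le> 2 * (real (y u))\<^sup>2 + 2 * (real (y v))\<^sup>2"
        using sum_squares_bound[of "real (y u)" "real (y v)"] by (simp add: power2_sum)
      moreover have "(sqrt (w u v) * (real (y u) + real (y v)))\<^sup>2 = w u v * (real (y u) + real (y v))\<^sup>2"
        by (simp only: power_mult_distrib) (simp add: w_nonneg)
      ultimately have "(sqrt (w u v) * (real (y u) + real (y v)))\<^sup>2
        \<le> w u v * (2 * (real (y u))\<^sup>2 + 2 * (real (y v))\<^sup>2)"
        by (simp only:) (intro mult_left_mono w_nonneg)
      then show "(sqrt (w u v) * (real (y u) + real (y v)))\<^sup>2
        \<le> 2 * (real (y u))\<^sup>2 * w u v + 2 * (real (y v))\<^sup>2 * w v u"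
        by (simp only: w_sym[of v u]) (simp only: distrib_left mult_ac)
    qed
    also have "\<dots> = 2 * (\<Sum>u\<in>U. \<Sum>v\<in>U. 2 * (real (y u))\<^sup>2 * w u v)"
      by (simp add: sum.distrib) (rule sum.swap)
    also have "\<dots> = (\<Sum>u\<in>U. 4 * (real (y u))\<^sup>2 * (\<Sum>v\<in>U. w u v))"
      by (simp only: sum_distrib_left) (simp add: mult.assoc)
    also have "\<dots> \<le> (\<Sum>u\<in>U. 4 * (real (y u))\<^sup>2 * D)"
      by (intro sum_mono mult_left_mono w_row) simp_all
    also have "\<dots> = 4 * D * X"
      by (simp add: X_def ip_def sum_distrib_left power2_eq_square algebra_simps)
    finally show ?thesis .
  qed
  finally have A2: "A\<^sup>2 \<le> energy (\<lambda>u. real (y u)) * (4 * D * X)"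
    by (simp add: mult_left_mono energy_nonneg)
  have X0: "0 \<le> X" by (simp add: X_def ip_self_nonneg)
  have "X * X \<le> (K * A)\<^sup>2"
    using XA X0 by (simp add: power2_eq_square mult_mono)
  also have "\<dots> \<le> K\<^sup>2 * (energy (\<lambda>u. real (y u)) * (4 * D * X))"
    using A2 by (simp add: power_mult_distrib mult_left_mono)
  finally have "X * X \<le> X * (4 * K\<^sup>2 * D * energy (\<lambda>u. real (y u)))" by (simp add: algebra_simps)
  then show ?thesis using X0 energy_nonneg[of "\<lambda>u. real (y u)"] D_pos unfolding X_def[symmetric]
    by (cases "X = 0") simp_all
qed

lemma cut_sym: "cut (U - S) = cut S"
proof -
  have "cut (U - S) = (\<Sum>u\<in>U. \<Sum>v\<in>U. w v u * of_bool (v \<in> S \<and> u \<notin> S))"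
    unfolding cut_def by (intro sum.cong refl) (auto simp: w_sym)
  also have "\<dots> = cut S" unfolding cut_def by (rule sum.swap)
  finally show ?thesis .
qed

text \<open>Cheeger's inequality; \<open>\<mu>\<close> is a median.\<close>

lemma cheeger_sweep:
  fixes x :: "'a \<Rightarrow> nat"
  assumes K: "0 \<le> K"
    and exp: "\<And>S z. z \<in> U \<Longrightarrow> S = {u\<in>U. x z \<le> x u} \<Longrightarrow> S \<noteq> U \<Longrightarrow>
      real (card S) \<le> K * cut S \<or> real (card (U - S)) \<le> K * cut S"
  obtains \<mu> :: real where
    "ip (\<lambda>u. real (x u) - \<mu>) (\<lambda>u. real (x u) - \<mu>) \<le> 4 * K\<^sup>2 * D * energy (\<lambda>u. real (x u))"
proof -
  define P where "P j \<longleftrightarrow> 2 * card {u\<in>U. j < x u} \<le> card U" for j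
  have "P (\<Sum>u\<in>U. x u)"
  proof -
    have "{u\<in>U. (\<Sum>u\<in>U. x u) < x u} = {}"
      using fin by (auto simp: not_less member_le_sum)
    then show ?thesis by (simp only: P_def) simp
  qed
  define m where "m = (LEAST j. P j)"
  have Pm: "P m" unfolding m_def by (rule LeastI) fact
  have low: "2 * card {u\<in>U. x u < m} \<le> card U"
  proof (cases m)
    case (Suc j)
    then have "\<not> P j" using not_less_Least[of j P] m_def by simp
    moreover have "card U = card {u\<in>U. x u < m} + card {u\<in>U. j < x u}"
      using Suc fin by (subst card_Un_disjoint[symmetric]) (auto intro!: arg_cong[where f = card])
    ultimately show ?thesis by (simp add: P_def)
  qed simp
  have min: "real (card S) \<le> K * cut S" if "S = {u\<in>U. j \<le> x u}" "m < j" for S j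
  proof (cases "S = {}")
    case False
    \<comment> \<open>\<open>exp\<close> speaks only of thresholds attained at a vertex. Replacing
      \<open>j\<close> by the least value occurring on \<open>S\<close> brings a nonempty level set
      into that form.\<close>
    define z where "z = arg_min_on x S"
    have finS: "finite S" using that fin by simp
    have z: "z \<in> S" "\<And>u. u \<in> S \<Longrightarrow> x z \<le> x u"
      using arg_min_if_finite[OF finS False, of x] by (auto simp: z_def not_less)
    have S: "S = {u\<in>U. x z \<le> x u}" using z that by auto
    have "S \<subseteq> {u\<in>U. m < x u}" using that by auto
    then have "card S \<le> card {u\<in>U. m < x u}" using fin by (intro card_mono) auto
    then have half: "2 * card S \<le> card U" using Pm by (simp add: P_def)
    have cU: "card (U - S) + card S = card U"
      using S fin card_mono[of U S] by (simp add: card_Diff_subset)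
    have "0 < card S" using finS False by (simp add: card_gt_0_iff)
    then have "S \<noteq> U" using half by auto
    then show ?thesis using exp[of z S] z(1) S half cU by force
  qed (simp add: cut_def)
  have max: "real (card S) \<le> K * cut S" if "S = {u\<in>U. x u < j}" "j \<le> m" for S j
  proof (cases "S = {}")
    case False
    have "S \<subseteq> {u\<in>U. x u < m}" using that by auto
    then have "card S \<le> card {u\<in>U. x u < m}" using fin by (intro card_mono) auto
    then have half: "2 * card S \<le> card U" using low by simp
    \<comment> \<open>A lower level set is handled through its complement, which is a sweep set with
      the same cut.\<close>
    define R where "R = {u\<in>U. j \<le> x u}"
    have RS: "R = U - S" "S = U - R" using that by (auto simp: R_def)
    have cU: "card R + card S = card U"
      using fin that by (subst card_Un_disjoint[symmetric]) (auto simp: R_def intro!: arg_cong[where f = card])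
    have "0 < card S" using fin that False by (auto simp: card_gt_0_iff)
    then have "0 < card R" using half cU by simp
    then have "R \<noteq> {}" by auto
    have finR: "finite R" using fin by (simp add: R_def)
    define z where "z = arg_min_on x R"
    have z: "z \<in> R" "\<And>u. u \<in> R \<Longrightarrow> x z \<le> x u"
      using arg_min_if_finite[OF finR \<open>R \<noteq> {}\<close>, of x] by (auto simp: z_def not_less)
    have R: "R = {u\<in>U. x z \<le> x u}" using z by (auto simp: R_def)
    have "R \<noteq> U" using RS False by auto
    moreover have "cut R = cut S" using RS(2) cut_sym by metis
    ultimately show ?thesis using exp[of z R] z(1) R half cU RS(2) by (force simp: R_def)
  qed (simp add: cut_def)
  \<comment> \<open>Positive and negative part of \<open>x - m\<close>. Their level sets lie
    strictly on one side of the median, where \<open>min\<close> and \<open>max\<close> provide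
    expansion.\<close>
  define y where "y u = x u - m" for u
  define y' where "y' u = m - x u" for u
  have 1: "ip (\<lambda>u. real (y u)) (\<lambda>u. real (y u)) \<le> 4 * K\<^sup>2 * D * energy (\<lambda>u. real (y u))"
  proof (rule cheeger_one_sided[OF K])
    fix j :: nat assume "0 < j"
    then have "{u\<in>U. j \<le> y u} = {u\<in>U. m + j \<le> x u}" by (auto simp: y_def)
    then show "real (card {u\<in>U. j \<le> y u}) \<le> K * cut {u\<in>U. j \<le> y u}"
      using min[of _ "m + j"] \<open>0 < j\<close> by simp
  qed
  have 2: "ip (\<lambda>u. real (y' u)) (\<lambda>u. real (y' u)) \<le> 4 * K\<^sup>2 * D * energy (\<lambda>u. real (y' u))"
  proof (rule cheeger_one_sided[OF K])
    fix j :: nat assume "0 < j"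
    then have "{u\<in>U. j \<le> y' u} = {u\<in>U. x u < m + 1 - j}" by (auto simp: y'_def)
    then show "real (card {u\<in>U. j \<le> y' u}) \<le> K * cut {u\<in>U. j \<le> y' u}"
      using max[of _ "m + 1 - j"] \<open>0 < j\<close> by simp
  qed
  \<comment> \<open>For each pair the cross terms between the two parts are nonnegative, because at
    every vertex one of the parts vanishes.\<close>
  have "energy (\<lambda>u. real (y u)) + energy (\<lambda>u. real (y' u)) \<le> energy (\<lambda>u. real (x u))"
    unfolding energy_def sum.distrib[symmetric]
  proof (intro sum_mono)
    fix u v
    have *: "real (x a) = real m + real (y a) - real (y' a)" "real (y a) * real (y' a) = 0"
      "0 \<le> real (y a)" "0 \<le> real (y' a)" for a
      by (auto simp: y_def y'_def)
    have "(real (x u) - real (x v))\<^sup>2 = (real (y u) - real (y v))\<^sup>2 + (real (y' u) - real (y' v))\<^sup>2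
       - 2 * (real (y u) * real (y' u)) - 2 * (real (y v) * real (y' v))
       + 2 * (real (y u) * real (y' v)) + 2 * (real (y v) * real (y' u))"
      unfolding *(1) by (simp add: power2_eq_square algebra_simps)
    then have "(real (y u) - real (y v))\<^sup>2 + (real (y' u) - real (y' v))\<^sup>2 \<le> (real (x u) - real (x v))\<^sup>2"
      using *(2) by simp
    from mult_left_mono[OF this w_nonneg[of u v]]
    show "w u v * (real (y u) - real (y v))\<^sup>2 + w u v * (real (y' u) - real (y' v))\<^sup>2
       \<le> w u v * (real (x u) - real (x v))\<^sup>2" by (simp add: distrib_left)
  qed
  then have "4 * K\<^sup>2 * D * (energy (\<lambda>u. real (y u)) + energy (\<lambda>u. real (y' u)))
     \<le> 4 * K\<^sup>2 * D * energy (\<lambda>u. real (x u))"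
    using D_pos by (intro mult_left_mono) simp_all
  moreover have "ip (\<lambda>u. real (x u) - m) (\<lambda>u. real (x u) - m)
      = ip (\<lambda>u. real (y u)) (\<lambda>u. real (y u)) + ip (\<lambda>u. real (y' u)) (\<lambda>u. real (y' u))"
    unfolding ip_def sum.distrib[symmetric]
  proof (intro sum.cong refl)
    fix u
    show "(real (x u) - real m) * (real (x u) - real m) = real (y u) * real (y u) + real (y' u) * real (y' u)"
    proof (cases "m \<le> x u")
      case True
      then have "real (y u) = real (x u) - real m" "y' u = 0" by (auto simp: y_def y'_def)
      then show ?thesis by simp
    next
      case False
      then have "real (x u) = real m - real (y' u)" "y u = 0" by (auto simp: y_def y'_def)
      then show ?thesis by simp
    qed
  qed
  ultimately show ?thesis using 1 2 that[of "real m"] by (simp add: distrib_left)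
qed

section \<open>Iteration on centred vectors\<close>

lemma walk_pow_contract:
  fixes x :: "'a \<Rightarrow> real" and c :: real
  assumes e: "0 \<le> e" "e \<le> 4 * D"
    and mean: "(\<Sum>u\<in>U. x u) = real (card U) * c"
    and gap: "\<And>t. t < T \<Longrightarrow> \<exists>\<mu>. e * ip (\<lambda>u. (walk ^^ t) x u - \<mu>) (\<lambda>u. (walk ^^ t) x u - \<mu>)
      \<le> energy ((walk ^^ t) x)"
    and t: "t \<le> T"
  shows "ip (\<lambda>u. (walk ^^ t) x u - (2 * D) ^ t * c) (\<lambda>u. (walk ^^ t) x u - (2 * D) ^ t * c)
    \<le> (4 * D\<^sup>2 - D * e) ^ t * ip (\<lambda>u. x u - c) (\<lambda>u. x u - c)"
  using t
proof (induction t)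
  case (Suc t)
  define y where "y = (walk ^^ t) x"
  define b where "b = (2 * D) ^ t * c"
  define z where "z u = y u - b" for u
  obtain \<mu> where \<mu>: "e * ip (\<lambda>u. y u - \<mu>) (\<lambda>u. y u - \<mu>) \<le> energy y"
    using gap[of t] Suc.prems by (auto simp: y_def)
  have "(\<Sum>u\<in>U. z u) = 0"
    using sum_walk_pow[of t x] mean by (simp add: z_def sum_subtractf y_def b_def algebra_simps)
  moreover have "(y u - \<mu>) * (y u - \<mu>) = z u * z u + 2 * (b - \<mu>) * z u + (b - \<mu>)\<^sup>2" for u
    by (simp add: z_def power2_eq_square algebra_simps)
  ultimately have "ip (\<lambda>u. y u - \<mu>) (\<lambda>u. y u - \<mu>) = ip z z + real (card U) * (b - \<mu>)\<^sup>2"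
    by (simp add: ip_def sum.distrib sum_distrib_left[symmetric])
  \<comment> \<open>\<open>\<mu>\<close> is an arbitrary centre, but the mean \<open>b\<close>
    minimises the squared distance to the constants.\<close>
  then have "ip z z \<le> ip (\<lambda>u. y u - \<mu>) (\<lambda>u. y u - \<mu>)" by simp
  then have "e * ip z z \<le> energy y" using \<mu> mult_left_mono[OF _ e(1)] by fastforce
  moreover have "energy z = energy y" by (simp add: energy_def z_def)
  ultimately have "D * (e * ip z z) \<le> D * energy z" using D_pos by simp
  then have "ip (walk z) (walk z) \<le> (4 * D\<^sup>2 - D * e) * ip z z"
    using walk_norm_le[of z] by (simp add: algebra_simps)
  also have "\<dots> \<le> (4 * D\<^sup>2 - D * e) * ((4 * D\<^sup>2 - D * e) ^ t * ip (\<lambda>u. x u - c) (\<lambda>u. x u - c))"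
  proof (rule mult_left_mono)
    show "ip z z \<le> (4 * D\<^sup>2 - D * e) ^ t * ip (\<lambda>u. x u - c) (\<lambda>u. x u - c)"
      using Suc by (simp add: z_def[abs_def] y_def b_def)
    have "D * e \<le> D * (4 * D)" using e D_pos by simp
    then show "0 \<le> 4 * D\<^sup>2 - D * e" by (simp add: power2_eq_square)
  qed
  finally show ?case
    by (simp add: walk_shift z_def[abs_def] y_def b_def mult.assoc ip_def)
qed simp

lemma cut_indicator:
  shows "energy (\<lambda>u. of_bool (u \<in> W) - c) = 2 * cut W"
proof -
  have "energy (\<lambda>u. of_bool (u \<in> W) - c) =
      (\<Sum>u\<in>U. \<Sum>v\<in>U. w u v * of_bool (u \<in> W \<and> v \<notin> W) + w v u * of_bool (v \<in> W \<and> u \<notin> W))"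
    unfolding energy_def by (intro sum.cong refl) (auto simp: w_sym)
  also have "\<dots> = cut W + (\<Sum>u\<in>U. \<Sum>v\<in>U. w v u * of_bool (v \<in> W \<and> u \<notin> W))"
    by (simp add: sum.distrib cut_def)
  also have "(\<Sum>u\<in>U. \<Sum>v\<in>U. w v u * of_bool (v \<in> W \<and> u \<notin> W)) = cut W"
    unfolding cut_def by (rule sum.swap)
  finally show ?thesis by simp
qed

text \<open>The centred indicator of a set with a small cut decays slowly under the iteration, while it
  is the sum of the centred unit vectors, each of which decays fast.\<close>

lemma walk_gap_bound:
  assumes W: "W \<subseteq> U" "W \<noteq> {}" "2 * card W \<le> card U"
    and cut: "cut W \<le> D * g * real (card W)" and g: "g \<le> 1"
    and e: "0 \<le> e" "e \<le> 4 * D"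
    and gap: "\<And>v t. v \<in> U \<Longrightarrow> t < T \<Longrightarrow> \<exists>\<mu>.
      e * ip (\<lambda>u. (walk ^^ t) (\<lambda>u. of_bool (u = v)) u - \<mu>) (\<lambda>u. (walk ^^ t) (\<lambda>u. of_bool (u = v)) u - \<mu>)
      \<le> energy ((walk ^^ t) (\<lambda>u. of_bool (u = v)))"
  shows "(1 - g) ^ (2 * T) \<le> real (card U) * (1 - e / (4 * D)) ^ T"
proof -
  define m where "m = real (card U)"
  define k where "k = real (card W)"
  have finW: "finite W" using W fin finite_subset by blast
  have k: "0 < k" "2 * k \<le> m" using W finW by (auto simp: k_def m_def card_gt_0_iff)
  define d where "d v u = (of_bool (u = v) :: real)" for u v :: 'a
  define z where "z v u = d v u - 1 / m" for u v :: 'a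
  define f where "f u = of_bool (u \<in> W) - k / m" for u :: 'a
  have f_sum: "f = (\<lambda>u. \<Sum>v\<in>W. z v u)"
    using finW by (auto simp: f_def z_def d_def fun_eq_iff sum_subtractf k_def of_bool_def)
  have ff: "ip f f = k * (1 - k / m)"
  proof -
    have "f u * f u = of_bool (u \<in> W) * (1 - 2 * k / m) + (k / m)\<^sup>2" for u
      by (simp add: f_def power2_eq_square algebra_simps)
    moreover have "(\<Sum>u\<in>U. of_bool (u \<in> W)) = k"
      using W(1) fin by (simp add: k_def of_bool_def sum.If_cases Int_absorb1)
    ultimately have "ip f f = k * (1 - 2 * k / m) + m * (k / m)\<^sup>2"
      by (simp add: ip_def sum.distrib sum_distrib_right[symmetric] m_def)
    then show ?thesis using k by (simp add: field_simps power2_eq_square)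
  qed
  have "k / m \<le> 1 / 2" using k by (simp add: field_simps)
  \<comment> \<open>Centring the indicator of at most half of the vertices loses at most half of its
    squared norm.\<close>
  then have ff2: "k / 2 \<le> ip f f" unfolding ff using k by (simp add: field_simps)
  have "energy f = 2 * cut W" unfolding f_def[abs_def] by (rule cut_indicator)
  moreover have "cut W \<le> D * g * k" using cut by (simp add: k_def)
  moreover have "0 \<le> cut W" by (simp add: cut_def sum_nonneg w_nonneg)
  moreover have "0 \<le> g"
    using calculation(2,3) D_pos k by (metis mult_pos_pos mult_le_0_iff not_le order_trans zero_le_mult_iff)
  then have "D * g * k \<le> D * g * (2 * ip f f)"
    using ff2 D_pos by (intro mult_left_mono) simp_all
  \<comment> \<open>The Rayleigh quotient of \<open>f\<close> is close to \<open>2 * D\<close>,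
    because \<open>energy f = 2 * cut W\<close> is at most
    \<open>4 * D * g * ip f f\<close>.\<close>
  ultimately have "2 * D * (1 - g) * ip f f \<le> ip f (walk f)"
    unfolding ip_walk_self by (simp add: algebra_simps)
  then have low: "(2 * D * (1 - g)) ^ (2 * T) * ip f f \<le> ip ((walk ^^ T) f) ((walk ^^ T) f)"
    using g D_pos by (intro walk_pow_norm_ge) simp_all
  define q where "q = 4 * D\<^sup>2 - D * e"
  have "D * e \<le> D * (4 * D)" using e D_pos by simp
  then have q: "0 \<le> q" by (simp add: q_def power2_eq_square)
  have z: "ip ((walk ^^ T) (z v)) ((walk ^^ T) (z v)) \<le> q ^ T" if v: "v \<in> W" for v
  proof -
    have vU: "v \<in> U" using v W by auto
    have sd: "(\<Sum>u\<in>U. d v u) = 1" using vU fin by (simp add: d_def of_bool_def)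
    have "ip (\<lambda>u. (walk ^^ T) (d v) u - (2 * D) ^ T * (1 / m)) (\<lambda>u. (walk ^^ T) (d v) u - (2 * D) ^ T * (1 / m))
      \<le> (4 * D\<^sup>2 - D * e) ^ T * ip (\<lambda>u. d v u - 1 / m) (\<lambda>u. d v u - 1 / m)"
      using sd k gap[OF vU] by (intro walk_pow_contract[OF e, where T = T])
        (simp_all add: m_def d_def[abs_def])
    also have "ip (\<lambda>u. d v u - 1 / m) (\<lambda>u. d v u - 1 / m) \<le> 1"
    proof -
      have "(d v u - 1 / m) * (d v u - 1 / m) = d v u * (1 - 2 / m) + 1 / m\<^sup>2" for u
        by (simp add: d_def power2_eq_square algebra_simps)
      then have "ip (\<lambda>u. d v u - 1 / m) (\<lambda>u. d v u - 1 / m) = 1 - 2 / m + m * (1 / m\<^sup>2)"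
        by (simp add: ip_def sum.distrib sum_distrib_right[symmetric] sd m_def[symmetric])
      also have "\<dots> = 1 - 1 / m" using k by (simp add: power2_eq_square)
      finally show ?thesis using k by simp
    qed
    finally show ?thesis using q unfolding z_def[abs_def] walk_pow_shift q_def
      by (simp add: mult_left_mono)
  qed
  have "ip ((walk ^^ T) f) ((walk ^^ T) f) = (\<Sum>u\<in>U. (\<Sum>v\<in>W. (walk ^^ T) (z v) u)\<^sup>2)"
    unfolding f_sum walk_pow_sum by (simp add: ip_def power2_eq_square)
  \<comment> \<open>Cauchy-Schwarz loses a factor \<open>k\<close>, and the number of summands is
    another \<open>k\<close>. Division by \<open>ip f f \<ge> k / 2\<close> leaves
    \<open>2 * k \<le> m\<close>.\<close>
  also have "\<dots> \<le> (\<Sum>u\<in>U. k * (\<Sum>v\<in>W. ((walk ^^ T) (z v) u)\<^sup>2))"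
    unfolding k_def by (intro sum_mono) (metis sum_squared_le_sum_of_squares mult.commute)
  also have "\<dots> = k * (\<Sum>v\<in>W. ip ((walk ^^ T) (z v)) ((walk ^^ T) (z v)))"
    unfolding ip_def sum_distrib_left[symmetric] by (subst sum.swap) (simp add: power2_eq_square)
  also have "\<dots> \<le> k * (\<Sum>v\<in>W. q ^ T)"
    using z k by (intro mult_left_mono sum_mono) simp_all
  also have "\<dots> = k * (k * q ^ T)" by (simp add: k_def)
  finally have "(2 * D * (1 - g)) ^ (2 * T) * ip f f \<le> k * (k * q ^ T)" using low by simp
  moreover have "(2 * D * (1 - g)) ^ (2 * T) * (k / 2) \<le> (2 * D * (1 - g)) ^ (2 * T) * ip f f"
    using ff2 by (intro mult_left_mono) (simp_all add: power_mult)
  ultimately have "(2 * D * (1 - g)) ^ (2 * T) * k \<le> 2 * (k * (k * q ^ T))" by linarith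
  then have "k * (2 * D * (1 - g)) ^ (2 * T) \<le> k * (2 * k * q ^ T)" by (simp only: mult_ac)
  then have 1: "(2 * D * (1 - g)) ^ (2 * T) \<le> 2 * k * q ^ T" using k by simp
  also have "\<dots> \<le> m * q ^ T" using k q by (intro mult_right_mono) simp_all
  also have "q = (2 * D)\<^sup>2 * (1 - e / (4 * D))"
    using D_pos by (simp add: q_def power2_eq_square field_simps)
  finally have 2: "(2 * D * (1 - g)) ^ (2 * T) \<le> m * ((2 * D)\<^sup>2 * (1 - e / (4 * D))) ^ T" .
  have "(a * b) ^ (2 * T) = (a\<^sup>2) ^ T * b ^ (2 * T)" for a b :: real
    by (simp add: power_mult power_mult_distrib)
  with 2 have "((2 * D)\<^sup>2) ^ T * (1 - g) ^ (2 * T) \<le> m * (((2 * D)\<^sup>2) ^ T * (1 - e / (4 * D)) ^ T)"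
    by (simp only: power_mult_distrib[of "(2 * D)\<^sup>2" "1 - e / (4 * D)"])
  then have "((2 * D)\<^sup>2) ^ T * (1 - g) ^ (2 * T) \<le> ((2 * D)\<^sup>2) ^ T * (m * (1 - e / (4 * D)) ^ T)"
    by (simp only: mult.left_commute)
  then show ?thesis using D_pos by (simp add: m_def)
qed

end

section \<open>Edge counts\<close>

text \<open>Ordered adjacent pairs, so an edge inside both sets counts twice; the double sum is the
  form that the program can evaluate.\<close>

definition pairs :: "'a set set \<Rightarrow> 'a set \<Rightarrow> 'a set \<Rightarrow> nat" where
  "pairs E A B = (\<Sum>u\<in>A. \<Sum>v\<in>B. of_bool ({u, v} \<in> E))"

lemma pairs_commute: "pairs E A B = pairs E B A"
  unfolding pairs_def by (subst sum.swap) (simp add: insert_commute)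

lemma pairs_Un_left:
  "finite A \<Longrightarrow> finite B \<Longrightarrow> A \<inter> B = {} \<Longrightarrow> pairs E (A \<union> B) X = pairs E A X + pairs E B X"
  by (simp add: pairs_def sum.union_disjoint)

lemma pairs_Un_right:
  "finite A \<Longrightarrow> finite B \<Longrightarrow> A \<inter> B = {} \<Longrightarrow> pairs E X (A \<union> B) = pairs E X A + pairs E X B"
  using pairs_Un_left[of A B E X] by (simp add: pairs_commute)

lemma pairs_split:
  assumes "finite U" "S \<subseteq> U"
  shows "pairs E U U = pairs E S S + pairs E (U - S) (U - S) + 2 * pairs E S (U - S)"
proof -
  have fin: "finite S" "finite (U - S)" "S \<inter> (U - S) = {}" using assms by (auto intro: finite_subset)
  have "pairs E (S \<union> (U - S)) (S \<union> (U - S)) =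
      pairs E S S + pairs E (U - S) (U - S) + (pairs E S (U - S) + pairs E (U - S) S)"
    using fin by (simp only: pairs_Un_left pairs_Un_right)
  moreover have "S \<union> (U - S) = U" using assms by auto
  ultimately show ?thesis using pairs_commute[of E "U - S" S] by simp
qed

lemma pairs_le_degree:
  assumes "finite B" "\<And>u. u \<in> A \<Longrightarrow> card {v\<in>B. {u, v} \<in> E} \<le> D"
  shows "pairs E A B \<le> card A * D"
proof -
  have "(\<Sum>v\<in>B. of_bool ({u, v} \<in> E)) = card {v\<in>B. {u, v} \<in> E}" for u
    using assms(1) by (simp add: of_bool_def sum.If_cases Int_def)
  then have "pairs E A B = (\<Sum>u\<in>A. card {v\<in>B. {u, v} \<in> E})" by (simp add: pairs_def)
  also have "\<dots> \<le> (\<Sum>u\<in>A. D)" using assms(2) by (rule sum_mono)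
  finally show ?thesis by simp
qed

text \<open>Over an edge, the map from \<open>(u, v)\<close> to \<open>{u, v}\<close> has a fibre of
  two elements.\<close>

lemma pairs_induced:
  assumes "finite W" and E: "\<And>e. e \<in> E \<Longrightarrow> card e = 2"
  shows "pairs E W W = 2 * card (induced_edges E W)"
proof -
  define Q where "Q e = {(u, v). {u, v} = e}" for e :: "'a set"
  have Q2: "card (Q e) = 2" and fin: "finite (Q e)" if "e \<in> E" for e
  proof -
    obtain a b where ab: "e = {a, b}" "a \<noteq> b" using E[OF \<open>e \<in> E\<close>] by (meson card_2_iff)
    then have "Q e = {(a, b), (b, a)}" by (auto simp: Q_def doubleton_eq_iff)
    then show "card (Q e) = 2" "finite (Q e)" using ab by simp_all
  qed
  have finI: "finite (induced_edges E W)"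
    by (rule finite_subset[of _ "Pow W"]) (use assms(1) in \<open>auto simp: induced_edges_def\<close>)
  have "pairs E W W = (\<Sum>(u,v)\<in>W \<times> W. of_bool ({u, v} \<in> E))"
    by (simp add: pairs_def sum.cartesian_product)
  also have "\<dots> = card {x \<in> W \<times> W. {fst x, snd x} \<in> E}"
    using assms(1) by (simp add: case_prod_beta of_bool_def sum.If_cases Int_def)
  also have "{x \<in> W \<times> W. {fst x, snd x} \<in> E} = (\<Union>e\<in>induced_edges E W. Q e)"
    by (auto simp: Q_def induced_edges_def)
  also have "card \<dots> = (\<Sum>e\<in>induced_edges E W. card (Q e))"
    using finI fin by (intro card_UN_disjoint) (auto simp: Q_def induced_edges_def)
  also have "\<dots> = (\<Sum>e\<in>induced_edges E W. 2)"
    using Q2 by (intro sum.cong) (auto simp: induced_edges_def)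
  finally show ?thesis by simp
qed

text \<open>A new maximum changes no earlier rank, hence the induction along the order. Selection by
  rank is how a set is cut down to a prescribed size.\<close>

lemma card_rank_le:
  fixes U :: "nat set"
  assumes "finite U"
  shows "card {u\<in>U. card {v\<in>U. v \<le> u} \<le> k} = min k (card U)"
  using assms
proof (induction U rule: finite_linorder_max_induct)
  case (insert b A)
  have "b \<notin> A" using insert.hyps(2) by blast
  let ?R = "\<lambda>U u. card {v\<in>U. v \<le> u}"
  have "{v \<in> insert b A. v \<le> u} = {v\<in>A. v \<le> u}" if "u \<in> A" for u
    using insert.hyps that by (metis (mono_tags, opaque_lifting) insertE insertI2 leD)
  then have "?R (insert b A) u = ?R A u" if "u \<in> A" for u using that by simp
  moreover have "{v \<in> insert b A. v \<le> b} = insert b A" using insert.hyps by auto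
  then have "?R (insert b A) b = Suc (card A)" using insert.hyps \<open>b \<notin> A\<close> by simp
  ultimately have "{u \<in> insert b A. ?R (insert b A) u \<le> k} =
      (if Suc (card A) \<le> k then insert b {u\<in>A. ?R A u \<le> k} else {u\<in>A. ?R A u \<le> k})"
    by auto
  moreover have "card {u\<in>A. ?R A u \<le> k} = min k (card A)" by (rule insert.IH)
  ultimately show ?case using insert.hyps(1) \<open>b \<notin> A\<close> by simp
qed simp

section \<open>Sweep cuts and the expansion criterion\<close>

definition sweep :: "'a set \<Rightarrow> ('a \<Rightarrow> nat) \<Rightarrow> 'a \<Rightarrow> 'a set" where
  "sweep U x z = {u\<in>U. x z \<le> x u}"

definition sparse_sweep :: "nat \<Rightarrow> 'a set set \<Rightarrow> 'a set \<Rightarrow> ('a \<Rightarrow> nat) \<Rightarrow> 'a \<Rightarrow> bool" where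
  "sparse_sweep K E U x z \<longleftrightarrow> (let S = sweep U x z in
     z \<in> U \<and> 1 \<le> card (U - S) \<and> K * pairs E S (U - S) \<le> card S \<and> K * pairs E S (U - S) \<le> card (U - S))"

abbreviation edge_walk :: "nat \<Rightarrow> 'a set set \<Rightarrow> 'a set \<Rightarrow> ('a \<Rightarrow> real) \<Rightarrow> 'a \<Rightarrow> real" where
  "edge_walk D E U \<equiv> weighted_graph.walk U (\<lambda>u v. of_bool ({u, v} \<in> E)) (real D)"

text \<open>A certificate that remains meaningful after the stored iterate has been overwritten. The
  natural-valued \<open>x\<close> stands for the stored integers, which need to match the real
  iterate only on \<open>U\<close>.\<close>

definition no_sparse_sweep ::
    "nat \<Rightarrow> nat \<Rightarrow> 'a set set \<Rightarrow> 'a set \<Rightarrow> 'a \<Rightarrow> nat \<Rightarrow> bool" where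
  "no_sparse_sweep D K E U v t \<longleftrightarrow>
     (\<exists>x :: 'a \<Rightarrow> nat. (\<forall>u\<in>U. real (x u) = (edge_walk D E U ^^ t) (\<lambda>u. of_bool (u = v)) u) \<and>
        (\<forall>z. \<not> sparse_sweep K E U x z))"

lemma weighted_graph_edges:
  assumes "finite U" "0 < D" "\<And>u. u \<in> U \<Longrightarrow> card {v\<in>U. {u, v} \<in> E} \<le> D"
  shows "weighted_graph U (\<lambda>u v. of_bool ({u, v} \<in> E)) (real D)"
proof
  fix u assume "u \<in> U"
  have "(\<Sum>v\<in>U. of_bool ({u, v} \<in> E)) = real (card {v\<in>U. {u, v} \<in> E})"
    using assms(1) by (simp add: of_bool_def sum.If_cases Int_def)
  then show "(\<Sum>v\<in>U. of_bool ({u, v} \<in> E)) \<le> real D" using assms(3)[OF \<open>u \<in> U\<close>] by simp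
qed (use assms in \<open>auto simp: insert_commute\<close>)

text \<open>A small neighbourhood gives a small cut, as each outer vertex carries at most
  \<open>D\<close> of its edges. For such a cut the two decay rates compared by
  \<open>walk_gap_bound\<close> are incompatible after \<open>T\<close> rounds.\<close>

lemma expander_if_no_sparse_sweep:
  assumes fin: "finite U" and D: "0 < D" and K: "0 < K"
    and deg: "\<And>u. u \<in> U \<Longrightarrow> card {v\<in>U. {u, v} \<in> E} \<le> D"
    and T: "32 * D\<^sup>2 * K\<^sup>2 * card U \<le> T"
    and sw: "\<And>v t. v \<in> U \<Longrightarrow> t < T \<Longrightarrow> no_sparse_sweep D K E U v t"
  shows "expander (1 / (64 * (real D)\<^sup>2 * (real K)\<^sup>2)) U (induced_edges E U)"
  unfolding expander_def
proof (intro allI impI, elim conjE)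
  interpret G: weighted_graph U "\<lambda>u v. of_bool ({u, v} \<in> E)" "real D"
    using fin D deg by (rule weighted_graph_edges)
  \<comment> \<open>\<open>e\<close> is the gap that Cheeger yields, \<open>h\<close> the resulting
    relative loss of squared norm per round, and \<open>g = h / 4\<close> makes
    \<open>(1 - g)\<^sup>2\<close> exceed \<open>1 - h\<close> by about
    \<open>h / 2\<close>.\<close>
  define g where "g = 1 / (64 * (real D)\<^sup>2 * (real K)\<^sup>2)"
  define e where "e = 1 / (4 * (real K)\<^sup>2 * real D)"
  define h where "h = 1 / (16 * (real D)\<^sup>2 * (real K)\<^sup>2)"
  have DK: "1 \<le> (real D)\<^sup>2" "1 \<le> (real K)\<^sup>2" "1 \<le> real D" using D K by (simp_all add: Suc_leI)
  then have DK1: "1 \<le> (real D)\<^sup>2 * (real K)\<^sup>2" "1 \<le> (real K)\<^sup>2 * real D"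
    by (metis mult_mono mult_1 zero_le_one order_trans zero_le_power2)+
  have h: "0 < h" "h \<le> 1" "g = h / 4" "h = e / (4 * real D)"
    using D K DK1 by (simp_all add: h_def g_def e_def field_simps power2_eq_square)
  have e: "0 \<le> e" "e \<le> 4 * real D"
  proof -
    show "0 \<le> e" by (simp add: e_def)
    have "e \<le> 1" using DK1 by (simp add: e_def field_simps)
    then show "e \<le> 4 * real D" using DK by simp
  qed
  have cut_eq: "G.cut S = real (pairs E S (U - S))" if "S \<subseteq> U" for S
  proof -
    have "G.cut S = (\<Sum>u\<in>S. \<Sum>v\<in>U. of_bool ({u, v} \<in> E) * of_bool (u \<in> S \<and> v \<notin> S))"
      unfolding G.cut_def using fin that by (intro sum.mono_neutral_right) auto
    also have "\<dots> = (\<Sum>u\<in>S. \<Sum>v\<in>U - S. of_bool ({u, v} \<in> E))"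
    proof (rule sum.cong[OF refl])
      fix u assume "u \<in> S"
      then show "(\<Sum>v\<in>U. of_bool ({u, v} \<in> E) * of_bool (u \<in> S \<and> v \<notin> S)) =
          (\<Sum>v\<in>U - S. of_bool ({u, v} \<in> E) :: real)"
        using fin by (intro sum.mono_neutral_cong_right) auto
    qed
    finally show ?thesis by (simp add: pairs_def)
  qed
  have gap: "\<exists>\<mu>. e * G.ip (\<lambda>u. (G.walk ^^ t) (\<lambda>u. of_bool (u = v)) u - \<mu>)
      (\<lambda>u. (G.walk ^^ t) (\<lambda>u. of_bool (u = v)) u - \<mu>) \<le> G.energy ((G.walk ^^ t) (\<lambda>u. of_bool (u = v)))"
    if v: "v \<in> U" and t: "t < T" for v t
  proof -
    obtain x where x: "\<And>u. u \<in> U \<Longrightarrow> real (x u) = (G.walk ^^ t) (\<lambda>u. of_bool (u = v)) u"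
      and ns: "\<And>z. \<not> sparse_sweep K E U x z"
      using sw[OF v t] unfolding no_sparse_sweep_def by blast
    have expand: "real (card S) \<le> real K * G.cut S \<or> real (card (U - S)) \<le> real K * G.cut S"
      if z: "z \<in> U" "S = {u\<in>U. x z \<le> x u}" "S \<noteq> U" for S z
    proof -
      have SU: "S \<subseteq> U" using z by auto
      then have "U - S \<noteq> {}" using z(3) by auto
      then have "1 \<le> card (U - S)" using fin by (simp add: Suc_le_eq card_gt_0_iff)
      then have "card S \<le> K * pairs E S (U - S) \<or> card (U - S) \<le> K * pairs E S (U - S)"
        using ns[of z] z by (auto simp: sparse_sweep_def sweep_def Let_def)
      then show ?thesis unfolding cut_eq[OF SU] of_nat_mult[symmetric] of_nat_le_iff .
    qed
    obtain \<mu> where \<mu>: "G.ip (\<lambda>u. real (x u) - \<mu>) (\<lambda>u. real (x u) - \<mu>)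
        \<le> 4 * (real K)\<^sup>2 * real D * G.energy (\<lambda>u. real (x u))"
      by (rule G.cheeger_sweep[OF of_nat_0_le_iff expand])
    have 1: "G.ip (\<lambda>u. real (x u) - \<mu>) (\<lambda>u. real (x u) - \<mu>) =
        G.ip (\<lambda>u. (G.walk ^^ t) (\<lambda>u. of_bool (u = v)) u - \<mu>) (\<lambda>u. (G.walk ^^ t) (\<lambda>u. of_bool (u = v)) u - \<mu>)"
      by (simp add: G.ip_def x)
    have 2: "G.energy (\<lambda>u. real (x u)) = G.energy ((G.walk ^^ t) (\<lambda>u. of_bool (u = v)))"
      by (simp add: G.energy_def x)
    show ?thesis using \<mu> D K unfolding 1 2
      by (intro exI[of _ \<mu>]) (simp add: e_def field_simps)
  qed
  fix W assume W: "W \<subseteq> U" and Wh: "real (card W) \<le> real (card U) / 2"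
  define N where "N = ext_nbhd U (induced_edges E U) W"
  have finN: "finite N" and NU: "N \<subseteq> U - W" using fin by (auto simp: N_def ext_nbhd_def)
  show "g * real (card W) \<le> real (card (ext_nbhd U (induced_edges E U) W))"
  proof (rule ccontr)
    assume neg: "\<not> ?thesis"
    then have small: "real (card N) \<le> g * real (card W)" by (simp add: N_def)
    have Wne: "W \<noteq> {}" using neg by auto
    have finW: "finite W" using W fin finite_subset by blast
    have "pairs E W (U - W) = pairs E (U - W) W" by (rule pairs_commute)
    also have "\<dots> = (\<Sum>v\<in>N. \<Sum>u\<in>W. of_bool ({v, u} \<in> E))"
      unfolding pairs_def
    proof (rule sum.mono_neutral_right)
      show "\<forall>v\<in>U - W - N. (\<Sum>u\<in>W. of_bool ({v, u} \<in> E)) = (0 :: nat)"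
        using W by (auto simp: N_def ext_nbhd_def induced_edges_def intro!: sum.neutral)
    qed (use fin NU in auto)
    also have "\<dots> = pairs E N W" by (simp add: pairs_def)
    also have "\<dots> \<le> card N * D"
    proof (rule pairs_le_degree[OF finW])
      fix v assume "v \<in> N"
      then have "v \<in> U" using NU by auto
      have "card {u\<in>W. {v, u} \<in> E} \<le> card {u\<in>U. {v, u} \<in> E}"
        using W fin by (intro card_mono) auto
      then show "card {u\<in>W. {v, u} \<in> E} \<le> D" using deg[OF \<open>v \<in> U\<close>] by simp
    qed
    finally have "real (pairs E W (U - W)) \<le> real (card N) * real D"
      by (metis of_nat_le_iff of_nat_mult)
    also have "\<dots> \<le> real D * g * real (card W)"
      using mult_left_mono[OF small, of "real D"] by (simp add: mult_ac)
    finally have cutW: "G.cut W \<le> real D * g * real (card W)" by (simp add: cut_eq[OF W])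
    have half: "2 * card W \<le> card U" using Wh by linarith
    have key: "(1 - g) ^ (2 * T) \<le> real (card U) * (1 - h) ^ T"
      using G.walk_gap_bound[OF W Wne half cutW _ e gap] h by simp
    \<comment> \<open>One round separates the rates by a factor \<open>1 + h / 2\<close>: the value
      \<open>1 - h / 2\<close> lies between \<open>(1 - h) * (1 + h / 2)\<close> and
      \<open>(1 - g)\<^sup>2\<close>.\<close>
    have "(1 - h) * (1 + h / 2) = 1 - h / 2 - h * h / 2" by (simp add: field_simps)
    moreover have "(1 - g)\<^sup>2 = 1 - h / 2 + g * g" using h(3) by (simp add: power2_eq_square field_simps)
    ultimately have "(1 - h) * (1 + h / 2) \<le> (1 - g)\<^sup>2"
      using zero_le_square[of g] zero_le_square[of h] by linarith
    moreover have p0: "0 \<le> (1 - h) * (1 + h / 2)" using h(1,2) by simp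
    ultimately have "((1 - h) * (1 + h / 2)) ^ T \<le> (1 - g) ^ (2 * T)"
      by (simp add: power_mono power_mult)
    with key have a: "(1 - h) ^ T * (1 + h / 2) ^ T \<le> (1 - h) ^ T * real (card U)"
      by (simp add: power_mult_distrib mult.commute)
    have h1: "h < 1" using DK1 by (simp add: h_def field_simps)
    have b: "(1 + h / 2) ^ T \<le> real (card U)"
      using a h1 by (simp add: mult_le_cancel_left_pos)
    \<comment> \<open>Bernoulli suffices because \<open>T * (h / 2)\<close> is at least
      \<open>card U\<close>; this is the origin of the constant 32 in the bound on
      \<open>T\<close>.\<close>
    have "1 + real T * (h / 2) \<le> (1 + h / 2) ^ T"
      using h Bernoulli_inequality[of "h / 2" T] by simp
    moreover have "real (card U) \<le> real T * (h / 2)"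
    proof -
      have "real (32 * D\<^sup>2 * K\<^sup>2 * card U) \<le> real T" using T of_nat_le_iff by blast
      then have "32 * (real D)\<^sup>2 * (real K)\<^sup>2 * real (card U) \<le> real T" by simp
      then have "32 * (real D)\<^sup>2 * (real K)\<^sup>2 * real (card U) * (h / 2) \<le> real T * (h / 2)"
        using h by (intro mult_right_mono) simp_all
      then show ?thesis using D K by (simp add: h_def field_simps)
    qed
    ultimately show False using b by linarith
  qed
qed

section \<open>The algorithm\<close>

text \<open>The \<open>_expr\<close> functions denote values in a state, not programs. They are
  composed of constructs that have a \<open>cexp\<close> rule, so polynomial computability follows
  from their syntax.\<close>

definition card_expr :: "nat \<Rightarrow> state \<Rightarrow> nat" where
  "card_expr a s = (\<Sum>u<s 0 0. if \<not> s a u = 0 then 1 else 0)"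

definition pairs_expr :: "nat \<Rightarrow> state \<Rightarrow> nat" where
  "pairs_expr a s = (\<Sum>u<s 0 0. \<Sum>v<s 0 0.
     if \<not> s a u = 0 \<and> \<not> s a v = 0 \<and> \<not> s 1 (s 0 0 * u + v) = 0 then 1 else 0)"

definition sweep_card_expr :: "nat \<Rightarrow> state \<Rightarrow> nat" where
  "sweep_card_expr z s = (\<Sum>u<s 0 0. if \<not> s 4 u = 0 \<and> s 5 z \<le> s 5 u then 1 else 0)"

definition sweep_cocard_expr :: "nat \<Rightarrow> state \<Rightarrow> nat" where
  "sweep_cocard_expr z s = (\<Sum>u<s 0 0. if \<not> s 4 u = 0 \<and> s 5 u < s 5 z then 1 else 0)"

definition sweep_cut_expr :: "nat \<Rightarrow> state \<Rightarrow> nat" where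
  "sweep_cut_expr z s = (\<Sum>u<s 0 0. \<Sum>v<s 0 0.
     if (\<not> s 4 u = 0 \<and> s 5 z \<le> s 5 u) \<and> (\<not> s 4 v = 0 \<and> s 5 v < s 5 z) \<and> \<not> s 1 (s 0 0 * u + v) = 0
     then 1 else 0)"

text \<open>The degree times \<open>s 5 u\<close> is written as a sum to avoid a product. The
  subtraction comes last: with degrees at most \<open>D\<close> the subtrahend is at most the first
  term, so truncation never takes effect.\<close>

definition walk_expr :: "nat \<Rightarrow> nat \<Rightarrow> state \<Rightarrow> nat" where
  "walk_expr D u s = (2 * D) * s 5 u
     + (\<Sum>v<s 0 0. if \<not> s 4 v = 0 \<and> \<not> s 1 (s 0 0 * u + v) = 0 then s 5 v else 0)
     - (\<Sum>v<s 0 0. if \<not> s 4 v = 0 \<and> \<not> s 1 (s 0 0 * u + v) = 0 then s 5 u else 0)"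

text \<open>
  Array 4 holds the current vertex set \<open>U\<close>, array 5 the iterate \<open>M\<^sup>t \<delta>\<^sub>v\<close>, and arrays 6 and 7
  the numbers \<open>v\<close> and \<open>t\<close>; array 8 receives the sweep set that splits \<open>U\<close>. Tests are written
  \<open>\<not> _ = 0\<close> because the rules for \<open>cbool\<close> match this form syntactically.
\<close>

locale algorithm =
  fixes D K C p q pa pb qa :: nat
begin

definition sparse_expr :: "nat \<Rightarrow> state \<Rightarrow> bool" where
  "sparse_expr z s \<longleftrightarrow> \<not> s 4 z = 0 \<and> 1 \<le> sweep_cocard_expr z s \<and>
     K * sweep_cut_expr z s \<le> sweep_card_expr z s \<and> K * sweep_cut_expr z s \<le> sweep_cocard_expr z s"

text \<open>The least \<open>z\<close> with a sparse sweep is singled out by a formula, so the sweep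
  set can be written entry by entry without storing \<open>z\<close>.\<close>

definition pick_expr :: "nat \<Rightarrow> state \<Rightarrow> nat" where
  "pick_expr u s = (if \<exists>z<s 0 0. sparse_expr z s \<and> \<not> (\<exists>y<s 0 0. y < z \<and> sparse_expr y s) \<and>
     (\<not> s 4 u = 0 \<and> s 5 z \<le> s 5 u) then 1 else 0)"

text \<open>The inequality \<open>e(U) \<ge> F(|U|)\<close> multiplied by \<open>2 q n\<close>, with
  \<open>pairs_expr\<close> as twice the edge count. The squared cardinality is a sum of
  \<open>card_expr\<close> over the members.\<close>

definition dense_expr :: "nat \<Rightarrow> state \<Rightarrow> bool" where
  "dense_expr a s \<longleftrightarrow>
     (2 * p) * (s 0 0 * card_expr a s) + 2 * (\<Sum>u<s 0 0. if s a u = 0 then 0 else card_expr a s)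
       \<le> q * (s 0 0 * pairs_expr a s)"

definition small_expr :: "state \<Rightarrow> bool" where
  "small_expr s \<longleftrightarrow> qa * card_expr 4 s \<le> pb * s 0 0"

definition reset :: "state \<Rightarrow> state" where
  "reset s = amap 5 (\<lambda>k s. if k = s 6 0 then 1 else 0) (amap 7 (\<lambda>k s. 0) s)"

text \<open>When the sweep set fails the density test, its complement is kept untested;
  \<open>dense_split\<close> justifies this.\<close>

definition split :: "state \<Rightarrow> state" where
  "split s = amap 4 (\<lambda>u s. if dense_expr 8 s then s 8 u else if \<not> s 4 u = 0 \<and> s 8 u = 0 then 1 else 0)
     (amap 8 pick_expr s)"

text \<open>One transition of a state machine that keeps its position in the nested searches as
  data. States where the search is over are fixed points, so a prescribed number of transitions
  replaces loops with early exit.\<close>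

definition step :: "state \<Rightarrow> state" where
  "step s = (if small_expr s \<or> s 0 0 \<le> s 6 0 then s
     else if \<exists>z<s 0 0. sparse_expr z s then reset (amap 6 (\<lambda>k s. 0) (split s))
     else if s 7 0 < C * s 0 0 then amap 7 (\<lambda>k s. s 7 0 + 1) (amap 5 (walk_expr D) s)
     else reset (amap 6 (\<lambda>k s. s 6 0 + 1) s))"

definition start :: "state \<Rightarrow> state" where
  "start s = reset (amap 4 (\<lambda>k s. 1) s)"

text \<open>A set whose size lies between the thresholds given by \<open>pa\<close> and
  \<open>pb\<close> is trimmed by keeping the vertices of low rank. The first outcome writes no tag,
  as cell 0 of array 2 is still 0.\<close>

definition finish :: "state \<Rightarrow> state" where
  "finish s = (if small_expr s
     then amap 3 (\<lambda>u s. if \<not> s 4 u = 0 \<and>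
       qa * (\<Sum>w<s 0 0. if \<not> s 4 w = 0 \<and> w \<le> u then 1 else 0) \<le> pa * s 0 0 then 1 else 0) s
     else amap 2 (\<lambda>k s. 1) (amap 3 (\<lambda>u s. s 4 u) s))"

text \<open>Nesting multiplies the counts; the three levels in \<open>main\<close> give
  \<open>(c n)^3\<close> transitions.\<close>

definition repeat :: "nat \<Rightarrow> (state \<Rightarrow> state) \<Rightarrow> state \<Rightarrow> state" where
  "repeat c F s = (F ^^ (c * s 0 0)) s"

definition main :: "nat \<Rightarrow> state \<Rightarrow> state" where
  "main c s = finish (repeat c (repeat c (repeat c step)) (start s))"

section \<open>Polynomial running time\<close>

lemma ccom_reset: "ccom 9 reset"
  unfolding reset_def[abs_def]
  by (rule ccom_amap_comp[OF ccom_amap]; (intro cdep_intros cexp_intros)?; simp)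

lemma ccom_walk: "ccom 9 (amap 5 (walk_expr D))"
  unfolding walk_expr_def[abs_def]
  by (rule ccom_amap; (intro cdep_intros cexp_intros)?; simp)

lemma cbool_small: "cbool 9 small_expr"
  unfolding small_expr_def[abs_def] card_expr_def
  by ((intro cdep_intros cexp_intros); simp)

lemma cbool_sparse: "cbool 9 (\<lambda>s. \<exists>z<s 0 0. sparse_expr z s)"
  unfolding sparse_expr_def sweep_cut_expr_def sweep_card_expr_def sweep_cocard_expr_def
  by ((intro cdep_intros cexp_intros); simp)

lemma ccom_pick: "ccom 9 (amap 8 pick_expr)"
  unfolding pick_expr_def[abs_def] sparse_expr_def sweep_cut_expr_def sweep_card_expr_def sweep_cocard_expr_def
  by (rule ccom_amap; (intro cdep_intros cexp_intros)?; simp)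

lemma ccom_split: "ccom 9 split"
  unfolding split_def[abs_def] dense_expr_def card_expr_def pairs_expr_def
  by (rule ccom_amap_comp[OF ccom_pick]; (intro cdep_intros cexp_intros)?; simp)

lemma ccom_step: "ccom 9 step"
  unfolding step_def[abs_def]
proof (intro ccom_if cbool_disj cbool_small cbool_sparse ccom_id)
  show "ccom 9 (\<lambda>s. reset (amap 6 (\<lambda>k s. 0) (split s)))"
    by (rule ccom_comp[OF ccom_amap_comp[OF ccom_split] ccom_reset]; (intro cdep_intros cexp_intros)?; simp)
  show "ccom 9 (\<lambda>s. amap 7 (\<lambda>k s. s 7 0 + 1) (amap 5 (walk_expr D) s))"
    by (rule ccom_amap_comp[OF ccom_walk]; (intro cdep_intros cexp_intros)?; simp)
  show "ccom 9 (\<lambda>s. reset (amap 6 (\<lambda>k s. s 6 0 + 1) s))"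
    by (rule ccom_comp[OF ccom_amap ccom_reset]; (intro cdep_intros cexp_intros)?; simp)
qed ((intro cexp_intros)?; simp)+

lemma ccom_start: "ccom 9 start"
  unfolding start_def[abs_def]
  by (rule ccom_comp[OF ccom_amap ccom_reset]; (intro cdep_intros cexp_intros)?; simp)

lemma ccom_finish: "ccom 9 finish"
  unfolding finish_def[abs_def]
proof (intro ccom_if cbool_small)
  show "ccom 9 (\<lambda>s. amap 3 (\<lambda>u s. if \<not> s 4 u = 0 \<and>
       qa * (\<Sum>w<s 0 0. if \<not> s 4 w = 0 \<and> w \<le> u then 1 else 0) \<le> pa * s 0 0 then 1 else 0) s)"
    by (rule ccom_amap; (intro cdep_intros cexp_intros)?; simp)
  show "ccom 9 (\<lambda>s. amap 2 (\<lambda>k s. 1) (amap 3 (\<lambda>u s. s 4 u) s))"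
    by (rule ccom_amap_comp[OF ccom_amap]; (intro cdep_intros cexp_intros)?; simp)
qed

lemma ccom_main: "ccom 9 (main c)"
  unfolding main_def[abs_def]
proof (intro ccom_comp[OF _ ccom_finish] ccom_comp[OF ccom_start])
  have "ccom 9 (repeat c F)" if "ccom 9 F" for F
    unfolding repeat_def[abs_def] using that by (rule ccom_iterate)
  then show "ccom 9 (repeat c (repeat c (repeat c step)))" using ccom_step by blast
qed

lemma main_poly_time:
  obtains P r where "\<And>s. \<exists>t s'. exec P s t s' \<and> t \<le> poly r (s 0 0) \<and> agree 9 s' (main c s)"
  using ccomE[OF ccom_main order_refl] by blast

end

section \<open>Program values as graph quantities\<close>

lemma amap_other: "b \<noteq> a \<Longrightarrow> amap a f s b = s b"
  by (simp add: amap_def)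

lemma amap_same: "k < s 0 0 \<Longrightarrow> amap a f s a k = f k s"
  by (simp add: amap_def)

lemma sum_if_card:
  fixes n :: nat
  shows "(\<Sum>u<n. if P u then 1 else 0 :: nat) = card {u. u < n \<and> P u}"
  by (simp add: sum.If_cases Int_def)

lemma sum_if_pairs:
  fixes n :: nat
  assumes "\<And>u v. u < n \<Longrightarrow> v < n \<Longrightarrow> R u v \<longleftrightarrow> {u, v} \<in> E"
  shows "(\<Sum>u<n. \<Sum>v<n. if P u \<and> Q v \<and> R u v then 1 else 0 :: nat) =
    pairs E {u. u < n \<and> P u} {v. v < n \<and> Q v}"
proof -
  have "pairs E {u. u < n \<and> P u} {v. v < n \<and> Q v} =
      (\<Sum>u<n. if P u then (\<Sum>v | v < n \<and> Q v. of_bool ({u, v} \<in> E)) else 0)"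
    unfolding pairs_def by (rule sum.mono_neutral_cong_left) auto
  also have "\<dots> = (\<Sum>u<n. \<Sum>v<n. if P u \<and> Q v \<and> R u v then 1 else 0)"
  proof (rule sum.cong[OF refl])
    fix u assume "u \<in> {..<n}"
    then show "(if P u then (\<Sum>v | v < n \<and> Q v. of_bool ({u, v} \<in> E)) else 0) =
        (\<Sum>v<n. if P u \<and> Q v \<and> R u v then 1 else 0 :: nat)"
      by (auto intro!: sum.mono_neutral_cong_left simp: assms simp del: sum_of_bool_eq split: if_splits)
  qed
  finally show ?thesis by simp
qed

text \<open>\<open>Kq\<close> ensures that a cut of sparsity \<open>1 / K\<close> is paid for while
  the set exceeds the size threshold; \<open>C\<close> makes \<open>C * n\<close> rounds sufficient
  for the expansion criterion.\<close>

locale algorithm_run = algorithm +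
  fixes n :: nat and E :: "nat set set"
  assumes n: "0 < n" and D: "0 < D" and K: "0 < K"
    and deg: "\<And>u. u < n \<Longrightarrow> card {v\<in>{..<n}. {u, v} \<in> E} \<le> D"
    and Kq: "q * qa \<le> K * pb" and C: "32 * D\<^sup>2 * K\<^sup>2 \<le> C"
begin

definition dense :: "nat set \<Rightarrow> bool" where
  "dense U \<longleftrightarrow> 2 * p * (n * card U) + 2 * (card U * card U) \<le> q * (n * pairs E U U)"

definition small :: "nat set \<Rightarrow> bool" where
  "small U \<longleftrightarrow> qa * card U \<le> pb * n"

definition supp :: "nat \<Rightarrow> state \<Rightarrow> nat set" where
  "supp a s = {u. u < n \<and> s a u \<noteq> 0}"

definition valid :: "state \<Rightarrow> bool" where
  "valid s \<longleftrightarrow> s 0 0 = n \<and> (\<forall>u<n. \<forall>v<n. s 1 (n * u + v) \<noteq> 0 \<longleftrightarrow> {u, v} \<in> E)"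

lemma deg_subset:
  assumes "A \<subseteq> {..<n}" "u < n"
  shows "card {v\<in>A. {u, v} \<in> E} \<le> D"
proof -
  have "card {v\<in>A. {u, v} \<in> E} \<le> card {v\<in>{..<n}. {u, v} \<in> E}"
    using assms(1) by (intro card_mono) auto
  then show ?thesis using deg[OF assms(2)] by simp
qed

lemma finite_supp: "finite (supp a s)"
  by (simp add: supp_def)

lemma valid_adj: "valid s \<Longrightarrow> u < n \<Longrightarrow> v < n \<Longrightarrow> (\<not> s 1 (s 0 0 * u + v) = 0) = ({u, v} \<in> E)"
  by (simp add: valid_def)

lemma card_expr_eq: "valid s \<Longrightarrow> card_expr a s = card (supp a s)"
  unfolding card_expr_def supp_def sum_if_card by (simp add: valid_def)

lemma pairs_expr_eq: "valid s \<Longrightarrow> pairs_expr a s = pairs E (supp a s) (supp a s)"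
  unfolding pairs_expr_def supp_def
  using sum_if_pairs[of n "\<lambda>u v. \<not> s 1 (s 0 0 * u + v) = 0" E "\<lambda>u. \<not> s a u = 0" "\<lambda>u. \<not> s a u = 0"]
    valid_adj[of s] by (simp add: valid_def)

lemma dense_expr_eq:
  assumes "valid s"
  shows "dense_expr a s \<longleftrightarrow> dense (supp a s)"
proof -
  have "(\<Sum>u<n. if s a u = 0 then 0 else card_expr a s) = (\<Sum>u\<in>supp a s. card_expr a s)"
    by (rule sum.mono_neutral_cong_right) (auto simp: supp_def)
  then show ?thesis using assms
    by (simp add: dense_expr_def dense_def card_expr_eq pairs_expr_eq valid_def)
qed

lemma small_expr_eq: "valid s \<Longrightarrow> small_expr s \<longleftrightarrow> small (supp 4 s)"
  by (simp add: small_expr_def small_def card_expr_eq) (simp add: valid_def)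

lemma sweep_supp: "sweep (supp 4 s) (s 5) z = {u. u < n \<and> (\<not> s 4 u = 0 \<and> s 5 z \<le> s 5 u)}"
  by (auto simp: sweep_def supp_def)

lemma cosweep_supp: "supp 4 s - sweep (supp 4 s) (s 5) z = {u. u < n \<and> (\<not> s 4 u = 0 \<and> s 5 u < s 5 z)}"
  by (auto simp: sweep_def supp_def)

lemma sparse_expr_eq:
  assumes s: "valid s" and z: "z < n"
  shows "sparse_expr z s \<longleftrightarrow> sparse_sweep K E (supp 4 s) (s 5) z"
proof -
  have n: "s 0 0 = n" using s by (simp add: valid_def)
  have 1: "sweep_card_expr z s = card (sweep (supp 4 s) (s 5) z)"
    unfolding sweep_card_expr_def n sum_if_card sweep_supp ..
  have 2: "sweep_cocard_expr z s = card (supp 4 s - sweep (supp 4 s) (s 5) z)"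
    unfolding sweep_cocard_expr_def n sum_if_card cosweep_supp ..
  have 3: "sweep_cut_expr z s = pairs E (sweep (supp 4 s) (s 5) z) (supp 4 s - sweep (supp 4 s) (s 5) z)"
    unfolding sweep_cut_expr_def cosweep_supp unfolding sweep_supp n
    by (rule sum_if_pairs) (use valid_adj[OF s] n in simp)
  have "z \<in> supp 4 s \<longleftrightarrow> \<not> s 4 z = 0" using z by (simp add: supp_def)
  then show ?thesis unfolding sparse_expr_def sparse_sweep_def Let_def 1 2 3 by blast
qed

lemma sparse_sweep_less: "sparse_sweep K E (supp 4 s) x z \<Longrightarrow> z < n"
  by (simp add: sparse_sweep_def Let_def supp_def)

lemma ex_sparse_expr:
  assumes "valid s"
  shows "(\<exists>z<s 0 0. sparse_expr z s) \<longleftrightarrow> (\<exists>z. sparse_sweep K E (supp 4 s) (s 5) z)"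
proof -
  have "s 0 0 = n" using assms by (simp add: valid_def)
  then show ?thesis using sparse_expr_eq[OF assms] sparse_sweep_less by metis
qed

lemma supp_pick:
  assumes s: "valid s" and ex: "\<exists>z. sparse_sweep K E (supp 4 s) (s 5) z"
  shows "\<exists>z. sparse_sweep K E (supp 4 s) (s 5) z \<and>
    supp 8 (amap 8 pick_expr s) = sweep (supp 4 s) (s 5) z"
proof -
  define G where "G z \<longleftrightarrow> sparse_sweep K E (supp 4 s) (s 5) z" for z
  define z where "z = (LEAST z. G z)"
  have z: "G z" using ex unfolding z_def G_def by (rule LeastI_ex)
  have zn: "z < n" using z unfolding G_def by (rule sparse_sweep_less)
  have least: "\<not> G y" if "y < z" for y using that unfolding z_def by (rule not_less_Least)
  have n: "s 0 0 = n" using s by (simp add: valid_def)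
  have G: "sparse_expr y s = G y" if "y < n" for y using sparse_expr_eq[OF s that] by (simp add: G_def)
  have uniq: "(G y \<and> \<not> (\<exists>y'<n. y' < y \<and> G y')) = (y = z)" if "y < n" for y
    using z zn least by (metis linorder_neqE_nat)
  have "pick_expr u s = (if u \<in> sweep (supp 4 s) (s 5) z then 1 else 0)" if "u < n" for u
  proof -
    have "(\<exists>z<n. sparse_expr z s \<and> \<not> (\<exists>y<n. y < z \<and> sparse_expr y s) \<and> P z) = P z" for P
      using uniq G zn by metis
    then show ?thesis unfolding pick_expr_def n sweep_supp using that by simp
  qed
  then have "supp 8 (amap 8 pick_expr s) = sweep (supp 4 s) (s 5) z"
    using n by (auto simp: supp_def amap_same sweep_def split: if_splits)
  then show ?thesis using z G_def by blast
qed

text \<open>Up to scaling, splitting releases \<open>2 * (a * b)\<close> from the quadratic term.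
  \<open>Kq\<close> and largeness of \<open>U\<close> give \<open>q * n \<le> K * (a + b)\<close>,
  so the lost edges cost \<open>q * n * e \<le> K * e * (a + b) \<le> 2 * (a * b)\<close>. If both
  parts failed, the cost would have to be strictly larger.\<close>

lemma dense_split:
  assumes U: "finite U" "dense U" "\<not> small U" and z: "sparse_sweep K E U x z"
  shows "dense (sweep U x z) \<or> dense (U - sweep U x z)"
proof (rule ccontr)
  define S where "S = sweep U x z"
  define e where "e = pairs E S (U - S)"
  define a where "a = card S"
  define b where "b = card (U - S)"
  assume "\<not> ?thesis"
  then have nd: "\<not> dense S" "\<not> dense (U - S)" by (auto simp: S_def)
  have SU: "S \<subseteq> U" by (auto simp: S_def sweep_def)
  have ab: "card U = a + b"
    using SU U(1) by (simp add: a_def b_def card_Diff_subset finite_subset card_mono)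
  have e: "K * e \<le> a" "K * e \<le> b" "1 \<le> b"
    using z by (auto simp: sparse_sweep_def Let_def S_def[symmetric] e_def a_def b_def)
  have 1: "q * (n * pairs E S S) + q * (n * pairs E (U - S) (U - S)) <
      2 * p * (n * card U) + 2 * (a * a) + 2 * (b * b)"
    using nd unfolding dense_def ab a_def[symmetric] b_def[symmetric]
    by (simp add: algebra_simps)
  have "2 * p * (n * card U) + 2 * ((a + b) * (a + b)) \<le> q * (n * pairs E U U)"
    using U(2) by (simp add: dense_def ab)
  also have "\<dots> = q * (n * pairs E S S) + q * (n * pairs E (U - S) (U - S)) + 2 * (q * (n * e))"
    unfolding pairs_split[OF U(1) SU] e_def by (simp add: algebra_simps)
  finally have 2: "2 * (a * b) < q * (n * e)"
    using 1 by (simp add: algebra_simps)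
  have "0 < qa"
    using U(3) unfolding small_def by (metis bot_nat_0.not_eq_extremum le0 mult_0)
  have "q * n * qa \<le> K * (pb * n)" using Kq mult_le_mono1[OF Kq, of n] by (simp add: mult_ac)
  also have "\<dots> \<le> K * (qa * card U)" using U(3) by (intro mult_le_mono2) (simp add: small_def)
  finally have "qa * (q * n) \<le> qa * (K * card U)" by (simp add: mult_ac)
  then have "q * n \<le> K * card U" using \<open>0 < qa\<close> by simp
  then have "q * n * e \<le> K * card U * e" by (rule mult_le_mono1)
  also have "\<dots> = (K * e) * a + (K * e) * b" by (simp add: ab algebra_simps)
  also have "\<dots> \<le> b * a + a * b" using e by (intro add_mono mult_le_mono1) simp_all
  finally show False using 2 by (simp add: algebra_simps)
qed

text \<open>The certificates cover all earlier start vertices in full and the current one up to time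
  \<open>s 7 0\<close>; once \<open>s 6 0 = n\<close>, they are the premise of the expansion
  criterion.\<close>

definition inv :: "state \<Rightarrow> bool" where
  "inv s \<longleftrightarrow> valid s \<and> s 2 0 = 0 \<and> supp 4 s \<noteq> {} \<and> dense (supp 4 s) \<and> s 6 0 \<le> n \<and> s 7 0 \<le> C * n \<and>
     (\<forall>u\<in>supp 4 s. real (s 5 u) = (edge_walk D E (supp 4 s) ^^ s 7 0) (\<lambda>u. of_bool (u = s 6 0)) u) \<and>
     (\<forall>v<s 6 0. \<forall>t<C * n. no_sparse_sweep D K E (supp 4 s) v t) \<and>
     (\<forall>t<s 7 0. no_sparse_sweep D K E (supp 4 s) (s 6 0) t)"

lemma invD:
  assumes "inv s"
  shows "valid s" "s 2 0 = 0" "supp 4 s \<noteq> {}" "dense (supp 4 s)" "s 6 0 \<le> n" "s 7 0 \<le> C * n"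
    "\<forall>u\<in>supp 4 s. real (s 5 u) = (edge_walk D E (supp 4 s) ^^ s 7 0) (\<lambda>u. of_bool (u = s 6 0)) u"
    "\<forall>v<s 6 0. \<forall>t<C * n. no_sparse_sweep D K E (supp 4 s) v t"
    "\<forall>t<s 7 0. no_sparse_sweep D K E (supp 4 s) (s 6 0) t"
  using assms unfolding inv_def by blast+

definition halted :: "state \<Rightarrow> bool" where
  "halted s \<longleftrightarrow> small (supp 4 s) \<or> n \<le> s 6 0"

text \<open>Lexicographic order on set size, remaining start vertices and remaining rounds, packed
  into one number: each weight exceeds whatever the lower components can regain on a reset.\<close>

definition potential :: "state \<Rightarrow> nat" where
  "potential s = card (supp 4 s) * ((n + 1) * (C * n + 1)) + (n - s 6 0) * (C * n + 1) + (C * n - s 7 0)"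

section \<open>Progress of a transition and termination\<close>

lemma reset_simps:
  "a \<noteq> 5 \<Longrightarrow> a \<noteq> 7 \<Longrightarrow> reset s a = s a"
  "s 0 0 = n \<Longrightarrow> reset s 7 0 = 0"
  "s 0 0 = n \<Longrightarrow> k < n \<Longrightarrow> reset s 5 k = of_bool (k = s 6 0)"
  using n by (simp_all add: reset_def amap_def)

lemma inv_reset:
  assumes "valid s" "s 2 0 = 0" "supp 4 s \<noteq> {}" "dense (supp 4 s)" "s 6 0 \<le> n"
    and "\<forall>v<s 6 0. \<forall>t<C * n. no_sparse_sweep D K E (supp 4 s) v t"
  shows "inv (reset s)"
proof -
  have n: "s 0 0 = n" using assms(1) by (simp add: valid_def)
  have U: "supp 4 (reset s) = supp 4 s" and v: "valid (reset s) = valid s"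
    by (simp_all add: supp_def reset_simps valid_def)
  have "\<forall>u\<in>supp 4 s. real (reset s 5 u) = of_bool (u = s 6 0)"
    using n by (simp add: supp_def reset_simps)
  then show ?thesis using assms n unfolding inv_def U v by (simp add: reset_simps)
qed

lemma walk_expr_eq:
  assumes s: "valid s" and u: "u \<in> supp 4 s"
  shows "real (walk_expr D u s) = edge_walk D E (supp 4 s) (\<lambda>u. real (s 5 u)) u"
proof -
  define U where "U = supp 4 s"
  have n: "s 0 0 = n" using s by (simp add: valid_def)
  have un: "u < n" using u by (simp add: supp_def)
  have deg': "card {v\<in>U. {w, v} \<in> E} \<le> D" if "w \<in> U" for w
    using that by (intro deg_subset) (auto simp: U_def supp_def)
  interpret G: weighted_graph U "\<lambda>u v. of_bool ({u, v} \<in> E)" "real D"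
    using finite_supp D deg' unfolding U_def by (rule weighted_graph_edges)
  have sum: "(\<Sum>v<s 0 0. if \<not> s 4 v = 0 \<and> \<not> s 1 (s 0 0 * u + v) = 0 then f v else 0) =
      (\<Sum>v\<in>U. of_bool ({u, v} \<in> E) * f v)" for f :: "nat \<Rightarrow> nat"
    unfolding n using valid_adj[OF s un] n
    by (intro sum.mono_neutral_cong_right) (auto simp: U_def supp_def)
  define A where "A = (\<Sum>v\<in>U. of_bool ({u, v} \<in> E) * s 5 v)"
  define B where "B = (\<Sum>v\<in>U. of_bool ({u, v} \<in> E) * s 5 u)"
  have "B = card {v\<in>U. {u, v} \<in> E} * s 5 u"
    unfolding B_def sum_distrib_right[symmetric] using finite_supp
    by (simp add: of_bool_def sum.If_cases Int_def U_def)
  also have "\<dots> \<le> (2 * D) * s 5 u" using deg'[of u] u by (intro mult_le_mono1) (simp add: U_def)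
  finally have "real (walk_expr D u s) = real ((2 * D) * s 5 u) + real A - real B"
    unfolding walk_expr_def sum A_def[symmetric] B_def[symmetric] by simp
  also have "\<dots> = G.walk (\<lambda>u. real (s 5 u)) u"
    by (simp add: G.walk_def G.lap_def A_def B_def right_diff_distrib sum_subtractf)
  finally show ?thesis by (simp add: U_def)
qed

lemma edge_walk_cong:
  assumes "\<And>u. u \<in> U \<Longrightarrow> x u = y u" "u \<in> U" "U \<subseteq> {..<n}"
  shows "edge_walk D E U x u = edge_walk D E U y u"
proof -
  have deg': "card {v\<in>U. {w, v} \<in> E} \<le> D" if "w \<in> U" for w
    using that assms(3) by (intro deg_subset) auto
  have fin: "finite U" using assms(3) finite_subset by blast
  interpret G: weighted_graph U "\<lambda>u v. of_bool ({u, v} \<in> E)" "real D"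
    using fin D deg' by (rule weighted_graph_edges)
  show ?thesis using assms by (intro G.walk_cong) auto
qed

lemma step_split:
  assumes inv: "inv s" and h: "\<not> halted s" and ex: "\<exists>z. sparse_sweep K E (supp 4 s) (s 5) z"
  shows "inv (step s) \<and> potential (step s) < potential s"
proof -
  have s: "valid s" and n0: "s 0 0 = n" using invD(1)[OF inv] by (simp_all add: valid_def)
  have ns: "\<not> small (supp 4 s)" using h by (simp add: halted_def)
  obtain z where z: "sparse_sweep K E (supp 4 s) (s 5) z"
    and pick: "supp 8 (amap 8 pick_expr s) = sweep (supp 4 s) (s 5) z"
    using supp_pick[OF s ex] by blast
  define S where "S = sweep (supp 4 s) (s 5) z"
  define s1 where "s1 = amap 8 pick_expr s"
  define s2 where "s2 = split s"
  define s3 where "s3 = amap 6 (\<lambda>k s. 0) s2"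
  have st: "step s = reset s3"
    using h ex n0 ex_sparse_expr[OF s] small_expr_eq[OF s]
    by (auto simp: step_def halted_def s3_def s2_def)
  have v1: "valid s1" using s by (simp add: s1_def valid_def amap_other)
  have s2: "s2 a = s a" if "a \<noteq> 4" "a \<noteq> 8" for a
    using that by (simp add: s2_def split_def amap_other)
  have S8: "supp 8 s1 = S" "supp 4 s1 = supp 4 s"
    using pick by (simp_all add: s1_def S_def supp_def amap_other)
  have SU: "S \<subseteq> supp 4 s" by (auto simp: S_def sweep_def)
  have "s2 4 u = (if dense S then s1 8 u else if \<not> s1 4 u = 0 \<and> s1 8 u = 0 then 1 else 0)"
    if "u < n" for u
  proof -
    have "u < s1 0 0" using that n0 by (simp add: s1_def amap_other)
    then show ?thesis unfolding s2_def split_def s1_def[symmetric]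
      by (simp add: amap_same dense_expr_eq[OF v1] S8)
  qed
  then have U2: "supp 4 s2 = (if dense S then S else supp 4 s - S)"
    unfolding S8(1)[symmetric] S8(2)[symmetric] using SU unfolding S8(1)[symmetric] S8(2)[symmetric]
    by (auto simp: supp_def)
  have zS: "z \<in> S" "1 \<le> card (supp 4 s - S)"
    using z by (auto simp: S_def sparse_sweep_def Let_def sweep_def)
  have finS: "finite S" using SU finite_supp finite_subset by blast
  have "supp 4 s - S \<noteq> {}" using zS(2) by (metis card.empty not_one_le_zero)
  then have ne: "supp 4 s2 \<noteq> {}" using zS(1) U2 by auto
  have dn: "dense (supp 4 s2)"
    using dense_split[OF finite_supp invD(4)[OF inv] ns z] unfolding U2 S_def by auto
  have "0 < card S" using zS finS by (auto simp: card_gt_0_iff)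
  then have less: "card (supp 4 s2) < card (supp 4 s)"
    using zS(2) SU card_mono[OF finite_supp SU] unfolding U2
    by (auto simp: card_Diff_subset finS)
  have U3: "supp 4 s3 = supp 4 s2" by (simp add: s3_def supp_def amap_other)
  have s36: "s3 6 0 = 0" using n0 n by (simp add: s3_def amap_same s2)
  have v3: "valid s3" using s by (simp add: valid_def s3_def amap_other s2)
  have "inv (reset s3)"
  proof (rule inv_reset)
    show "s3 2 0 = 0" using invD(2)[OF inv] by (simp add: s3_def amap_other s2)
  qed (use v3 ne dn s36 in \<open>simp_all add: U3\<close>)
  moreover have "potential (reset s3) < potential s"
  proof -
    define M where "M = (n + 1) * (C * n + 1)"
    have U: "supp 4 (reset s3) = supp 4 s2" using U3 by (simp add: supp_def reset_simps)
    have "potential (reset s3) \<le> card (supp 4 s2) * M + n * (C * n + 1) + C * n"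
      unfolding potential_def U M_def by (intro add_mono mult_le_mono) auto
    also have "\<dots> < (card (supp 4 s2) + 1) * M" by (simp add: M_def)
    also have "\<dots> \<le> card (supp 4 s) * M" using less by (intro mult_le_mono1) simp
    also have "\<dots> \<le> potential s" by (simp add: potential_def M_def)
    finally show ?thesis .
  qed
  ultimately show ?thesis by (simp add: st)
qed

lemma step_walk:
  assumes inv: "inv s" and h: "\<not> halted s" and ex: "\<not> (\<exists>z. sparse_sweep K E (supp 4 s) (s 5) z)"
    and t: "s 7 0 < C * n"
  shows "inv (step s) \<and> potential (step s) < potential s"
proof -
  have s: "valid s" and n0: "s 0 0 = n" using invD(1)[OF inv] by (simp_all add: valid_def)
  define U where "U = supp 4 s"
  define s' where "s' = amap 7 (\<lambda>k s. s 7 0 + 1) (amap 5 (walk_expr D) s)"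
  have st: "step s = s'"
    using h ex n0 t ex_sparse_expr[OF s] small_expr_eq[OF s]
    by (auto simp: step_def halted_def s'_def)
  have s': "s' a = s a" if "a \<noteq> 5" "a \<noteq> 7" for a
    using that by (simp add: s'_def amap_other)
  have s7: "s' 7 0 = Suc (s 7 0)" using n0 n by (simp add: s'_def amap_same amap_other)
  have s5: "s' 5 u = walk_expr D u s" if "u < n" for u
    using n0 that by (simp add: s'_def amap_other amap_same)
  have U': "supp 4 s' = U" by (simp add: U_def supp_def s')
  have Un: "U \<subseteq> {..<n}" by (auto simp: U_def supp_def)
  have rep: "\<forall>u\<in>U. real (s 5 u) = (edge_walk D E U ^^ s 7 0) (\<lambda>u. of_bool (u = s 6 0)) u"
    using invD(7)[OF inv] by (simp add: U_def)
  have "real (s' 5 u) = (edge_walk D E U ^^ s' 7 0) (\<lambda>u. of_bool (u = s' 6 0)) u" if "u \<in> U" for u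
  proof -
    have "real (s' 5 u) = edge_walk D E U (\<lambda>u. real (s 5 u)) u"
      using s5[of u] walk_expr_eq[OF s, of u] that Un by (auto simp: U_def)
    also have "\<dots> = edge_walk D E U ((edge_walk D E U ^^ s 7 0) (\<lambda>u. of_bool (u = s 6 0))) u"
      using rep that Un by (intro edge_walk_cong) auto
    finally show ?thesis by (simp add: s7 s')
  qed
  \<comment> \<open>Array 5 still holds the iterate for time \<open>s 7 0\<close>, so the failed
    search on it becomes the certificate for that time.\<close>
  moreover have "no_sparse_sweep D K E U (s 6 0) (s 7 0)"
    using rep ex unfolding no_sparse_sweep_def U_def by blast
  then have "\<forall>t<s' 7 0. no_sparse_sweep D K E U (s' 6 0) t"
    using invD(9)[OF inv] by (simp add: s7 s' less_Suc_eq U_def)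
  moreover have "valid s'" using s by (simp add: valid_def s')
  moreover have "s' 2 0 = 0" "U \<noteq> {}" "dense U" "s' 6 0 \<le> n" "s' 7 0 \<le> C * n"
      "\<forall>v<s' 6 0. \<forall>t<C * n. no_sparse_sweep D K E U v t"
    using invD(2-5,8)[OF inv] t by (simp_all add: s' s7 U_def)
  ultimately have "inv s'" unfolding inv_def U' by blast
  moreover have "potential s' < potential s"
    unfolding potential_def U' using t by (simp add: s' s7 U_def)
  ultimately show ?thesis by (simp add: st)
qed

lemma step_next:
  assumes inv: "inv s" and h: "\<not> halted s" and ex: "\<not> (\<exists>z. sparse_sweep K E (supp 4 s) (s 5) z)"
    and t: "\<not> s 7 0 < C * n"
  shows "inv (step s) \<and> potential (step s) < potential s"
proof -
  have s: "valid s" and n0: "s 0 0 = n" using invD(1)[OF inv] by (simp_all add: valid_def)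
  define s1 where "s1 = amap 6 (\<lambda>k s. s 6 0 + 1) s"
  have st: "step s = reset s1"
    using h ex n0 t ex_sparse_expr[OF s] small_expr_eq[OF s]
    by (auto simp: step_def halted_def s1_def)
  have s1: "s1 a = s a" if "a \<noteq> 6" for a
    using that by (simp add: s1_def amap_other)
  have s6: "s1 6 0 = Suc (s 6 0)" using n0 n by (simp add: s1_def amap_same)
  have U: "supp 4 s1 = supp 4 s" "supp 4 (reset s1) = supp 4 s"
    by (simp_all add: supp_def s1 reset_simps)
  have t7: "s 7 0 = C * n" using t invD(6)[OF inv] by simp
  have v: "s 6 0 < n" using h by (simp add: halted_def)
  have "valid s1" using s by (simp add: valid_def s1)
  then have "inv (reset s1)"
  proof (rule inv_reset)
    show "s1 2 0 = 0" "supp 4 s1 \<noteq> {}" "dense (supp 4 s1)" "s1 6 0 \<le> n"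
      using invD(2-5)[OF inv] v by (simp_all add: U s1 s6)
    show "\<forall>v<s1 6 0. \<forall>t<C * n. no_sparse_sweep D K E (supp 4 s1) v t"
      using invD(8,9)[OF inv] unfolding U s6 t7 less_Suc_eq by blast
  qed
  moreover have "potential (reset s1) < potential s"
  proof -
    have "n - s 6 0 = Suc (n - Suc (s 6 0))" using v by simp
    moreover have "reset s1 6 0 = Suc (s 6 0)" "reset s1 7 0 = 0"
      using n0 by (simp_all add: reset_simps s6 s1)
    ultimately show ?thesis unfolding potential_def U using t7 by simp
  qed
  ultimately show ?thesis by (simp add: st)
qed

lemma step_progress: "inv s \<Longrightarrow> \<not> halted s \<Longrightarrow> inv (step s) \<and> potential (step s) < potential s"
  using step_split step_walk step_next by blast

lemma step_halted: "inv s \<Longrightarrow> halted s \<Longrightarrow> step s = s"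
  using invD(1)[of s] small_expr_eq[of s] by (auto simp: halted_def step_def valid_def)

lemma steps_halt:
  assumes "inv s" "potential s \<le> k"
  shows "inv ((step ^^ k) s) \<and> halted ((step ^^ k) s)"
  using assms
proof (induction k arbitrary: s)
  case 0
  show ?case
  proof (cases "halted s")
    case False
    then show ?thesis using step_progress[OF 0(1)] 0(2) by simp
  qed (use 0 in simp)
next
  case (Suc k)
  show ?case
  proof (cases "halted s")
    case True
    have "(step ^^ j) s = s" for j
      using step_halted[OF Suc.prems(1) True] by (induction j) simp_all
    then show ?thesis using True Suc.prems by metis
  next
    case False
    then have "inv (step s)" "potential (step s) \<le> k"
      using step_progress[OF Suc.prems(1)] Suc.prems(2) by auto
    then show ?thesis using Suc.IH[of "step s"] by (simp add: funpow_Suc_right del: funpow.simps)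
  qed
qed

text \<open>Array 0 never changes, so the counts on all levels are fixed by the initial
  \<open>n\<close> and multiply.\<close>

lemma repeat_funpow:
  assumes F: "\<And>s. F s 0 = s 0" and G: "\<And>s. G s = (F ^^ g (s 0 0)) s"
  shows "repeat c G s = (F ^^ (c * s 0 0 * g (s 0 0))) s"
proof -
  have F0: "(F ^^ j) s 0 = s 0" for j s by (induction j) (simp_all add: F)
  have "(G ^^ j) s = (F ^^ (j * g (s 0 0))) s" for j
    by (induction j) (simp_all add: G F0 funpow_add add.commute)
  then show ?thesis by (simp add: repeat_def)
qed

lemma repeat_step:
  "repeat c (repeat c (repeat c step)) s = (step ^^ ((c * s 0 0) ^ 3)) s"
proof -
  have F: "step s 0 = s 0" for s using ccom_fix[OF ccom_step] by simp
  have 1: "repeat c step s = (step ^^ (c * s 0 0)) s" for s by (simp add: repeat_def)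
  have 2: "repeat c (repeat c step) s = (step ^^ (c * s 0 0 * (c * s 0 0))) s" for s
    by (rule repeat_funpow[OF F 1])
  show ?thesis
    using repeat_funpow[where g = "\<lambda>m. c * m * (c * m)", OF F 2]
    by (simp add: power3_eq_cube mult.assoc)
qed

lemma valid_input: "valid (graph_input n E)"
proof -
  have "n * u + v < n * n" "(n * u + v) div n = u" "(n * u + v) mod n = v" if "u < n" "v < n" for u v
  proof -
    have "n * u + v < n * Suc u" using that by simp
    also have "\<dots> \<le> n * n" using that by (intro mult_le_mono2) simp
    finally show "n * u + v < n * n" .
  qed (use that in simp_all)
  then show ?thesis by (simp add: valid_def graph_input_def)
qed

lemma inv_start:
  assumes "dense {..<n}"
  shows "inv (start (graph_input n E))" "supp 4 (start (graph_input n E)) = {..<n}"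
proof -
  define s0 where "s0 = graph_input n E"
  have s0: "valid s0" "s0 0 0 = n" "s0 2 0 = 0" "s0 6 0 = 0"
    using valid_input by (auto simp: s0_def graph_input_def)
  have U: "supp 4 (amap 4 (\<lambda>k s. 1) s0) = {..<n}"
    using s0 by (auto simp: supp_def amap_same)
  then show "supp 4 (start (graph_input n E)) = {..<n}"
    by (simp add: start_def s0_def[symmetric] supp_def reset_simps)
  have "valid (amap 4 (\<lambda>k s. 1) s0)" using s0 by (simp add: valid_def amap_other)
  then show "inv (start (graph_input n E))"
    unfolding start_def s0_def[symmetric]
    using assms U s0 n by (intro inv_reset) (auto simp: amap_other)
qed

lemma main_correct:
  assumes dn: "dense {..<n}" and c: "c = 4 * C + 4"
  defines "s' \<equiv> main c (graph_input n E)"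
  obtains U where "U \<subseteq> {..<n}" "U \<noteq> {}" "dense U"
    "out_tag s' = 0 \<and> qa * card U \<le> pb * n \<and>
       out_set n s' = {u\<in>U. qa * card {w\<in>U. w \<le> u} \<le> pa * n} \<or>
     out_tag s' = 1 \<and> pb * n < qa * card U \<and> out_set n s' = U \<and>
       expander (1 / (64 * (real D)\<^sup>2 * (real K)\<^sup>2)) U (induced_edges E U)"
proof -
  define s1 where "s1 = start (graph_input n E)"
  define s where "s = (step ^^ ((c * n) ^ 3)) s1"
  have i1: "inv s1" "supp 4 s1 = {..<n}" using inv_start[OF dn] by (simp_all add: s1_def)
  have n1: "s1 0 0 = n" using invD(1)[OF i1(1)] by (simp add: valid_def)
  have "potential s1 \<le> n * ((n + 1) * (C * n + 1)) + n * (C * n + 1) + C * n"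
    unfolding potential_def i1(2) by (intro add_mono mult_le_mono) auto
  also have "\<dots> \<le> (c * n) ^ 3"
  proof -
    have "C * n + 1 \<le> (C + 1) * n" "n + 1 \<le> 2 * n" "n \<le> n * n" "n \<le> n * (n * n)" using n by simp_all
    then have "n * ((n + 1) * (C * n + 1)) + n * (C * n + 1) + C * n
        \<le> n * ((2 * n) * ((C + 1) * n)) + (n * n) * ((C + 1) * n) + C * (n * (n * n))"
      by (intro add_mono mult_le_mono) simp_all
    \<comment> \<open>The coefficients add up to \<open>2 (C + 1) + (C + 1) + C = 4 C + 3\<close>,
      whence the choice of \<open>c\<close>.\<close>
    also have "\<dots> \<le> c * (n * (n * n))" by (simp add: c algebra_simps)
    also have "\<dots> \<le> c ^ 3 * (n * (n * n))"
      by (intro mult_le_mono1 self_le_power) (simp_all add: c)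
    also have "\<dots> = (c * n) ^ 3" by (simp add: power_mult_distrib power3_eq_cube)
    finally show ?thesis .
  qed
  finally have inv: "inv s" and h: "halted s"
    using steps_halt[OF i1(1), of "(c * n) ^ 3"] by (simp_all add: s_def)
  have s': "s' = finish s"
    unfolding s'_def main_def repeat_step s1_def[symmetric] s_def n1 ..
  have v: "valid s" and n0: "s 0 0 = n" using invD(1)[OF inv] by (simp_all add: valid_def)
  define U where "U = supp 4 s"
  have Un: "U \<subseteq> {..<n}" by (auto simp: U_def supp_def)
  have "out_tag s' = 0 \<and> qa * card U \<le> pb * n \<and>
       out_set n s' = {u\<in>U. qa * card {w\<in>U. w \<le> u} \<le> pa * n} \<or>
     out_tag s' = 1 \<and> pb * n < qa * card U \<and> out_set n s' = U \<and>
       expander (1 / (64 * (real D)\<^sup>2 * (real K)\<^sup>2)) U (induced_edges E U)"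
  proof (cases "small U")
    case True
    have rank: "(\<Sum>w<n. if \<not> s 4 w = 0 \<and> w \<le> u then 1 else 0 :: nat) = card {w\<in>U. w \<le> u}" for u
      unfolding sum_if_card by (rule arg_cong[where f = card]) (auto simp: U_def supp_def)
    have sm: "small_expr s" using True small_expr_eq[OF v] by (simp add: U_def)
    have "out_tag s' = 0" using invD(2)[OF inv] sm by (simp add: s' finish_def out_tag_def amap_other)
    moreover have "s' 3 u = (if \<not> s 4 u = 0 \<and>
        qa * (\<Sum>w<n. if \<not> s 4 w = 0 \<and> w \<le> u then 1 else 0) \<le> pa * n then 1 else 0)" if "u < n" for u
      unfolding s' finish_def using sm that by (simp add: amap_same n0)
    then have "out_set n s' = {u\<in>U. qa * card {w\<in>U. w \<le> u} \<le> pa * n}"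
      unfolding rank out_set_def by (auto simp: U_def supp_def split: if_splits)
    ultimately show ?thesis using True by (simp add: small_def)
  next
    case False
    have sm: "\<not> small_expr s" using False small_expr_eq[OF v] by (simp add: U_def)
    have "out_tag s' = 1" using sm n0 n by (simp add: s' finish_def out_tag_def amap_same amap_other)
    moreover have "out_set n s' = U"
      unfolding out_set_def s' finish_def using sm
      by (auto simp: amap_same amap_other n0 U_def supp_def)
    moreover have "expander (1 / (64 * (real D)\<^sup>2 * (real K)\<^sup>2)) U (induced_edges E U)"
    proof (rule expander_if_no_sparse_sweep)
      show "finite U" by (simp add: U_def finite_supp)
      show "card {v\<in>U. {u, v} \<in> E} \<le> D" if "u \<in> U" for u
        using that Un by (intro deg_subset) auto
      have "card U \<le> n" using Un card_mono[of "{..<n}" U] by simp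
      then show "32 * D\<^sup>2 * K\<^sup>2 * card U \<le> C * n" using C by (intro mult_le_mono)
      have "s 6 0 = n" using h False invD(5)[OF inv] by (simp add: halted_def U_def)
      then show "no_sparse_sweep D K E U v t" if "v \<in> U" "t < C * n" for v t
        using invD(8)[OF inv] that Un by (auto simp: U_def)
    qed (rule D K)+
    ultimately show ?thesis using False by (simp add: small_def)
  qed
  then show ?thesis using that[OF Un] invD(3,4)[OF inv] by (simp add: U_def)
qed

end

section \<open>Trimming a small set\<close>

context algorithm_run
begin

text \<open>Removing \<open>m - k\<close> vertices destroys at most \<open>(m - k) * D\<close>
  edges, which by \<open>gap\<close> the quadratic term can pay, and the linear term keeps the
  density at \<open>p / q\<close>. In this case \<open>gap\<close> also makes \<open>k\<close>
  positive, so a vertex is left.\<close>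

lemma trim:
  assumes U: "U \<subseteq> {..<n}" "U \<noteq> {}" "dense U" "qa * card U \<le> pb * n" and qa: "0 < qa"
    and gap: "\<And>m. pa * n < m * qa \<Longrightarrow> m * qa \<le> pb * n \<Longrightarrow>
      qa \<le> pa * n \<and> q * D * n * (m - pa * n div qa) \<le> m * m"
    and W: "W = {u\<in>U. qa * card {w\<in>U. w \<le> u} \<le> pa * n}"
  shows "W \<noteq> {}" "qa * card W \<le> pa * n" "2 * p * card W \<le> q * pairs E W W"
proof -
  define k where "k = pa * n div qa"
  have fin: "finite U" using U(1) finite_subset by blast
  have le_k: "qa * m \<le> pa * n \<longleftrightarrow> m \<le> k" for m
    using qa by (simp add: k_def less_eq_div_iff_mult_less_eq mult.commute)
  have WU: "W \<subseteq> U" by (auto simp: W)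
  have cW: "card W = min k (card U)" using card_rank_le[OF fin] by (simp add: W le_k)
  then show "qa * card W \<le> pa * n" by (simp add: le_k)
  have "W \<noteq> {} \<and> 2 * p * card W \<le> q * pairs E W W"
  proof (cases "card U \<le> k")
    case True
    then have "W = U" using cW WU fin by (intro card_subset_eq) simp_all
    moreover have "2 * p * (n * card U) \<le> q * (n * pairs E U U)"
      using U(3) unfolding dense_def by linarith
    then have "n * (2 * p * card U) \<le> n * (q * pairs E U U)" by (simp only: mult_ac)
    ultimately show ?thesis using U(2) n by simp
  next
    case False
    define m where "m = card U"
    have km: "k < m" using False by (simp add: m_def)
    have "\<not> qa * m \<le> pa * n" using km le_k by simp
    then have g: "qa \<le> pa * n" "q * D * n * (m - k) \<le> m * m"
      using gap[of m] U(4) unfolding k_def m_def by (simp_all add: mult.commute)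
    have "1 \<le> k" using g(1) le_k[of 1] by simp
    moreover have ck: "card W = k" using cW km by (simp add: m_def)
    ultimately have "W \<noteq> {}" by auto
    moreover have "2 * p * k \<le> q * pairs E W W"
    proof -
      have r: "card (U - W) = m - k" using WU fin ck by (simp add: m_def card_Diff_subset finite_subset)
      have deg': "card {v\<in>A. {u, v} \<in> E} \<le> D" if "u \<in> U" "A \<subseteq> U" for u A
        using that U(1) by (intro deg_subset) auto
      have finW: "finite W" "W \<inter> (U - W) = {}" using WU fin finite_subset by auto
      have "pairs E (U - W) U = pairs E (U - W) (W \<union> (U - W))"
        using WU by (simp add: Un_absorb1)
      also have "\<dots> = pairs E (U - W) W + pairs E (U - W) (U - W)"
        using finW fin by (intro pairs_Un_right) auto
      finally have "pairs E (U - W) W + pairs E (U - W) (U - W) \<le> (m - k) * D"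
        using pairs_le_degree[of U "U - W" E D] fin deg' r by simp
      moreover have "pairs E (U - W) W \<le> (m - k) * D"
        using pairs_le_degree[of W "U - W" E D] finW(1) deg' r WU by simp
      ultimately have "pairs E U U \<le> pairs E W W + 2 * ((m - k) * D)"
        unfolding pairs_split[OF fin WU] pairs_commute[of E W "U - W"] by simp
      then have "q * (n * pairs E U U) \<le> q * (n * (pairs E W W + 2 * ((m - k) * D)))"
        by (intro mult_le_mono2)
      also have "\<dots> = n * (q * pairs E W W) + 2 * (q * D * n * (m - k))"
        by (simp add: algebra_simps)
      also have "\<dots> \<le> n * (q * pairs E W W) + 2 * (m * m)" using g(2) by simp
      finally have "2 * p * (n * m) \<le> n * (q * pairs E W W)"
        using U(3) unfolding dense_def m_def by linarith
      then have "n * (2 * p * m) \<le> n * (q * pairs E W W)" by (simp only: mult_ac)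
      then have "2 * p * m \<le> q * pairs E W W" using n by simp
      moreover have "2 * p * k \<le> 2 * p * m" using km by simp
      ultimately show ?thesis by linarith
    qed
    ultimately show ?thesis by (simp add: ck)
  qed
  then show "W \<noteq> {}" "2 * p * card W \<le> q * pairs E W W" by simp_all
qed

end

text \<open>
  An irrational bound \<open>\<alpha> n\<close> on a cardinality cannot in general be tested by a program, so \<open>\<alpha>\<close> is
  enclosed between two rationals. They are so close that, for small \<open>n\<close>, no integer lies between
  the two bounds; for large \<open>n\<close>, trimming a set down to the lower bound costs few edges.
\<close>

lemma rational_thresholds:
  fixes \<alpha> :: real and B :: nat
  assumes "0 < \<alpha>" "\<alpha> < 1"
  obtains pa pb qa :: nat where "0 < qa" "0 < pb" "real pa / real qa \<le> \<alpha>" "\<alpha> \<le> real pb / real qa"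
    "\<And>n m. 0 < n \<Longrightarrow> pa * n < m * qa \<Longrightarrow> m * qa \<le> pb * n \<Longrightarrow>
      qa \<le> pa * n \<and> B * n * (m - pa * n div qa) \<le> m * m"
proof (cases "\<alpha> \<in> \<rat>")
  case True
  then obtain a b :: nat where ab: "b \<noteq> 0" "\<bar>\<alpha>\<bar> = real a / real b"
    by (rule Rats_abs_nat_div_natE)
  have "a \<noteq> 0"
  proof
    assume "a = 0"
    then show False using ab assms by simp
  qed
  then have pos: "0 < b" "0 < a" using ab(1) by simp_all
  show ?thesis
  \<comment> \<open>For rational \<open>\<alpha>\<close> both thresholds equal
    \<open>\<alpha>\<close>, and the last condition is vacuous.\<close>
  proof (rule that[OF pos])
    show "real a / real b \<le> \<alpha>" "\<alpha> \<le> real a / real b" using ab assms by simp_all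
  qed simp
next
  case False
  \<comment> \<open>For larger \<open>n\<close> both \<open>2 \<le> \<alpha> n\<close> and
    \<open>8 B \<le> \<alpha>\<^sup>2 n\<close> hold: the first makes the lower bound at least 1,
    the second pays for rounding it to an integer.\<close>
  define n0 where "n0 = nat \<lceil>2 / \<alpha> + 8 * real B / \<alpha>\<^sup>2\<rceil>"
  \<comment> \<open>For \<open>n \<le> n0\<close> only finitely many ratios \<open>m / n\<close>
    matter, those up to 2 since \<open>y < 2\<close>, and the irrational \<open>\<alpha>\<close> has
    positive distance from all of them.\<close>
  define R where "R = (\<lambda>(m, n). real m / real n) ` ({..2 * n0} \<times> {1..n0})"
  have "finite R" by (simp add: R_def)
  then obtain d where d: "0 < d" "\<And>x. x \<in> R \<Longrightarrow> x \<noteq> \<alpha> \<Longrightarrow> d \<le> dist \<alpha> x"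
    using finite_set_avoid[of R \<alpha>] by blast
  define e where "e = \<alpha>\<^sup>2 / (16 * (real B + 1))"
  have e0: "0 < e" using assms by (simp add: e_def)
  define h where "h = Min {d, e, \<alpha> / 2, 1 :: real}"
  have h: "0 < h" "h \<le> d" "h \<le> e" "h \<le> \<alpha> / 2" "h \<le> 1"
    using d e0 assms by (auto simp: h_def)
  obtain x where x: "x \<in> \<rat>" "\<alpha> - h < x" "x < \<alpha>"
    using Rats_dense_in_real[of "\<alpha> - h" \<alpha>] h(1) by auto
  obtain y where y: "y \<in> \<rat>" "\<alpha> < y" "y < \<alpha> + h"
    using Rats_dense_in_real[of \<alpha> "\<alpha> + h"] h(1) by auto
  have xy: "\<alpha> / 2 < x" "y < 2" "y - x < 2 * e" "0 < x" "0 < y" using x y h assms by linarith+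
  obtain ma na :: nat where a: "na \<noteq> 0" "\<bar>x\<bar> = real ma / real na"
    using x(1) by (rule Rats_abs_nat_div_natE)
  obtain mb nb :: nat where b: "nb \<noteq> 0" "\<bar>y\<bar> = real mb / real nb"
    using y(1) by (rule Rats_abs_nat_div_natE)
  define pa where "pa = ma * nb"
  define pb where "pb = mb * na"
  define qa where "qa = na * nb"
  have qa: "0 < qa" using a b by (simp add: qa_def)
  have xa: "real pa = x * real qa" and yb: "real pb = y * real qa"
    using a b xy by (simp_all add: pa_def pb_def qa_def field_simps)
  have "0 < real pb" using yb xy qa by simp
  then have pb: "0 < pb" by simp
  show ?thesis
  proof (rule that[OF qa pb])
    show "real pa / real qa \<le> \<alpha>" "\<alpha> \<le> real pb / real qa" using x y qa by (simp_all add: xa yb)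
    fix n m :: nat
    assume n: "0 < n" and "pa * n < m * qa" and "m * qa \<le> pb * n"
    then have "real (pa * n) < real (m * qa)" "real (m * qa) \<le> real (pb * n)"
      by (simp_all only: of_nat_less_iff of_nat_le_iff)
    then have "real qa * (x * real n) < real qa * real m" "real qa * real m \<le> real qa * (y * real n)"
      by (simp_all add: xa yb mult_ac)
    then have m: "x * real n < real m" "real m \<le> y * real n" using qa by simp_all
    have "n0 < n"
    proof (rule ccontr)
      assume "\<not> n0 < n"
      then have "n \<le> n0" by simp
      have "y * real n \<le> 2 * real n" using xy by (intro mult_right_mono) simp_all
      then have "real m \<le> 2 * real n" using m(2) by linarith
      then have "m \<le> 2 * n0" using \<open>n \<le> n0\<close> by linarith
      then have "real m / real n \<in> R" using n \<open>n \<le> n0\<close> by (force simp: R_def)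
      moreover have "real m / real n \<noteq> \<alpha>" using False by (metis Rats_divide Rats_of_nat)
      ultimately have "d \<le> dist \<alpha> (real m / real n)" by (rule d(2))
      moreover have "x < real m / real n" "real m / real n \<le> y" using m n by (simp_all add: field_simps)
      ultimately show False using x y h by (simp add: dist_real_def)
    qed
    then have "2 / \<alpha> + 8 * real B / \<alpha>\<^sup>2 \<le> real n" unfolding n0_def by linarith
    moreover have "0 \<le> 8 * real B / \<alpha>\<^sup>2" "0 \<le> 2 / \<alpha>" using assms by simp_all
    ultimately have n1: "2 / \<alpha> \<le> real n" "8 * real B / \<alpha>\<^sup>2 \<le> real n" by linarith+
    have n2: "2 \<le> \<alpha> * real n" "8 * real B \<le> \<alpha>\<^sup>2 * real n"
      using n1 assms by (simp_all add: field_simps)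
    have xn: "\<alpha> / 2 * real n \<le> x * real n" using xy by (intro mult_right_mono) simp_all
    then have "1 \<le> x * real n" using n2 by linarith
    then have "real qa * 1 \<le> real qa * (x * real n)" by (intro mult_left_mono) simp_all
    then have "real qa \<le> real (pa * n)" by (simp add: xa mult_ac)
    then have 1: "qa \<le> pa * n" by (simp only: of_nat_le_iff)
    define k where "k = pa * n div qa"
    have "pa * n < (k + 1) * qa"
      using qa by (simp add: k_def dividend_less_div_times)
    then have "real (pa * n) < real ((k + 1) * qa)" by (simp only: of_nat_less_iff)
    then have "real qa * (x * real n) < real qa * (real k + 1)" by (simp add: xa algebra_simps)
    then have k: "x * real n < real k + 1" using qa by simp
    have "real (B * n * (m - k)) \<le> real (m * m)"
    proof (cases "k \<le> m")
      case True
      have "(y - x) * real n \<le> 2 * e * real n" using xy by (intro mult_right_mono) simp_all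
      then have "real (m - k) \<le> 2 * e * real n + 1"
        using True m k by (simp add: algebra_simps)
      then have "real B * real n * real (m - k) \<le> real B * real n * (2 * e * real n + 1)"
        by (intro mult_left_mono) simp_all
      also have "\<dots> = (real B * (2 * e)) * (real n * real n) + real B * real n" by (simp add: algebra_simps)
      \<comment> \<open>The width of the enclosure, through the choice of \<open>e\<close>, and the
        rounding each cost at most \<open>\<alpha>\<^sup>2 n\<^sup>2 / 8\<close>; together this is
        \<open>(\<alpha> n / 2)\<^sup>2\<close>.\<close>
      also have "\<dots> \<le> (\<alpha>\<^sup>2 / 8) * (real n * real n) + (\<alpha>\<^sup>2 * real n / 8) * real n"
      proof (intro add_mono mult_right_mono)
        have "real B * (\<alpha>\<^sup>2 * 2) \<le> (real B + 1) * (\<alpha>\<^sup>2 * 2)" by (intro mult_right_mono) simp_all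
        then show "real B * (2 * e) \<le> \<alpha>\<^sup>2 / 8" by (simp add: e_def field_simps)
      qed (use n2 in simp_all)
      also have "\<dots> = (\<alpha> / 2 * real n) * (\<alpha> / 2 * real n)" by (simp add: power2_eq_square)
      also have "\<dots> \<le> real m * real m"
        using xn m assms by (intro mult_mono) simp_all
      finally show ?thesis by simp
    qed simp
    then have "B * n * (m - k) \<le> m * m" by (simp only: of_nat_le_iff)
    then show "qa \<le> pa * n \<and> B * n * (m - pa * n div qa) \<le> m * m" using 1 by (simp add: k_def)
  qed
qed

section \<open>Choice of the constants and assembly\<close>

lemma card_neighbours_le_degree:
  assumes "finite E"
  shows "card {v\<in>A. {u, v} \<in> E} \<le> vertex_degree E u"
proof -
  have "card {v\<in>A. {u, v} \<in> E} = card ((\<lambda>v. {u, v}) ` {v\<in>A. {u, v} \<in> E})"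
    by (rule card_image[symmetric]) (auto simp: inj_on_def doubleton_eq_iff)
  also have "\<dots> \<le> card {e\<in>E. u \<in> e}" using assms by (intro card_mono) auto
  finally show ?thesis by (simp add: vertex_degree_def)
qed

theorem theorem2:
  fixes c1 c2 \<alpha> \<Delta> :: real
  assumes "c1 > c2" and "c2 > 1" and "0 < \<alpha>" and "\<alpha> < 1" and "\<Delta> > 0"
  shows "\<exists>\<gamma>>0. \<exists>P :: com. \<exists>p :: nat poly. \<forall>(n::nat) (E :: nat set set).
    simple_graph {..<n} E \<and> real (max_degree {..<n} E) \<le> \<Delta> \<and>
    real (card E) / real (card {..<n}) \<ge> c1 \<longrightarrow>
    (\<exists>t s. exec P (graph_input n E) t s \<and> t \<le> poly p n \<and>
      (let W = out_set n s in
         (out_tag s = 0 \<and> W \<noteq> {} \<and> real (card W) \<le> \<alpha> * real n \<and>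
            real (card (induced_edges E W)) \<ge> c2 * real (card W)) \<or>
         (out_tag s = 1 \<and> real (card W) \<ge> \<alpha> * real n \<and>
            expander \<gamma> W (induced_edges E W))))"
proof -
  \<comment> \<open>A length of \<open>2 / q\<close> fits between \<open>c2\<close> and
    \<open>c1\<close>: one \<open>1 / q\<close> for rounding \<open>c2\<close> up to
    \<open>p / q\<close>, another for the quadratic term of \<open>F(n) / n\<close>.\<close>
  define q where "q = nat \<lceil>2 / (c1 - c2)\<rceil>"
  define p where "p = nat \<lceil>real q * c2\<rceil>"
  \<comment> \<open>The added 1 keeps \<open>D\<close> positive even for
    \<open>\<Delta> < 1\<close>.\<close>
  define D where "D = nat \<lfloor>\<Delta>\<rfloor> + 1"
  have "0 < 2 / (c1 - c2)" using assms by simp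
  then have q0: "0 < q" and q2: "2 / (c1 - c2) \<le> real q" unfolding q_def by linarith+
  have q: "2 \<le> real q * (c1 - c2)" using q2 assms by (simp add: field_simps)
  have "0 \<le> real q * c2" using assms by simp
  then have p: "real q * c2 \<le> real p" "real p \<le> real q * c2 + 1" unfolding p_def by linarith+
  have D0: "0 < D" by (simp add: D_def)
  obtain pa pb qa :: nat where qa: "0 < qa" and pb: "0 < pb"
    and a: "real pa / real qa \<le> \<alpha>" and b: "\<alpha> \<le> real pb / real qa"
    and gap: "\<And>n m. 0 < n \<Longrightarrow> pa * n < m * qa \<Longrightarrow> m * qa \<le> pb * n \<Longrightarrow>
      qa \<le> pa * n \<and> q * D * n * (m - pa * n div qa) \<le> m * m"
    by (rule rational_thresholds[OF assms(3,4), of "q * D"]) (rule that; assumption)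
  \<comment> \<open>Since \<open>pb \<ge> 1\<close>, this choice meets
    \<open>q * qa \<le> K * pb\<close>.\<close>
  define K where "K = q * qa"
  define C where "C = 32 * D\<^sup>2 * K\<^sup>2"
  define \<gamma> where "\<gamma> = 1 / (64 * (real D)\<^sup>2 * (real K)\<^sup>2)"
  have K0: "0 < K" using q0 qa by (simp add: K_def)
  have \<gamma>: "0 < \<gamma>" using K0 D0 by (simp add: \<gamma>_def)
  define F where "F = algorithm.main D K C p q pa pb qa (4 * C + 4)"
  obtain P r where P: "\<And>s. \<exists>t s'. exec P s t s' \<and> t \<le> poly r (s 0 0) \<and> agree 9 s' (F s)"
    unfolding F_def by (rule algorithm.main_poly_time) blast
  show ?thesis
  proof (intro exI[of _ \<gamma>] conjI \<gamma> exI[of _ P] exI[of _ r] allI impI, elim conjE)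
    fix n :: nat and E :: "nat set set"
    assume G: "simple_graph {..<n} E" and maxdeg: "real (max_degree {..<n} E) \<le> \<Delta>"
      and "real (card E) / real (card {..<n}) \<ge> c1"
    \<comment> \<open>For \<open>n = 0\<close> the edge density is \<open>0 / 0 = 0\<close>, which
      is below \<open>c1\<close>.\<close>
    then have n0: "0 < n" and m: "c1 * real n \<le> real (card E)"
      using assms by (cases "n = 0"; simp add: field_simps)+
    have E: "e \<subseteq> {..<n}" "card e = 2" if "e \<in> E" for e
      using G that by (auto simp: simple_graph_def)
    have finE: "finite E" by (rule finite_subset[of _ "Pow {..<n}"]) (use E in auto)
    have deg: "card {v\<in>{..<n}. {u, v} \<in> E} \<le> D" if "u < n" for u
    proof -
      have "card {v\<in>{..<n}. {u, v} \<in> E} \<le> vertex_degree E u"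
        using finE by (rule card_neighbours_le_degree)
      also have "\<dots> \<le> max_degree {..<n} E" unfolding max_degree_def using that by (intro Max_ge) auto
      also have "\<dots> \<le> D" using maxdeg unfolding D_def by linarith
      finally show ?thesis .
    qed
    interpret algorithm_run D K C p q pa pb qa n E
    proof
      show "q * qa \<le> K * pb" using pb by (simp add: K_def)
    qed (use n0 D0 K0 deg in \<open>simp_all add: C_def\<close>)
    have pairs: "pairs E W W = 2 * card (induced_edges E W)" if "finite W" for W
      using that E(2) by (rule pairs_induced)
    have "dense {..<n}"
    proof -
      have "induced_edges E {..<n} = E" using E by (auto simp: induced_edges_def)
      then have *: "pairs E {..<n} {..<n} = 2 * card E" using pairs[of "{..<n}"] by simp
      \<comment> \<open>The whole vertex set qualifies because
        \<open>F(n) = (p + 1) n / q\<close>.\<close>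
      have "real p + 1 \<le> real q * c1" using p q by (simp add: algebra_simps)
      then have "(real p + 1) * real n \<le> real q * c1 * real n" by (intro mult_right_mono) simp_all
      also have "\<dots> \<le> real q * real (card E)"
        using mult_left_mono[OF m, of "real q"] by (simp add: mult_ac)
      finally have "real ((p + 1) * n) \<le> real (q * card E)" by (simp add: distrib_right)
      then have "(p + 1) * n \<le> q * card E" by (simp only: of_nat_le_iff)
      then have "2 * n * ((p + 1) * n) \<le> 2 * n * (q * card E)" by (rule mult_le_mono2)
      then show ?thesis by (simp add: dense_def * algebra_simps)
    qed
    then obtain U where U: "U \<subseteq> {..<n}" "U \<noteq> {}" "dense U"
      and out: "out_tag (F (graph_input n E)) = 0 \<and> qa * card U \<le> pb * n \<and>
         out_set n (F (graph_input n E)) = {u\<in>U. qa * card {w\<in>U. w \<le> u} \<le> pa * n} \<or>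
       out_tag (F (graph_input n E)) = 1 \<and> pb * n < qa * card U \<and> out_set n (F (graph_input n E)) = U \<and>
         expander \<gamma> U (induced_edges E U)"
      unfolding F_def \<gamma>_def using main_correct[OF _ refl] by blast
    have "graph_input n E 0 0 = n" by (simp add: graph_input_def)
    then obtain t s where run: "exec P (graph_input n E) t s" "t \<le> poly r n"
      and s: "agree 9 s (F (graph_input n E))"
      using P[of "graph_input n E"] by auto
    have tag: "out_tag s = out_tag (F (graph_input n E))" "out_set n s = out_set n (F (graph_input n E))"
      using s by (simp_all add: out_tag_def out_set_def agree_def)
    define W where "W = out_set n s"
    have finW: "finite W" by (simp add: W_def out_set_def)
    have "(out_tag s = 0 \<and> W \<noteq> {} \<and> real (card W) \<le> \<alpha> * real n \<and>
            real (card (induced_edges E W)) \<ge> c2 * real (card W)) \<or>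
         (out_tag s = 1 \<and> real (card W) \<ge> \<alpha> * real n \<and> expander \<gamma> W (induced_edges E W))"
      using out
    proof (elim disjE conjE)
      assume t0: "out_tag (F (graph_input n E)) = 0" and sm: "qa * card U \<le> pb * n"
        and "out_set n (F (graph_input n E)) = {u\<in>U. qa * card {w\<in>U. w \<le> u} \<le> pa * n}"
      then have W: "W = {u\<in>U. qa * card {w\<in>U. w \<le> u} \<le> pa * n}" by (simp add: W_def tag)
      note trimmed = trim[OF U sm qa gap[OF n0] W]
      have "real (qa * card W) \<le> real (pa * n)" using trimmed(2) by (simp only: of_nat_le_iff)
      then have "real (card W) \<le> real pa / real qa * real n" using qa by (simp add: field_simps)
      also have "\<dots> \<le> \<alpha> * real n" using a by (intro mult_right_mono) simp_all
      finally have 1: "real (card W) \<le> \<alpha> * real n" .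
      have "2 * (p * card W) \<le> 2 * (q * card (induced_edges E W))"
        using trimmed(3) by (simp add: pairs[OF finW] mult_ac)
      then have "p * card W \<le> q * card (induced_edges E W)" by simp
      then have "real (p * card W) \<le> real (q * card (induced_edges E W))" by (simp only: of_nat_le_iff)
      then have "real p * real (card W) \<le> real q * real (card (induced_edges E W))" by simp
      moreover have "real q * c2 * real (card W) \<le> real p * real (card W)"
        using p(1) by (intro mult_right_mono) simp_all
      ultimately have "real q * (c2 * real (card W)) \<le> real q * real (card (induced_edges E W))"
        by (simp add: mult.assoc)
      then have "c2 * real (card W) \<le> real (card (induced_edges E W))" using q0 by simp
      then show ?thesis using trimmed(1) 1 t0 tag by simp
    next
      assume t1: "out_tag (F (graph_input n E)) = 1" and big: "pb * n < qa * card U"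
        and "out_set n (F (graph_input n E)) = U" and ex: "expander \<gamma> U (induced_edges E U)"
      then have W: "W = U" by (simp add: W_def tag)
      have "real (pb * n) \<le> real (qa * card U)" using big by (simp only: of_nat_le_iff)
      then have "real pb / real qa * real n \<le> real (card U)" using qa by (simp add: field_simps)
      moreover have "\<alpha> * real n \<le> real pb / real qa * real n" using b by (intro mult_right_mono) simp_all
      ultimately show ?thesis using t1 ex tag W by simp
    qed
    then show "\<exists>t s. exec P (graph_input n E) t s \<and> t \<le> poly r n \<and>
      (let W = out_set n s in
         (out_tag s = 0 \<and> W \<noteq> {} \<and> real (card W) \<le> \<alpha> * real n \<and>
            real (card (induced_edges E W)) \<ge> c2 * real (card W)) \<or>
         (out_tag s = 1 \<and> real (card W) \<ge> \<alpha> * real n \<and>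
            expander \<gamma> W (induced_edges E W)))"
      using run unfolding W_def Let_def by blast
  qed
qed

end
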